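(* Let $(M,\phi_\alpha,\xi_\alpha,\eta_\alpha,g)$, $\alpha\in\{1,2,3\}$, be a $3$-quasi-Sasakian manifold. Then the $3$-dimensional distribution $\mathcal{V}$ generated by $\xi_1,\xi_2,\xi_3$ is integrable. Moreover, $\mathcal{V}$ defines a totally geodesic and Riemannian foliation of $M$ (i.e. its leaves are totally geodesic submanifolds of $(M,g)$, and the foliation is Riemannian with respect to $g$).
   Context: All manifolds are smooth and connected. Convention: $2u\wedge v=u\otimes v-v\otimes u$, so for a $1$-form $\eta$, $2d\eta(X,Y)=X(\eta(Y))-Y(\eta(X))-\eta([X,Y])$. An almost contact structure on an odd-dimensional manifold $M$ is a triple $(\phi,\xi,\eta)$ of a $(1,1)$-tensor field, a vector field (the Reeb vector field) and a $1$-form with $\phi^2=-I+\eta\otimes\xi$ and $\eta(\xi)=1$ (hence $\phi\xi=0$, $\eta\circ\phi=0$). It is normal if $N^{(1)}:=[\phi,\phi]+2d\eta\otimes\xi=0$, where $[\phi,\phi](X,Y)=\phi^2[X,Y]+[\phi X,\phi Y]-\phi[\phi X,Y]-\phi[X,\phi Y]$. A Riemannian metric $g$ is compatible if $g(\phi X,\phi Y)=g(X,Y)-\eta(X)\eta(Y)$; the fundamental $2$-form is $\Phi(X,Y)=g(X,\phi Y)$. An almost $3$-contact metric manifold is a $(4n+3)$-dimensional manifold $M$ with three almost contact structures $(\phi_\alpha,\xi_\alpha,\eta_\alpha)$, $\alpha\in\{1,2,3\}$, and a Riemannian metric $g$ compatible with each of them, such that for every even permutation $(\alpha,\beta,\gamma)$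 of $\{1,2,3\}$: $\phi_\gamma=\phi_\alpha\phi_\beta-\eta_\beta\otimes\xi_\alpha=-\phi_\beta\phi_\alpha+\eta_\alpha\otimes\xi_\beta$, $\xi_\gamma=\phi_\alpha\xi_\beta=-\phi_\beta\xi_\alpha$, $\eta_\gamma=\eta_\alpha\circ\phi_\beta=-\eta_\beta\circ\phi_\alpha$. It is hyper-normal if each of the three almost contact structures is normal. A $3$-quasi-Sasakian manifold is a hyper-normal almost $3$-contact metric manifold such that each fundamental $2$-form $\Phi_\alpha(X,Y)=g(X,\phi_\alpha Y)$ is closed. *)

theory Defs
  imports "HOL-Analysis.Analysis"
begin

section \<open>Smooth manifolds\<close>

text \<open>The Frechet derivative only depends on the values near the point, so for open U the
  function may be arbitrary outside of U.\<close>

primrec C_diff_on :: "nat \<Rightarrow> 'a::euclidean_space set \<Rightarrow> ('a \<Rightarrow> 'b::real_normed_vector) \<Rightarrow> bool" where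
  "C_diff_on 0 U f \<longleftrightarrow> continuous_on U f"
| "C_diff_on (Suc k) U f \<longleftrightarrow> (\<forall>x\<in>U. f differentiable (at x)) \<and>
     (\<forall>v. C_diff_on k U (\<lambda>x. frechet_derivative f (at x) v))"

definition smooth_on :: "'a::euclidean_space set \<Rightarrow> ('a \<Rightarrow> 'b::real_normed_vector) \<Rightarrow> bool" where
  "smooth_on U f \<longleftrightarrow> (\<forall>k. C_diff_on k U f)"

text \<open>A chart is a pair of its domain and its coordinate map; the dimension of a manifold is the
  dimension of the Euclidean model space in which the charts take their values.\<close>

type_synonym ('p, 'e) atlas = "('p set \<times> ('p \<Rightarrow> 'e)) set"

definition carrier :: "('p, 'e) atlas \<Rightarrow> 'p set" where
  "carrier A = (\<Union>(U, x)\<in>A. U)"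

definition smooth_manifold :: "'p topology \<Rightarrow> ('p, 'e::euclidean_space) atlas \<Rightarrow> bool" where
  "smooth_manifold T A \<longleftrightarrow>
     Hausdorff_space T \<and> second_countable T \<and> topspace T = carrier A \<and>
     (\<forall>(U, x)\<in>A. openin T U \<and> open (x ` U) \<and>
        homeomorphic_map (subtopology T U) (top_of_set (x ` U)) x) \<and>
     (\<forall>(U, x)\<in>A. \<forall>(V, y)\<in>A. smooth_on (x ` (U \<inter> V)) (y \<circ> inv_into U x))"

definition smooth_fun :: "('p, 'e::euclidean_space) atlas \<Rightarrow> ('p \<Rightarrow> real) \<Rightarrow> bool" where
  "smooth_fun A f \<longleftrightarrow> (\<forall>(U, x)\<in>A. smooth_on (x ` U) (f \<circ> inv_into U x))"

definition smooth_map ::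
  "('p, 'e::euclidean_space) atlas \<Rightarrow> ('q, 'k::euclidean_space) atlas \<Rightarrow> ('p \<Rightarrow> 'q) \<Rightarrow> bool" where
  "smooth_map A B F \<longleftrightarrow> F ` carrier A \<subseteq> carrier B \<and>
     (\<forall>(U, x)\<in>A. \<forall>(V, y)\<in>B. open (x ` (U \<inter> F -` V)) \<and>
        smooth_on (x ` (U \<inter> F -` V)) (y \<circ> F \<circ> inv_into U x))"


section \<open>Tangent vectors and vector fields\<close>

type_synonym 'p tangent = "('p \<Rightarrow> real) \<Rightarrow> real"
type_synonym 'p vfield = "'p \<Rightarrow> 'p tangent"

text \<open>Tangent vectors at p are the derivations at p of the algebra of smooth functions. The first
  two conditions fix the representation: a tangent vector does not see the values of a function
  outside of the manifold, and it is zero on functions that are not smooth. Hence equality of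
  tangent vectors is equality of HOL functions.\<close>

definition tangent_space :: "('p, 'e::euclidean_space) atlas \<Rightarrow> 'p \<Rightarrow> 'p tangent set" where
  "tangent_space A p = {v.
     (\<forall>f. \<not> smooth_fun A f \<longrightarrow> v f = 0) \<and>
     (\<forall>f h. smooth_fun A f \<and> smooth_fun A h \<and> (\<forall>q\<in>carrier A. f q = h q) \<longrightarrow> v f = v h) \<and>
     (\<forall>f h a b. smooth_fun A f \<and> smooth_fun A h \<longrightarrow>
        v (\<lambda>q. a * f q + b * h q) = a * v f + b * v h) \<and>
     (\<forall>f h. smooth_fun A f \<and> smooth_fun A h \<longrightarrow>
        v (\<lambda>q. f q * h q) = f p * v h + h p * v f)}"

text \<open>The differential of a smooth map F into the manifold with atlas B.\<close>

definition differential ::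
  "('q, 'k::euclidean_space) atlas \<Rightarrow> ('p \<Rightarrow> 'q) \<Rightarrow> 'p tangent \<Rightarrow> 'q tangent" where
  "differential B F w = (\<lambda>f. if smooth_fun B f then w (f \<circ> F) else 0)"

definition vector_field :: "('p, 'e::euclidean_space) atlas \<Rightarrow> 'p vfield \<Rightarrow> bool" where
  "vector_field A X \<longleftrightarrow> (\<forall>p\<in>carrier A. X p \<in> tangent_space A p) \<and>
     (\<forall>f. smooth_fun A f \<longrightarrow> smooth_fun A (\<lambda>p. X p f))"

definition lie_bracket :: "'p vfield \<Rightarrow> 'p vfield \<Rightarrow> 'p vfield" where
  "lie_bracket X Y = (\<lambda>p f. X p (\<lambda>q. Y q f) - Y p (\<lambda>q. X q f))"


section \<open>Tensor fields\<close>

definition one_form :: "('p, 'e::euclidean_space) atlas \<Rightarrow> ('p \<Rightarrow> 'p tangent \<Rightarrow> real) \<Rightarrow> bool" where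
  "one_form A \<eta> \<longleftrightarrow>
     (\<forall>p\<in>carrier A. \<forall>u\<in>tangent_space A p. \<forall>v\<in>tangent_space A p. \<forall>a b.
        \<eta> p (\<lambda>f. a * u f + b * v f) = a * \<eta> p u + b * \<eta> p v) \<and>
     (\<forall>X. vector_field A X \<longrightarrow> smooth_fun A (\<lambda>p. \<eta> p (X p)))"

definition tensor_field_1_1 ::
  "('p, 'e::euclidean_space) atlas \<Rightarrow> ('p \<Rightarrow> 'p tangent \<Rightarrow> 'p tangent) \<Rightarrow> bool" where
  "tensor_field_1_1 A \<phi> \<longleftrightarrow>
     (\<forall>p\<in>carrier A. \<forall>u\<in>tangent_space A p. \<phi> p u \<in> tangent_space A p) \<and>
     (\<forall>p\<in>carrier A. \<forall>u\<in>tangent_space A p. \<forall>v\<in>tangent_space A p. \<forall>a b.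
        \<phi> p (\<lambda>f. a * u f + b * v f) = (\<lambda>f. a * \<phi> p u f + b * \<phi> p v f)) \<and>
     (\<forall>X. vector_field A X \<longrightarrow> vector_field A (\<lambda>p. \<phi> p (X p)))"

definition riemannian_metric ::
  "('p, 'e::euclidean_space) atlas \<Rightarrow> ('p \<Rightarrow> 'p tangent \<Rightarrow> 'p tangent \<Rightarrow> real) \<Rightarrow> bool" where
  "riemannian_metric A g \<longleftrightarrow>
     (\<forall>p\<in>carrier A. \<forall>u\<in>tangent_space A p. \<forall>v\<in>tangent_space A p. g p u v = g p v u) \<and>
     (\<forall>p\<in>carrier A. \<forall>u\<in>tangent_space A p. \<forall>v\<in>tangent_space A p. \<forall>w\<in>tangent_space A p. \<forall>a b.
        g p (\<lambda>f. a * u f + b * v f) w = a * g p u w + b * g p v w) \<and>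
     (\<forall>p\<in>carrier A. \<forall>u\<in>tangent_space A p. u \<noteq> (\<lambda>f. 0) \<longrightarrow> g p u u > 0) \<and>
     (\<forall>X Y. vector_field A X \<and> vector_field A Y \<longrightarrow> smooth_fun A (\<lambda>p. g p (X p) (Y p)))"

text \<open>Exterior derivatives of a 1-form and of a 2-form, in the normalisation that belongs to
  2 (u \<open>\<and>\<close> v) = u \<open>\<otimes>\<close> v - v \<open>\<otimes>\<close> u: the invariant formula carries the factor 1/(r+1) for r-forms.\<close>

definition ext_deriv1 :: "('p \<Rightarrow> 'p tangent \<Rightarrow> real) \<Rightarrow> 'p vfield \<Rightarrow> 'p vfield \<Rightarrow> 'p \<Rightarrow> real" where
  "ext_deriv1 \<eta> X Y p = (1 / 2) *
     (X p (\<lambda>q. \<eta> q (Y q)) - Y p (\<lambda>q. \<eta> q (X q)) - \<eta> p (lie_bracket X Y p))"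

definition ext_deriv2 ::
  "('p \<Rightarrow> 'p tangent \<Rightarrow> 'p tangent \<Rightarrow> real) \<Rightarrow> 'p vfield \<Rightarrow> 'p vfield \<Rightarrow> 'p vfield \<Rightarrow> 'p \<Rightarrow> real" where
  "ext_deriv2 \<omega> X Y Z p = (1 / 3) *
     (X p (\<lambda>q. \<omega> q (Y q) (Z q)) + Y p (\<lambda>q. \<omega> q (Z q) (X q)) + Z p (\<lambda>q. \<omega> q (X q) (Y q))
      - \<omega> p (lie_bracket X Y p) (Z p) - \<omega> p (lie_bracket Y Z p) (X p)
      - \<omega> p (lie_bracket Z X p) (Y p))"

definition closed_2_form ::
  "('p, 'e::euclidean_space) atlas \<Rightarrow> ('p \<Rightarrow> 'p tangent \<Rightarrow> 'p tangent \<Rightarrow> real) \<Rightarrow> bool" where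
  "closed_2_form A \<omega> \<longleftrightarrow> (\<forall>X Y Z. vector_field A X \<and> vector_field A Y \<and> vector_field A Z \<longrightarrow>
     (\<forall>p\<in>carrier A. ext_deriv2 \<omega> X Y Z p = 0))"


section \<open>3-quasi-Sasakian manifolds\<close>

definition almost_contact_structure ::
  "('p, 'e::euclidean_space) atlas \<Rightarrow> ('p \<Rightarrow> 'p tangent \<Rightarrow> 'p tangent) \<Rightarrow> 'p vfield \<Rightarrow>
   ('p \<Rightarrow> 'p tangent \<Rightarrow> real) \<Rightarrow> bool" where
  "almost_contact_structure A \<phi> \<xi> \<eta> \<longleftrightarrow>
     tensor_field_1_1 A \<phi> \<and> vector_field A \<xi> \<and> one_form A \<eta> \<and>
     (\<forall>p\<in>carrier A. \<forall>v\<in>tangent_space A p. \<phi> p (\<phi> p v) = (\<lambda>f. - v f + \<eta> p v * \<xi> p f)) \<and>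
     (\<forall>p\<in>carrier A. \<eta> p (\<xi> p) = 1)"

definition nijenhuis ::
  "('p \<Rightarrow> 'p tangent \<Rightarrow> 'p tangent) \<Rightarrow> 'p vfield \<Rightarrow> 'p vfield \<Rightarrow> 'p vfield" where
  "nijenhuis \<phi> X Y = (\<lambda>p f.
     \<phi> p (\<phi> p (lie_bracket X Y p)) f
     + lie_bracket (\<lambda>q. \<phi> q (X q)) (\<lambda>q. \<phi> q (Y q)) p f
     - \<phi> p (lie_bracket (\<lambda>q. \<phi> q (X q)) Y p) f
     - \<phi> p (lie_bracket X (\<lambda>q. \<phi> q (Y q)) p) f)"

definition normal_structure ::
  "('p, 'e::euclidean_space) atlas \<Rightarrow> ('p \<Rightarrow> 'p tangent \<Rightarrow> 'p tangent) \<Rightarrow> 'p vfield \<Rightarrow>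
   ('p \<Rightarrow> 'p tangent \<Rightarrow> real) \<Rightarrow> bool" where
  "normal_structure A \<phi> \<xi> \<eta> \<longleftrightarrow> (\<forall>X Y. vector_field A X \<and> vector_field A Y \<longrightarrow>
     (\<forall>p\<in>carrier A. \<forall>f. nijenhuis \<phi> X Y p f + 2 * ext_deriv1 \<eta> X Y p * \<xi> p f = 0))"

definition compatible_metric ::
  "('p, 'e::euclidean_space) atlas \<Rightarrow> ('p \<Rightarrow> 'p tangent \<Rightarrow> 'p tangent) \<Rightarrow>
   ('p \<Rightarrow> 'p tangent \<Rightarrow> real) \<Rightarrow> ('p \<Rightarrow> 'p tangent \<Rightarrow> 'p tangent \<Rightarrow> real) \<Rightarrow> bool" where
  "compatible_metric A \<phi> \<eta> g \<longleftrightarrow>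
     (\<forall>p\<in>carrier A. \<forall>u\<in>tangent_space A p. \<forall>v\<in>tangent_space A p.
        g p (\<phi> p u) (\<phi> p v) = g p u v - \<eta> p u * \<eta> p v)"

definition fundamental_form ::
  "('p \<Rightarrow> 'p tangent \<Rightarrow> 'p tangent) \<Rightarrow> ('p \<Rightarrow> 'p tangent \<Rightarrow> 'p tangent \<Rightarrow> real) \<Rightarrow>
   'p \<Rightarrow> 'p tangent \<Rightarrow> 'p tangent \<Rightarrow> real" where
  "fundamental_form \<phi> g = (\<lambda>p u v. g p u (\<phi> p v))"

text \<open>The three structures are indexed by the natural numbers 1, 2, 3; the values at other indices
  are irrelevant. The triples below are the even permutations of 1, 2, 3.\<close>

definition almost_3_contact_metric_manifold ::
  "nat \<Rightarrow> 'p topology \<Rightarrow> ('p, 'e::euclidean_space) atlas \<Rightarrow>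
   (nat \<Rightarrow> 'p \<Rightarrow> 'p tangent \<Rightarrow> 'p tangent) \<Rightarrow> (nat \<Rightarrow> 'p vfield) \<Rightarrow>
   (nat \<Rightarrow> 'p \<Rightarrow> 'p tangent \<Rightarrow> real) \<Rightarrow> ('p \<Rightarrow> 'p tangent \<Rightarrow> 'p tangent \<Rightarrow> real) \<Rightarrow> bool" where
  "almost_3_contact_metric_manifold n T A \<phi> \<xi> \<eta> g \<longleftrightarrow>
     smooth_manifold T A \<and> connected_space T \<and> DIM('e) = 4 * n + 3 \<and>
     riemannian_metric A g \<and>
     (\<forall>\<alpha>\<in>{1, 2, 3}. almost_contact_structure A (\<phi> \<alpha>) (\<xi> \<alpha>) (\<eta> \<alpha>) \<and>
        compatible_metric A (\<phi> \<alpha>) (\<eta> \<alpha>) g) \<and>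
     (\<forall>(\<alpha>, \<beta>, \<gamma>)\<in>{(1, 2, 3), (2, 3, 1), (3, 1, 2)}. \<forall>p\<in>carrier A.
        (\<forall>v\<in>tangent_space A p.
           \<phi> \<gamma> p v = (\<lambda>f. \<phi> \<alpha> p (\<phi> \<beta> p v) f - \<eta> \<beta> p v * \<xi> \<alpha> p f) \<and>
           \<phi> \<gamma> p v = (\<lambda>f. - \<phi> \<beta> p (\<phi> \<alpha> p v) f + \<eta> \<alpha> p v * \<xi> \<beta> p f)) \<and>
        \<xi> \<gamma> p = \<phi> \<alpha> p (\<xi> \<beta> p) \<and>
        \<xi> \<gamma> p = (\<lambda>f. - \<phi> \<beta> p (\<xi> \<alpha> p) f) \<and>
        (\<forall>v\<in>tangent_space A p.
           \<eta> \<gamma> p v = \<eta> \<alpha> p (\<phi> \<beta> p v) \<and>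
           \<eta> \<gamma> p v = - \<eta> \<beta> p (\<phi> \<alpha> p v)))"

definition three_quasi_sasakian_manifold ::
  "nat \<Rightarrow> 'p topology \<Rightarrow> ('p, 'e::euclidean_space) atlas \<Rightarrow>
   (nat \<Rightarrow> 'p \<Rightarrow> 'p tangent \<Rightarrow> 'p tangent) \<Rightarrow> (nat \<Rightarrow> 'p vfield) \<Rightarrow>
   (nat \<Rightarrow> 'p \<Rightarrow> 'p tangent \<Rightarrow> real) \<Rightarrow> ('p \<Rightarrow> 'p tangent \<Rightarrow> 'p tangent \<Rightarrow> real) \<Rightarrow> bool" where
  "three_quasi_sasakian_manifold n T A \<phi> \<xi> \<eta> g \<longleftrightarrow>
     almost_3_contact_metric_manifold n T A \<phi> \<xi> \<eta> g \<and>
     (\<forall>\<alpha>\<in>{1, 2, 3}. normal_structure A (\<phi> \<alpha>) (\<xi> \<alpha>) (\<eta> \<alpha>)) \<and>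
     (\<forall>\<alpha>\<in>{1, 2, 3}. closed_2_form A (fundamental_form (\<phi> \<alpha>) g))"

definition reeb_distribution :: "(nat \<Rightarrow> 'p vfield) \<Rightarrow> 'p \<Rightarrow> 'p tangent set" where
  "reeb_distribution \<xi> p = {v. \<exists>a::nat \<Rightarrow> real. v = (\<lambda>f. \<Sum>\<alpha>\<in>{1, 2, 3}. a \<alpha> * \<xi> \<alpha> p f)}"


section \<open>Integral manifolds and foliations\<close>

text \<open>An immersed submanifold is a subset S with its own manifold structure (topology S, atlas B)
  for which the inclusion is an immersion; its topology may be finer than the subspace topology.\<close>

definition immersed_submanifold ::
  "('p, 'e::euclidean_space) atlas \<Rightarrow> 'p topology \<Rightarrow> ('p, 'k::euclidean_space) atlas \<Rightarrow> bool" where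
  "immersed_submanifold A S B \<longleftrightarrow> smooth_manifold S B \<and> smooth_map B A id \<and>
     (\<forall>p\<in>carrier B. inj_on (differential A id) (tangent_space B p))"

definition submanifold_tangent_space ::
  "('p, 'e::euclidean_space) atlas \<Rightarrow> ('p, 'k::euclidean_space) atlas \<Rightarrow> 'p \<Rightarrow> 'p tangent set" where
  "submanifold_tangent_space A B p = differential A id ` tangent_space B p"

definition integral_manifold ::
  "('p, 'e::euclidean_space) atlas \<Rightarrow> ('p \<Rightarrow> 'p tangent set) \<Rightarrow>
   'p topology \<Rightarrow> ('p, 'k::euclidean_space) atlas \<Rightarrow> bool" where
  "integral_manifold A D S B \<longleftrightarrow> immersed_submanifold A S B \<and>
     (\<forall>p\<in>carrier B. submanifold_tangent_space A B p = D p)"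

text \<open>The type argument is the model space of the integral manifolds, so its dimension is the rank
  of the distribution.\<close>

definition integrable_distribution ::
  "'k::euclidean_space itself \<Rightarrow> ('p, 'e::euclidean_space) atlas \<Rightarrow>
   ('p \<Rightarrow> 'p tangent set) \<Rightarrow> bool" where
  "integrable_distribution K A D \<longleftrightarrow> (\<forall>p\<in>carrier A. \<exists>S. \<exists>B::('p, 'k) atlas.
     integral_manifold A D S B \<and> p \<in> carrier B)"

definition levi_civita_connection ::
  "('p, 'e::euclidean_space) atlas \<Rightarrow> ('p \<Rightarrow> 'p tangent \<Rightarrow> 'p tangent \<Rightarrow> real) \<Rightarrow>
   ('p vfield \<Rightarrow> 'p vfield \<Rightarrow> 'p vfield) \<Rightarrow> bool" where
  "levi_civita_connection A g nabla \<longleftrightarrow>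
     (\<forall>X Y. vector_field A X \<and> vector_field A Y \<longrightarrow> vector_field A (nabla X Y)) \<and>
     (\<forall>X Y Z h k. vector_field A X \<and> vector_field A Y \<and> vector_field A Z \<and>
        smooth_fun A h \<and> smooth_fun A k \<longrightarrow> (\<forall>p\<in>carrier A. \<forall>f.
        nabla (\<lambda>q u. h q * X q u + k q * Y q u) Z p f = h p * nabla X Z p f + k p * nabla Y Z p f)) \<and>
     (\<forall>X Y Z. vector_field A X \<and> vector_field A Y \<and> vector_field A Z \<longrightarrow> (\<forall>p\<in>carrier A. \<forall>f.
        nabla X (\<lambda>q u. Y q u + Z q u) p f = nabla X Y p f + nabla X Z p f)) \<and>
     (\<forall>X Y h. vector_field A X \<and> vector_field A Y \<and> smooth_fun A h \<longrightarrow> (\<forall>p\<in>carrier A. \<forall>f.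
        nabla X (\<lambda>q u. h q * Y q u) p f = X p h * Y p f + h p * nabla X Y p f)) \<and>
     (\<forall>X Y. vector_field A X \<and> vector_field A Y \<longrightarrow> (\<forall>p\<in>carrier A. \<forall>f.
        nabla X Y p f - nabla Y X p f = lie_bracket X Y p f)) \<and>
     (\<forall>X Y Z. vector_field A X \<and> vector_field A Y \<and> vector_field A Z \<longrightarrow> (\<forall>p\<in>carrier A.
        X p (\<lambda>q. g q (Y q) (Z q)) = g p (nabla X Y p) (Z p) + g p (Y p) (nabla X Z p)))"

text \<open>Vanishing of the second fundamental form of an immersed submanifold: for vector fields X, Y
  of the ambient manifold that extend fields tangent to the submanifold near p, the normal component
  of the covariant derivative of Y along X is zero at p. The extensions are only required to be
  tangent on a neighbourhood W of p in the topology of the submanifold, since an immersed submanifold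
  may accumulate on itself. The Levi-Civita connection of g exists and is unique on the carrier.\<close>

definition totally_geodesic ::
  "('p, 'e::euclidean_space) atlas \<Rightarrow> ('p \<Rightarrow> 'p tangent \<Rightarrow> 'p tangent \<Rightarrow> real) \<Rightarrow>
   'p topology \<Rightarrow> ('p, 'k::euclidean_space) atlas \<Rightarrow> bool" where
  "totally_geodesic A g S B \<longleftrightarrow> (\<forall>nabla. levi_civita_connection A g nabla \<longrightarrow>
     (\<forall>W X Y. openin S W \<and> vector_field A X \<and> vector_field A Y \<and>
        (\<forall>q\<in>W. X q \<in> submanifold_tangent_space A B q \<and> Y q \<in> submanifold_tangent_space A B q) \<longrightarrow>
        (\<forall>p\<in>W. nabla X Y p \<in> submanifold_tangent_space A B p)))"

text \<open>The leaves are the maximal connected integral manifolds. Quantifying over all integral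
  manifolds includes the leaves, and says no more, since integral manifolds of an integrable
  distribution are locally open in leaves and total geodesy is a local property.\<close>

definition totally_geodesic_foliation ::
  "'k::euclidean_space itself \<Rightarrow> ('p, 'e::euclidean_space) atlas \<Rightarrow>
   ('p \<Rightarrow> 'p tangent \<Rightarrow> 'p tangent \<Rightarrow> real) \<Rightarrow> ('p \<Rightarrow> 'p tangent set) \<Rightarrow> bool" where
  "totally_geodesic_foliation K A g D \<longleftrightarrow>
     (\<forall>S. \<forall>B::('p, 'k) atlas. integral_manifold A D S B \<longrightarrow> totally_geodesic A g S B)"

definition lie_derivative_metric ::
  "('p \<Rightarrow> 'p tangent \<Rightarrow> 'p tangent \<Rightarrow> real) \<Rightarrow> 'p vfield \<Rightarrow> 'p vfield \<Rightarrow> 'p vfield \<Rightarrow> 'p \<Rightarrow> real" where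
  "lie_derivative_metric g V X Y p = V p (\<lambda>q. g q (X q) (Y q))
     - g p (lie_bracket V X p) (Y p) - g p (X p) (lie_bracket V Y p)"

text \<open>The foliation is Riemannian with respect to g (g is bundle-like) if the metric that g induces
  on the normal bundle is invariant along the leaves, i.e. has vanishing Lie derivative along all
  tangent fields. The normal bundle is identified with the orthogonal complement of D.\<close>

definition riemannian_foliation ::
  "('p, 'e::euclidean_space) atlas \<Rightarrow> ('p \<Rightarrow> 'p tangent \<Rightarrow> 'p tangent \<Rightarrow> real) \<Rightarrow>
   ('p \<Rightarrow> 'p tangent set) \<Rightarrow> bool" where
  "riemannian_foliation A g D \<longleftrightarrow> (\<forall>V X Y.
     vector_field A V \<and> vector_field A X \<and> vector_field A Y \<and>
     (\<forall>p\<in>carrier A. V p \<in> D p \<and> (\<forall>u\<in>D p. g p (X p) u = 0 \<and> g p (Y p) u = 0)) \<longrightarrow>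
     (\<forall>p\<in>carrier A. lie_derivative_metric g V X Y p = 0))"

end

theory Submission
  imports Defs "HOL-Computational_Algebra.Polynomial"
begin

text \<open>Normality gives that the Lie derivative along a Reeb field \<open>\<xi>\<close> annihilates \<open>\<eta>\<close> and \<open>\<phi>\<close>;
  with \<open>d\<Phi> = 0\<close> and \<open>\<phi> \<xi> = 0\<close> it annihilates \<open>\<Phi>\<close>, so that \<open>\<xi>\<close> is Killing. Evaluating
  \<open>d\<Phi>\<close> of one structure on the Reeb fields of the other two and a third field shows that their
  bracket is a multiple of the remaining Reeb field, so the distribution is involutive. The Killing
  property gives the Riemannian foliation at once, and together with the orthonormality of the Reeb
  fields it shows that the covariant derivative of one Reeb field along another is half their
  bracket, hence vertical.

  Integrability is the Frobenius theorem. In a chart, a linear projection P onto \<open>\<real>\<^sup>3\<close> that is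
  injective on the distribution normalises it to fields \<open>Y(z) s\<close> with \<open>P (Y(z) s) = s\<close>;
  involutivity makes these commute. The total differential equation \<open>F'(s) = Y(F(s))\<close> is solved
  along the rays from the origin by a contraction argument; commutation yields a differential
  inequality for the error of the first order expansion of F, which shows that F is differentiable
  with the right derivative in all directions, and smoothness follows by bootstrapping.\<close>

section \<open>Calculus of smooth maps\<close>

text \<open>A tangent vector is a derivation of globally defined functions, so chart computations
  need bump functions that extend chart data to the manifold, and Hadamard's lemma that turns a
  derivation into a coordinate vector. In the Frobenius argument F is the fixed point of one
  contraction on functions of the whole parameter space, so all rays are solved at once and F is
  continuous; differentiability across the rays is the open point, and there the commutation enters.
  For the geodesic part it is not enough that Reeb fields have vertical derivatives along each
  other: the definition admits fields X, Y that are tangent to the distribution only on a piece W of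
  one leaf, so Y cannot be replaced by a combination of Reeb fields near p in M. Instead the
  derivative of Y along X is paired with a horizontal field Z. Metric compatibility moves the
  derivative to Z and then to the Reeb fields, where X and Y enter only through their values at p;
  the remaining term X(g(Y, Z)) differentiates, along the leaf, a function that vanishes on
  W.\<close>

lemma frechet_derivative_cong:
  assumes "open U" "x \<in> U" "\<And>y. y \<in> U \<Longrightarrow> f y = g y"
  shows "frechet_derivative f (at x) = frechet_derivative g (at x)"
proof -
  have "(f has_derivative D) (at x) \<longleftrightarrow> (g has_derivative D) (at x)" for D
    using assms has_derivative_transform_within_open[of f D x UNIV U g]
      has_derivative_transform_within_open[of g D x UNIV U f] by auto
  then show ?thesis
    by (simp add: frechet_derivative_def)
qed

lemma differentiable_cong:
  assumes "open U" "x \<in> U" "\<And>y. y \<in> U \<Longrightarrow> f y = g y" "f differentiable (at x)"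
  shows "g differentiable (at x)"
  using assms has_derivative_transform_within_open[of f _ x UNIV U g]
  unfolding differentiable_def by blast

lemma C_diff_on_differentiable:
  assumes "C_diff_on (Suc k) U f" "x \<in> U"
  shows "(f has_derivative frechet_derivative f (at x)) (at x)"
  by (rule frechet_derivative_works[THEN iffD1]) (use assms in simp)

lemma C_diff_on_SucD:
  assumes "C_diff_on (Suc k) U f"
  shows "C_diff_on k U f"
  using assms
proof (induction k arbitrary: f)
  case 0
  then have "f differentiable_on U"
    using differentiable_at_withinI unfolding differentiable_on_def C_diff_on.simps by blast
  then show ?case using differentiable_imp_continuous_on by simp
next
  case (Suc k)
  have "C_diff_on (Suc k) U (\<lambda>x. frechet_derivative f (at x) v)" for v
    using Suc.prems unfolding C_diff_on.simps(2)[of "Suc k"] by blast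
  from Suc.IH[OF this] show ?case
    using Suc.prems unfolding C_diff_on.simps(2) by blast
qed

lemma C_diff_on_mono:
  assumes "C_diff_on k U f" "j \<le> k"
  shows "C_diff_on j U f"
  using assms(2,1) by (induction rule: dec_induct) (simp only:, metis C_diff_on_SucD)

lemma C_diff_on_cong:
  assumes "open U" "\<And>y. y \<in> U \<Longrightarrow> f y = g y" "C_diff_on k U f"
  shows "C_diff_on k U g"
  using assms(2,3)
proof (induction k arbitrary: f g)
  case 0
  then show ?case using continuous_on_cong[of U U f g] by simp
next
  case (Suc k)
  have "C_diff_on k U (\<lambda>x. frechet_derivative g (at x) v)" for v
  proof (rule Suc.IH)
    show "frechet_derivative f (at y) v = frechet_derivative g (at y) v" if "y \<in> U" for y
      using frechet_derivative_cong[OF assms(1) that Suc.prems(1)] by simp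
    show "C_diff_on k U (\<lambda>x. frechet_derivative f (at x) v)"
      using Suc.prems by simp
  qed
  moreover have "g differentiable (at x)" if "x \<in> U" for x
    using differentiable_cong[OF assms(1) that Suc.prems(1)] Suc.prems(2) that by simp
  ultimately show ?case by simp
qed

lemma C_diff_on_subset:
  assumes "C_diff_on k U f" "V \<subseteq> U"
  shows "C_diff_on k V f"
  using assms(1)
proof (induction k arbitrary: f)
  case 0
  then show ?case using assms(2) continuous_on_subset by auto
next
  case (Suc k)
  then show ?case using assms(2) by (simp add: subset_iff)
qed

lemma C_diff_on_local:
  assumes "\<And>x. x \<in> U \<Longrightarrow> \<exists>V. open V \<and> x \<in> V \<and> C_diff_on k V f"
  shows "C_diff_on k U f"
  using assms
proof (induction k arbitrary: f)
  case 0
  have "isCont f x" if "x \<in> U" for x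
    using 0[OF that] by (auto simp: continuous_on_eq_continuous_at)
  then show ?case by (simp add: continuous_at_imp_continuous_on)
next
  case (Suc k)
  have loc: "\<exists>V. open V \<and> x \<in> V \<and> (\<forall>x\<in>V. f differentiable (at x)) \<and>
      (\<forall>v. C_diff_on k V (\<lambda>x. frechet_derivative f (at x) v))" if "x \<in> U" for x
    using Suc.prems[OF that] by simp
  have "C_diff_on k U (\<lambda>x. frechet_derivative f (at x) v)" for v
    by (rule Suc.IH) (use loc in blast)
  moreover have "f differentiable (at x)" if "x \<in> U" for x
    using loc[OF that] by blast
  ultimately show ?case by simp
qed

lemma C_diff_on_const: "C_diff_on k U (\<lambda>x. c)"
  by (induction k arbitrary: c) (simp_all add: frechet_derivative_const)

lemma C_diff_on_add:
  assumes "C_diff_on k U f" "C_diff_on k U g" "open U"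
  shows "C_diff_on k U (\<lambda>x. f x + g x)"
  using assms(1,2)
proof (induction k arbitrary: f g)
  case 0
  then show ?case by (simp add: continuous_on_add)
next
  case (Suc k)
  have "C_diff_on k U (\<lambda>x. frechet_derivative (\<lambda>x. f x + g x) (at x) v)" for v
  proof (rule C_diff_on_cong[OF assms(3) _ Suc.IH])
    show "frechet_derivative f (at y) v + frechet_derivative g (at y) v
        = frechet_derivative (\<lambda>x. f x + g x) (at y) v" if "y \<in> U" for y
      using fun_cong[OF frechet_derivative_at[OF has_derivative_add[OF
            C_diff_on_differentiable[OF Suc.prems(1) that]
            C_diff_on_differentiable[OF Suc.prems(2) that]]], of v] by simp
  qed (use Suc.prems in auto)
  then show ?case using Suc.prems by simp
qed

lemma C_diff_on_bilinear:
  assumes "bounded_bilinear pr" "C_diff_on k U f" "C_diff_on k U g" "open U"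
  shows "C_diff_on k U (\<lambda>x. pr (f x) (g x))"
  using assms(2,3)
proof (induction k arbitrary: f g)
  case 0
  then show ?case using bounded_bilinear.continuous_on[OF assms(1)] by simp
next
  case (Suc k)
  have hd: "((\<lambda>x. pr (f x) (g x)) has_derivative
      (\<lambda>v. pr (f y) (frechet_derivative g (at y) v) + pr (frechet_derivative f (at y) v) (g y))) (at y)"
    if "y \<in> U" for y
    using bounded_bilinear.FDERIV[OF assms(1) C_diff_on_differentiable[OF Suc.prems(1) that]
            C_diff_on_differentiable[OF Suc.prems(2) that]] .
  have "C_diff_on k U (\<lambda>x. frechet_derivative (\<lambda>x. pr (f x) (g x)) (at x) v)" for v
  proof (rule C_diff_on_cong[OF assms(4)])
    show "pr (f y) (frechet_derivative g (at y) v) + pr (frechet_derivative f (at y) v) (g y)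
        = frechet_derivative (\<lambda>x. pr (f x) (g x)) (at y) v" if "y \<in> U" for y
      using fun_cong[OF frechet_derivative_at[OF hd[OF that]], of v] by simp
    show "C_diff_on k U (\<lambda>y. pr (f y) (frechet_derivative g (at y) v)
        + pr (frechet_derivative f (at y) v) (g y))"
      by (intro C_diff_on_add Suc.IH assms(4))
        (use Suc.prems C_diff_on_SucD[OF Suc.prems(1)] C_diff_on_SucD[OF Suc.prems(2)] in auto)
  qed
  moreover have "(\<lambda>x. pr (f x) (g x)) differentiable (at y)" if "y \<in> U" for y
    using hd[OF that] differentiable_def by blast
  ultimately show ?case by simp
qed

lemma C_diff_on_linear:
  assumes "bounded_linear L" "C_diff_on k U f" "open U"
  shows "C_diff_on k U (\<lambda>x. L (f x))"
  using assms(2)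
proof (induction k arbitrary: f)
  case 0
  then show ?case using bounded_linear.continuous_on[OF assms(1)] by simp
next
  case (Suc k)
  have hd: "((\<lambda>x. L (f x)) has_derivative (\<lambda>v. L (frechet_derivative f (at y) v))) (at y)"
    if "y \<in> U" for y
    using bounded_linear.has_derivative[OF assms(1) C_diff_on_differentiable[OF Suc.prems that]] .
  have "C_diff_on k U (\<lambda>x. frechet_derivative (\<lambda>x. L (f x)) (at x) v)" for v
  proof (rule C_diff_on_cong[OF assms(3)])
    show "L (frechet_derivative f (at y) v) = frechet_derivative (\<lambda>x. L (f x)) (at y) v" if "y \<in> U" for y
      using fun_cong[OF frechet_derivative_at[OF hd[OF that]], of v] by simp
    show "C_diff_on k U (\<lambda>y. L (frechet_derivative f (at y) v))"
      by (intro Suc.IH) (use Suc.prems in auto)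
  qed
  moreover have "(\<lambda>x. L (f x)) differentiable (at y)" if "y \<in> U" for y
    using hd[OF that] differentiable_def by blast
  ultimately show ?case by simp
qed

lemma C_diff_on_ident: "C_diff_on k (U::'a::euclidean_space set) (\<lambda>x. x)"
proof (cases k)
  case (Suc j)
  have "frechet_derivative (\<lambda>x::'a. x) (at x) v = v" for x v :: 'a
    by (simp add: frechet_derivative_ident)
  then show ?thesis using Suc by (simp add: C_diff_on_const)
qed simp

lemma C_diff_on_sum:
  fixes f :: "'i \<Rightarrow> 'a::euclidean_space \<Rightarrow> 'b::real_normed_vector"
  assumes "\<And>i. i \<in> I \<Longrightarrow> C_diff_on k U (f i)" "open U"
  shows "C_diff_on k U (\<lambda>x. \<Sum>i\<in>I. f i x)"
  using assms(1)
  by (induction I rule: infinite_finite_induct) (auto simp: C_diff_on_const assms(2) intro: C_diff_on_add)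

lemma linear_sum_Basis:
  fixes D :: "'a::euclidean_space \<Rightarrow> 'b::real_vector"
  assumes "linear D"
  shows "D v = (\<Sum>i\<in>Basis. (v \<bullet> i) *\<^sub>R D i)"
proof -
  have "D v = D (\<Sum>i\<in>Basis. (v \<bullet> i) *\<^sub>R i)" by (simp add: euclidean_representation)
  also have "\<dots> = (\<Sum>i\<in>Basis. (v \<bullet> i) *\<^sub>R D i)"
    by (simp add: linear_sum[OF assms] linear_scale[OF assms])
  finally show ?thesis .
qed

text \<open>\<open>C_diff_on\<close> speaks of derivatives in fixed directions only, so the chain
  rule is expanded over \<open>Basis\<close>. Each summand is a component of the derivative of
  \<open>f\<close> times a directional derivative of \<open>g\<close> composed with the same
  \<open>f\<close>; hence the induction varies \<open>g\<close> and keeps \<open>f\<close>.\<close>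

lemma C_diff_on_compose:
  fixes f :: "'a::euclidean_space \<Rightarrow> 'b::euclidean_space" and g :: "'b \<Rightarrow> 'c::real_normed_vector"
  assumes "C_diff_on k V g" "C_diff_on k U f" "open U" "f ` U \<subseteq> V"
  shows "C_diff_on k U (\<lambda>x. g (f x))"
  using assms(1,2)
proof (induction k arbitrary: g)
  case 0
  then show ?case using continuous_on_compose2[of V g U f] assms(4) by simp
next
  case (Suc k)
  have hd: "((\<lambda>x. g (f x)) has_derivative
      (\<lambda>v. frechet_derivative g (at (f y)) (frechet_derivative f (at y) v))) (at y)" if "y \<in> U" for y
  proof -
    have "f y \<in> V" using assms(4) that by auto
    then show ?thesis
      using has_derivative_compose[of f "frechet_derivative f (at y)" y UNIV g
            "frechet_derivative g (at (f y))"] C_diff_on_differentiable[OF Suc.prems(1)]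
        C_diff_on_differentiable[OF Suc.prems(2) that] by blast
  qed
  have "C_diff_on k U (\<lambda>x. frechet_derivative (\<lambda>x. g (f x)) (at x) v)" for v
  proof (rule C_diff_on_cong[OF assms(3)])
    show "(\<Sum>i\<in>Basis. (frechet_derivative f (at y) v \<bullet> i) *\<^sub>R frechet_derivative g (at (f y)) i)
        = frechet_derivative (\<lambda>x. g (f x)) (at y) v" if "y \<in> U" for y
    proof -
      have "f y \<in> V" using assms(4) that by auto
      then have "linear (frechet_derivative g (at (f y)))"
        using C_diff_on_differentiable[OF Suc.prems(1)] has_derivative_linear by blast
      from linear_sum_Basis[OF this, of "frechet_derivative f (at y) v"] show ?thesis
        using fun_cong[OF frechet_derivative_at[OF hd[OF that]], of v] by simp
    qed
    show "C_diff_on k U (\<lambda>y. \<Sum>i\<in>Basis. (frechet_derivative f (at y) v \<bullet> i)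
        *\<^sub>R frechet_derivative g (at (f y)) i)"
      by (intro C_diff_on_sum C_diff_on_bilinear[OF bounded_bilinear_scaleR]
          C_diff_on_linear[OF bounded_linear_inner_left] assms(3) Suc.IH)
        (use Suc.prems C_diff_on_SucD[OF Suc.prems(2)] in auto)
  qed
  moreover have "(\<lambda>x. g (f x)) differentiable (at y)" if "y \<in> U" for y
    using hd[OF that] differentiable_def by blast
  ultimately show ?case by simp
qed

text \<open>The derivative of 1/f contains 1/f only undifferentiated, so the induction closes with
  the same \<open>f\<close>.\<close>

lemma C_diff_on_inverse:
  fixes f :: "'a::euclidean_space \<Rightarrow> real"
  assumes "C_diff_on k U f" "open U" "\<And>x. x \<in> U \<Longrightarrow> f x \<noteq> 0"
  shows "C_diff_on k U (\<lambda>x. inverse (f x))"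
  using assms(1)
proof (induction k)
  case 0
  then show ?case using assms(3) by (auto intro: continuous_on_inverse)
next
  case (Suc k)
  have hd: "((\<lambda>x. inverse (f x)) has_derivative
      (\<lambda>v. - (inverse (f y) * frechet_derivative f (at y) v * inverse (f y)))) (at y)" if "y \<in> U" for y
    using Deriv.has_derivative_inverse[OF assms(3)[OF that] C_diff_on_differentiable[OF Suc.prems that]] .
  have "C_diff_on k U (\<lambda>x. frechet_derivative (\<lambda>x. inverse (f x)) (at x) v)" for v
  proof (rule C_diff_on_cong[OF assms(2)])
    show "- (inverse (f y) * frechet_derivative f (at y) v * inverse (f y))
        = frechet_derivative (\<lambda>x. inverse (f x)) (at y) v" if "y \<in> U" for y
      using fun_cong[OF frechet_derivative_at[OF hd[OF that]], of v] by simp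
    show "C_diff_on k U (\<lambda>y. - (inverse (f y) * frechet_derivative f (at y) v * inverse (f y)))"
      by (intro C_diff_on_linear[OF bounded_linear_minus] C_diff_on_bilinear[OF bounded_bilinear_mult]
          assms(2) Suc.IH bounded_linear_ident)
        (use Suc.prems C_diff_on_SucD[OF Suc.prems] in auto)
  qed
  moreover have "(\<lambda>x. inverse (f x)) differentiable (at y)" if "y \<in> U" for y
    using hd[OF that] differentiable_def by blast
  ultimately show ?case by simp
qed

lemma smooth_on_subset: "smooth_on U f \<Longrightarrow> V \<subseteq> U \<Longrightarrow> smooth_on V f"
  unfolding smooth_on_def using C_diff_on_subset by blast

lemma smooth_on_cong:
  "smooth_on U f \<Longrightarrow> open U \<Longrightarrow> (\<And>y. y \<in> U \<Longrightarrow> f y = g y) \<Longrightarrow> smooth_on U g"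
  unfolding smooth_on_def using C_diff_on_cong by blast

lemma smooth_on_local:
  assumes "\<And>x. x \<in> U \<Longrightarrow> \<exists>V. open V \<and> x \<in> V \<and> smooth_on V f"
  shows "smooth_on U f"
  unfolding smooth_on_def
proof (intro allI C_diff_on_local)
  fix k x assume "x \<in> U"
  then show "\<exists>V. open V \<and> x \<in> V \<and> C_diff_on k V f"
    using assms unfolding smooth_on_def by blast
qed

lemma smooth_on_const: "smooth_on U (\<lambda>x. c)"
  by (simp add: smooth_on_def C_diff_on_const)

lemma smooth_on_ident: "smooth_on U (\<lambda>x. x)"
  by (simp add: smooth_on_def C_diff_on_ident)

lemma smooth_on_add:
  "smooth_on U f \<Longrightarrow> smooth_on U g \<Longrightarrow> open U \<Longrightarrow> smooth_on U (\<lambda>x. f x + g x)"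
  by (simp add: smooth_on_def C_diff_on_add)

lemma smooth_on_bilinear:
  "bounded_bilinear pr \<Longrightarrow> smooth_on U f \<Longrightarrow> smooth_on U g \<Longrightarrow> open U \<Longrightarrow>
    smooth_on U (\<lambda>x. pr (f x) (g x))"
  by (simp add: smooth_on_def C_diff_on_bilinear)

lemma smooth_on_linear:
  "bounded_linear L \<Longrightarrow> smooth_on U f \<Longrightarrow> open U \<Longrightarrow> smooth_on U (\<lambda>x. L (f x))"
  by (simp add: smooth_on_def C_diff_on_linear)

lemma smooth_on_diff:
  assumes "smooth_on U f" "smooth_on U g" "open U"
  shows "smooth_on U (\<lambda>x. f x - g x)"
proof -
  have "smooth_on U (\<lambda>x. - g x)"
    using smooth_on_linear[OF bounded_linear_minus[OF bounded_linear_ident] assms(2,3)] by simp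
  from smooth_on_add[OF assms(1) this assms(3)] show ?thesis by simp
qed

lemma smooth_on_sum:
  "(\<And>i. i \<in> I \<Longrightarrow> smooth_on U (f i)) \<Longrightarrow> open U \<Longrightarrow> smooth_on U (\<lambda>x. \<Sum>i\<in>I. f i x)"
  by (simp add: smooth_on_def C_diff_on_sum)

lemma smooth_on_compose:
  fixes f :: "'a::euclidean_space \<Rightarrow> 'b::euclidean_space"
  shows "smooth_on V g \<Longrightarrow> smooth_on U f \<Longrightarrow> open U \<Longrightarrow> f ` U \<subseteq> V \<Longrightarrow> smooth_on U (\<lambda>x. g (f x))"
  unfolding smooth_on_def using C_diff_on_compose by blast

lemma smooth_on_inverse:
  fixes f :: "'a::euclidean_space \<Rightarrow> real"
  shows "smooth_on U f \<Longrightarrow> open U \<Longrightarrow> (\<And>x. x \<in> U \<Longrightarrow> f x \<noteq> 0) \<Longrightarrow> smooth_on U (\<lambda>x. inverse (f x))"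
  by (simp add: smooth_on_def C_diff_on_inverse)

lemma smooth_on_has_derivative:
  assumes "smooth_on U f" "x \<in> U"
  shows "(f has_derivative frechet_derivative f (at x)) (at x)"
  using assms C_diff_on_differentiable unfolding smooth_on_def by blast

lemma smooth_on_derivative:
  assumes "smooth_on U f"
  shows "smooth_on U (\<lambda>x. frechet_derivative f (at x) v)"
  using assms unfolding smooth_on_def by (metis C_diff_on.simps(2))

lemma smooth_on_continuous: "smooth_on U f \<Longrightarrow> continuous_on U f"
  unfolding smooth_on_def by (metis C_diff_on.simps(1))

section \<open>Smooth bump functions and Hadamard's lemma\<close>

text \<open>The classical function exp(-1/t) is \<open>flat 1\<close>. The polynomial factor in 1/t
  makes the family closed under differentiation: with u = 1/t, the derivative replaces p by u^2 (p -
  p').\<close>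

definition flat :: "real poly \<Rightarrow> real \<Rightarrow> real" where
  "flat p t = (if t > 0 then poly p (1 / t) * exp (- (1 / t)) else 0)"

lemma poly_exp_tendsto_0: "((\<lambda>x. poly p x * exp (- x)) \<longlongrightarrow> (0::real)) at_top"
proof -
  have "((\<lambda>x. \<Sum>i\<le>degree p. coeff p i * (x ^ i / exp x)) \<longlongrightarrow> (\<Sum>i\<le>degree p. coeff p i * 0)) at_top"
    by (intro tendsto_sum tendsto_mult tendsto_const tendsto_power_div_exp_0)
  moreover have "(\<Sum>i\<le>degree p. coeff p i * (x ^ i / exp x)) = poly p x * exp (- x)" for x
    by (simp add: poly_altdef exp_minus sum_distrib_right divide_inverse mult.assoc)
  ultimately show ?thesis by simp
qed

lemma flat_has_derivative: "(flat p has_real_derivative flat ([:0, 0, 1:] * (p - pderiv p)) t) (at t)"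
proof -
  consider "t > 0" | "t < 0" | "t = 0" by linarith
  then show ?thesis
  proof cases
    case 1
    have "((\<lambda>t. poly p (1 / t) * exp (- (1 / t))) has_real_derivative
        flat ([:0, 0, 1:] * (p - pderiv p)) t) (at t)"
      using 1 by (auto intro!: derivative_eq_intros DERIV_chain'[OF _ poly_DERIV]
          simp: flat_def field_simps power2_eq_square)
    then show ?thesis
      by (rule has_field_derivative_transform_within_open[where S="{0<..}"])
        (use 1 in \<open>auto simp: flat_def\<close>)
  next
    case 2
    have "((\<lambda>t. 0) has_real_derivative 0) (at t)" by simp
    then have "(flat p has_real_derivative 0) (at t)"
      by (rule has_field_derivative_transform_within_open[where S="{..<0}"])
        (use 2 in \<open>auto simp: flat_def\<close>)
    then show ?thesis using 2 by (simp add: flat_def)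
  next
    case 3
    \<comment> \<open>The right difference quotient at 0 is p(1/h) exp(-1/h) / h; the division by h
      raises p to the polynomial u p(u).\<close>
    have "((\<lambda>h. poly ([:0, 1:] * p) (inverse h) * exp (- inverse h)) \<longlongrightarrow> 0) (at_right 0)"
      by (rule filterlim_compose[OF poly_exp_tendsto_0 filterlim_inverse_at_top_right])
    then have "((\<lambda>h. (flat p (0 + h) - flat p 0) / h) \<longlongrightarrow> 0) (at_right 0)"
      by (rule Lim_transform_eventually)
        (auto simp: flat_def eventually_at_right_less field_simps intro!: eventually_at_rightI[of 0 1])
    moreover have "((\<lambda>h. (flat p (0 + h) - flat p 0) / h) \<longlongrightarrow> 0) (at_left 0)"
      by (rule Lim_transform_eventually[OF tendsto_const])
        (auto simp: flat_def intro!: eventually_at_leftI[of "-1" 0])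
    ultimately have "((\<lambda>h. (flat p (0 + h) - flat p 0) / h) \<longlongrightarrow> 0) (at 0)"
      by (simp add: filterlim_split_at)
    then have "(flat p has_real_derivative 0) (at 0)"
      by (simp add: DERIV_def)
    then show ?thesis using 3 by (simp add: flat_def)
  qed
qed

lemma smooth_on_flat: "smooth_on UNIV (flat p)"
proof -
  have "C_diff_on k UNIV (flat p)" for k
  proof (induction k arbitrary: p)
    case 0
    have "isCont (flat p) t" for t
      using DERIV_isCont[OF flat_has_derivative] .
    then show ?case by (simp add: continuous_at_imp_continuous_on)
  next
    case (Suc k)
    let ?q = "[:0, 0, 1:] * (p - pderiv p)"
    have hd: "(flat p has_derivative (*) (flat ?q t)) (at t)" for t
      using flat_has_derivative[of p t] unfolding has_field_derivative_def .
    have "frechet_derivative (flat p) (at t) v = flat ?q t * v" for t v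
      by (rule fun_cong[OF frechet_derivative_at[OF hd], symmetric])
    moreover have "C_diff_on k UNIV (\<lambda>t. flat ?q t * v)" for v
      by (rule C_diff_on_linear[OF bounded_linear_mult_left Suc.IH open_UNIV])
    ultimately show ?case using hd by (simp add: differentiable_def) blast
  qed
  then show ?thesis by (simp add: smooth_on_def)
qed

lemma flat_1_pos_iff: "flat 1 t > 0 \<longleftrightarrow> t > 0" and flat_1_nonneg: "flat 1 t \<ge> 0"
  by (simp_all add: flat_def)

text \<open>A quotient f / (f + h), where f is positive exactly on the open ball of radius r and h
  exactly outside the closed ball of radius r/2. As r/2 < r, the denominator never vanishes.\<close>

lemma exists_bump:
  fixes a :: "'a::euclidean_space"
  assumes "r > 0"
  obtains b :: "'a \<Rightarrow> real" where "smooth_on UNIV b"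
    "\<And>z. z \<in> ball a (r / 2) \<Longrightarrow> b z = 1" "\<And>z. z \<notin> ball a r \<Longrightarrow> b z = 0"
proof
  let ?s = "\<lambda>z. (z - a) \<bullet> (z - a)"
  let ?f = "\<lambda>z. flat 1 (r\<^sup>2 - ?s z)" and ?h = "\<lambda>z. flat 1 (?s z - (r / 2)\<^sup>2)"
  let ?b = "\<lambda>z. ?f z * inverse (?f z + ?h z)"
  have s: "smooth_on UNIV ?s"
    by (intro smooth_on_bilinear[OF bounded_bilinear_inner] smooth_on_diff smooth_on_ident
        smooth_on_const open_UNIV)
  have f: "smooth_on UNIV ?f" and h: "smooth_on UNIV ?h"
    by (intro smooth_on_compose[OF smooth_on_flat] smooth_on_diff s smooth_on_const open_UNIV; simp)+
  have "(r / 2)\<^sup>2 < r\<^sup>2" using assms by (simp add: power_divide)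
  then have pos: "?f z + ?h z > 0" for z
    using flat_1_nonneg[of "r\<^sup>2 - ?s z"] flat_1_nonneg[of "?s z - (r / 2)\<^sup>2"]
      flat_1_pos_iff[of "r\<^sup>2 - ?s z"] flat_1_pos_iff[of "?s z - (r / 2)\<^sup>2"] by (smt (verit))
  then have "?f z + ?h z \<noteq> 0" for z using less_irrefl by metis
  then show "smooth_on UNIV ?b"
    by (intro smooth_on_bilinear[OF bounded_bilinear_mult] smooth_on_inverse smooth_on_add f h open_UNIV)
  have sq: "?s z = (dist a z)\<^sup>2" for z
    by (simp add: dist_norm norm_minus_commute[of a z] power2_norm_eq_inner)
  show "?b z = 1" if "z \<in> ball a (r / 2)" for z
  proof -
    have "(dist a z)\<^sup>2 \<le> (r / 2)\<^sup>2" using that by (intro power_mono) auto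
    then have "?h z = 0" using sq[of z] by (simp add: flat_def)
    then show ?thesis using pos[of z] by simp
  qed
  show "?b z = 0" if "z \<notin> ball a r" for z
  proof -
    have "r\<^sup>2 \<le> (dist a z)\<^sup>2" using that assms by (intro power_mono) auto
    then show ?thesis using sq[of z] by (simp add: flat_def)
  qed
qed

text \<open>Differentiating under the integral brings out a factor t from the inner map a + t(z -
  a). The weight \<open>t ^ j\<close> is carried along so that the statement reproduces itself for
  the partial derivatives.\<close>

lemma C_diff_on_ray_integral:
  fixes g :: "'a::euclidean_space \<Rightarrow> real"
  assumes "C_diff_on k (ball a r) g"
  shows "C_diff_on k (ball a r) (\<lambda>z. integral (cbox 0 1) (\<lambda>t::real. t ^ j * g (a + t *\<^sub>R (z - a))))"
  using assms
proof (induction k arbitrary: j g)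
  have inb: "a + t *\<^sub>R (z - a) \<in> ball a r" if "z \<in> ball a r" "t \<in> cbox 0 1" for z and t :: real
  proof -
    have "dist a (a + t *\<^sub>R (z - a)) = t * dist a z"
      using that by (simp add: dist_norm norm_minus_commute)
    also have "\<dots> \<le> 1 * dist a z" by (intro mult_right_mono) (use that in auto)
    finally show ?thesis using that by simp
  qed
  have cont: "continuous_on (ball a r \<times> cbox 0 1) (\<lambda>(z, t). t ^ j * g (a + t *\<^sub>R (z - a)))"
    if "continuous_on (ball a r) g" for j and g :: "'a \<Rightarrow> real"
    unfolding case_prod_unfold
    by (intro continuous_intros continuous_on_compose2[OF that]) (use inb in \<open>auto simp: mem_Times_iff\<close>)
  {
    case 0
    then show ?case using integral_continuous_on_param[OF cont[of g j]] by simp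
  next
    case (Suc k)
    let ?G = "\<lambda>z. integral (cbox 0 1) (\<lambda>t::real. t ^ j * g (a + t *\<^sub>R (z - a)))"
    let ?D = "\<lambda>i. \<lambda>z. frechet_derivative g (at z) i"
    \<comment> \<open>\<open>leibniz_rule\<close> takes the derivative as a bounded linear function,
      so the gradient is packed into the functionals \<open>blinfun_inner_right i\<close>; the inner
      derivative accounts for \<open>Suc j\<close>.\<close>
    let ?fx = "\<lambda>z t. \<Sum>i\<in>Basis. (t ^ Suc j * ?D i (a + t *\<^sub>R (z - a))) *\<^sub>R blinfun_inner_right i"
    have gD: "(g has_derivative frechet_derivative g (at z)) (at z)" if "z \<in> ball a r" for z
      using C_diff_on_differentiable[OF Suc.prems that] .
    have fx: "((\<lambda>z. t ^ j * g (a + t *\<^sub>R (z - a))) has_derivative blinfun_apply (?fx z t))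
        (at z within ball a r)" if "z \<in> ball a r" "t \<in> cbox 0 1" for z t
    proof -
      let ?w = "a + t *\<^sub>R (z - a)"
      have "linear (frechet_derivative g (at ?w))"
        using has_derivative_linear[OF gD[OF inb[OF that]]] .
      then have "blinfun_apply (?fx z t) v = t ^ j * frechet_derivative g (at ?w) (t *\<^sub>R v)" for v
        using linear_sum_Basis[of "frechet_derivative g (at ?w)" v]
        by (simp add: blinfun.sum_left blinfun.scaleR_left linear_scale sum_distrib_left
            inner_commute mult_ac)
      moreover have "((\<lambda>z. t ^ j * g (a + t *\<^sub>R (z - a))) has_derivative
          (\<lambda>v. t ^ j * frechet_derivative g (at ?w) (t *\<^sub>R v))) (at z within ball a r)"
        by (intro has_derivative_mult_right has_derivative_compose[where g=g and
              f="\<lambda>z. a + t *\<^sub>R (z - a)", OF _ gD[OF inb[OF that]]])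
          (auto intro!: derivative_eq_intros)
      ultimately show ?thesis by (metis (no_types, lifting) ext)
    qed
    have C: "C_diff_on k (ball a r) (?D i)" for i
      using Suc.prems by simp
    have Dc: "continuous_on (ball a r) (?D i)" for i
      using C_diff_on_mono[OF C[of i], of 0] by simp
    have gc: "continuous_on (ball a r) g"
      using C_diff_on_mono[OF Suc.prems, of 0] by simp
    have cfx: "continuous_on (ball a r \<times> cbox 0 1) (\<lambda>(z, t). ?fx z t)"
      unfolding case_prod_unfold
      by (intro continuous_intros continuous_on_compose2[OF Dc]) (use inb in \<open>auto simp: mem_Times_iff\<close>)
    have contt: "continuous_on (cbox 0 1) (\<lambda>t. f (z, t))"
      if "continuous_on (ball a r \<times> cbox 0 1) f" "z \<in> ball a r"
      for z and f :: "'a \<times> real \<Rightarrow> 'c::topological_space"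
      by (rule continuous_on_compose2[OF that(1)]) (use that(2) in \<open>auto intro!: continuous_intros\<close>)
    have hd: "(?G has_derivative (\<lambda>v. \<Sum>i\<in>Basis. (v \<bullet> i) *
        integral (cbox 0 1) (\<lambda>t. t ^ Suc j * ?D i (a + t *\<^sub>R (z - a))))) (at z)"
      if z: "z \<in> ball a r" for z
    proof -
      have "(?G has_derivative blinfun_apply (integral (cbox 0 1) (?fx z))) (at z within ball a r)"
        by (rule leibniz_rule[OF fx _ cfx z convex_ball])
          (use contt[OF cont[OF gc]] in \<open>auto intro!: integrable_continuous_interval\<close>)
      then have *: "(?G has_derivative blinfun_apply (integral (cbox 0 1) (?fx z))) (at z)"
        using at_within_open[OF z open_ball] by simp
      have int: "?fx z integrable_on cbox 0 1"
        using contt[OF cfx z] by (auto intro!: integrable_continuous_interval)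
      have inti: "(\<lambda>t. t ^ Suc j * ?D i (a + t *\<^sub>R (z - a))) integrable_on cbox 0 1" for i
        using contt[OF cont[OF Dc, of "Suc j"] z] by (auto intro!: integrable_continuous_interval)
      have "blinfun_apply (integral (cbox 0 1) (?fx z)) v
          = integral (cbox 0 1) (\<lambda>t. blinfun_apply (?fx z t) v)" for v
        using integral_linear[OF int blinfun.bounded_linear_left[of v]] by (simp add: o_def)
      also have "\<dots> v = integral (cbox 0 1) (\<lambda>t. \<Sum>i\<in>Basis. (v \<bullet> i) * (t ^ Suc j * ?D i (a + t *\<^sub>R (z - a))))" for v
        by (simp add: blinfun.sum_left blinfun.scaleR_left inner_commute mult_ac)
      also have "\<dots> v = (\<Sum>i\<in>Basis. (v \<bullet> i) * integral (cbox 0 1) (\<lambda>t. t ^ Suc j * ?D i (a + t *\<^sub>R (z - a))))" for v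
        using integrable_on_mult_right[OF inti]
        by (subst integral_sum) (simp_all only: finite_Basis integral_mult_right)
      finally show ?thesis using * by (metis (no_types, lifting) ext)
    qed
    have "C_diff_on k (ball a r) (\<lambda>z. frechet_derivative ?G (at z) v)" for v
    proof (rule C_diff_on_cong[OF open_ball])
      show "(\<Sum>i\<in>Basis. (v \<bullet> i) * integral (cbox 0 1) (\<lambda>t. t ^ Suc j * ?D i (a + t *\<^sub>R (z - a))))
          = frechet_derivative ?G (at z) v" if "z \<in> ball a r" for z
        using fun_cong[OF frechet_derivative_at[OF hd[OF that]], of v] .
      show "C_diff_on k (ball a r) (\<lambda>z. \<Sum>i\<in>Basis. (v \<bullet> i) *
          integral (cbox 0 1) (\<lambda>t. t ^ Suc j * ?D i (a + t *\<^sub>R (z - a))))"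
        by (intro C_diff_on_sum C_diff_on_linear[OF bounded_linear_mult_right] Suc.IH C open_ball)
    qed
    moreover have "?G differentiable (at z)" if "z \<in> ball a r" for z
      using hd[OF that] differentiable_def by blast
    ultimately show ?case by simp
  }
qed

text \<open>Integrate the derivative of f along the segment from a to z. In contrast to a Taylor
  estimate the coefficients are smooth functions, so a derivation can be applied to the expansion by
  the product rule.\<close>

lemma Hadamard_expansion:
  fixes f :: "'a::euclidean_space \<Rightarrow> real"
  assumes f: "smooth_on (ball a r) f" and r: "r > 0"
  obtains h where "\<And>i. smooth_on (ball a r) (h i)"
    "\<And>z. z \<in> ball a r \<Longrightarrow> f z = f a + (\<Sum>i\<in>Basis. ((z - a) \<bullet> i) * h i z)"
    "\<And>i. h i a = frechet_derivative f (at a) i"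
proof
  let ?D = "\<lambda>i z. frechet_derivative f (at z) i"
  \<comment> \<open>The mean of the i-th partial derivative over the segment; at z = a the integrand
    is constant. The factor \<open>t ^ 0\<close> fits the shape of
    \<open>C_diff_on_ray_integral\<close>.\<close>
  let ?h = "\<lambda>i z. integral (cbox 0 1) (\<lambda>t::real. t ^ 0 * ?D i (a + t *\<^sub>R (z - a)))"
  show "smooth_on (ball a r) (?h i)" for i
    using smooth_on_derivative[OF f, of i] C_diff_on_ray_integral unfolding smooth_on_def by blast
  show "?h i a = ?D i a" for i by simp
  show "f z = f a + (\<Sum>i\<in>Basis. ((z - a) \<bullet> i) * ?h i z)" if z: "z \<in> ball a r" for z
  proof -
    have inb: "a + t *\<^sub>R (z - a) \<in> ball a r" if "t \<in> {0..1}" for t :: real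
    proof -
      have "dist a (a + t *\<^sub>R (z - a)) = t * dist a z"
        using that by (simp add: dist_norm norm_minus_commute)
      also have "\<dots> \<le> 1 * dist a z" by (intro mult_right_mono) (use that in auto)
      finally show ?thesis using z by simp
    qed
    have hd: "(f has_derivative frechet_derivative f (at (a + t *\<^sub>R (z - a)))) (at (a + t *\<^sub>R (z - a)))"
      if "t \<in> {0..1}" for t
      using smooth_on_has_derivative[OF f inb[OF that]] .
    have "((\<lambda>t. f (a + t *\<^sub>R (z - a))) has_vector_derivative
        frechet_derivative f (at (a + t *\<^sub>R (z - a))) (z - a)) (at t within {0..1})" if "t \<in> {0..1}" for t
      unfolding has_vector_derivative_def
    proof (rule has_derivative_eq_rhs[OF has_derivative_compose[where g=f and
          f="\<lambda>t. a + t *\<^sub>R (z - a)", OF _ hd[OF that]]])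
      show "((\<lambda>t. a + t *\<^sub>R (z - a)) has_derivative (\<lambda>s. s *\<^sub>R (z - a))) (at t within {0..1})"
        by (auto intro!: derivative_eq_intros)
      show "(\<lambda>x. frechet_derivative f (at (a + t *\<^sub>R (z - a))) (x *\<^sub>R (z - a))) =
          (\<lambda>x. x *\<^sub>R frechet_derivative f (at (a + t *\<^sub>R (z - a))) (z - a))"
        using linear_scale[OF has_derivative_linear[OF hd[OF that]]] by blast
    qed
    then have "((\<lambda>t. frechet_derivative f (at (a + t *\<^sub>R (z - a))) (z - a)) has_integral
        (f (a + 1 *\<^sub>R (z - a)) - f (a + 0 *\<^sub>R (z - a)))) {0..1}"
      by (intro fundamental_theorem_of_calculus) auto
    then have "f z - f a = integral (cbox 0 1) (\<lambda>t. frechet_derivative f (at (a + t *\<^sub>R (z - a))) (z - a))"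
      by (simp add: integral_unique)
    also have "\<dots> = integral (cbox 0 1) (\<lambda>t. \<Sum>i\<in>Basis. ((z - a) \<bullet> i) * ?D i (a + t *\<^sub>R (z - a)))"
      using linear_sum_Basis[OF has_derivative_linear[OF hd]] by (intro integral_cong) simp
    also have "\<dots> = (\<Sum>i\<in>Basis. ((z - a) \<bullet> i) * ?h i z)"
    proof (subst integral_sum)
      show "(\<lambda>t. ((z - a) \<bullet> i) * ?D i (a + t *\<^sub>R (z - a))) integrable_on cbox 0 1" for i
        by (intro integrable_continuous continuous_intros
            continuous_on_compose2[OF smooth_on_continuous[OF smooth_on_derivative[OF f]]])
          (use inb in auto)
    qed auto
    finally show ?thesis by simp
  qed
qed

section \<open>Tangent vectors in charts\<close>

locale smooth_mfd =
  fixes T :: "'p topology" and A :: "('p, 'e::euclidean_space) atlas"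
  assumes smooth_manifold: "smooth_manifold T A"
begin

lemma Hausdorff: "Hausdorff_space T" and topspace: "topspace T = carrier A"
  using smooth_manifold by (auto simp: smooth_manifold_def)

lemma carrierE:
  assumes "p \<in> carrier A"
  obtains U x where "(U, x) \<in> A" "p \<in> U"
  using assms by (auto simp: carrier_def)

context
  fixes U x assumes chart: "(U, x) \<in> A"
begin

lemma chart_subset: "U \<subseteq> carrier A"
  using chart by (auto simp: carrier_def)

lemma chart_open: "openin T U" and chart_image_open: "open (x ` U)"
  and chart_homeo: "homeomorphic_map (subtopology T U) (top_of_set (x ` U)) x"
  using smooth_manifold chart by (auto simp: smooth_manifold_def)

lemma chart_inj: "inj_on x U"
  using homeomorphic_imp_injective_map[OF chart_homeo] openin_subset[OF chart_open]
  by (simp add: Int_absorb1)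

lemma chart_inv [simp]: "q \<in> U \<Longrightarrow> inv_into U x (x q) = q"
  using chart_inj by simp

lemma inv_chart: "z \<in> x ` U \<Longrightarrow> x (inv_into U x z) = z" "z \<in> x ` U \<Longrightarrow> inv_into U x z \<in> U"
  by (auto simp: f_inv_into_f inv_into_into)

lemma chart_image_openin:
  assumes "openin T W" "W \<subseteq> U"
  shows "open (x ` W)"
proof -
  have "openin (subtopology T U) W"
    using assms chart_open by (simp add: openin_open_subtopology)
  then have "openin (top_of_set (x ` U)) (x ` W)"
    using homeomorphic_map_openness[OF chart_homeo, of W] openin_subset by blast
  then show ?thesis
    using chart_image_open by (simp add: openin_open_eq)
qed

lemma image_inv_chart: "Z \<subseteq> x ` U \<Longrightarrow> x ` inv_into U x ` Z = Z"
  by (rule image_inv_into_cancel[OF refl])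

lemma inv_chart_image_openin:
  assumes "open Z" "Z \<subseteq> x ` U"
  shows "openin T (inv_into U x ` Z)"
proof -
  have sub: "inv_into U x ` Z \<subseteq> U" using assms inv_chart by blast
  have "openin (top_of_set (x ` U)) (x ` (inv_into U x ` Z))"
    using image_inv_chart[OF assms(2)] assms chart_image_open by (simp add: openin_open_eq)
  then have "openin (subtopology T U) (inv_into U x ` Z)"
    using homeomorphic_map_openness[OF chart_homeo, of "inv_into U x ` Z"] sub
      openin_subset[OF chart_open] by auto
  then show ?thesis
    using chart_open by (simp add: openin_open_subtopology)
qed

lemma inv_chart_image_closedin:
  assumes "compact K" "K \<subseteq> x ` U"
  shows "closedin T (inv_into U x ` K)"
proof -
  have sub: "inv_into U x ` K \<subseteq> U" using assms inv_chart by blast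
  have "compactin (top_of_set (x ` U)) (x ` (inv_into U x ` K))"
    using image_inv_chart[OF assms(2)] assms by (simp add: compactin_subtopology)
  then have "compactin (subtopology T U) (inv_into U x ` K)"
    using homeomorphic_map_compactness[OF chart_homeo, of "inv_into U x ` K"] sub
      openin_subset[OF chart_open] by auto
  then show ?thesis
    using compactin_imp_closedin[OF Hausdorff] by (simp add: compactin_subtopology)
qed

lemma smooth_fun_chart: "smooth_fun A f \<Longrightarrow> smooth_on (x ` U) (\<lambda>z. f (inv_into U x z))"
  using chart by (auto simp: smooth_fun_def o_def)

end

lemma smooth_transition:
  "(U, x) \<in> A \<Longrightarrow> (V, y) \<in> A \<Longrightarrow> smooth_on (x ` (U \<inter> V)) (\<lambda>z. y (inv_into U x z))"
  using smooth_manifold by (auto simp: smooth_manifold_def o_def)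

text \<open>\<open>smooth_fun\<close> demands smoothness in every chart of the atlas; the transition
  maps allow it to be checked in one suitable chart near each point.\<close>

lemma smooth_funI:
  assumes "\<And>q. q \<in> carrier A \<Longrightarrow> \<exists>U x Z. (U, x) \<in> A \<and> q \<in> U \<and> open Z \<and> x q \<in> Z \<and> Z \<subseteq> x ` U \<and>
    smooth_on Z (\<lambda>z. f (inv_into U x z))"
  shows "smooth_fun A f"
  unfolding smooth_fun_def
proof (clarify)
  fix V y assume Vy: "(V, y) \<in> A"
  show "smooth_on (y ` V) (f \<circ> inv_into V y)"
  proof (rule smooth_on_local)
    fix z assume "z \<in> y ` V"
    then obtain q where q: "q \<in> V" "z = y q" by auto
    then obtain U x Z where *: "(U, x) \<in> A" "q \<in> U" "open Z" "x q \<in> Z" "Z \<subseteq> x ` U"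
      "smooth_on Z (\<lambda>z. f (inv_into U x z))"
      using assms chart_subset[OF Vy] by (metis subsetD)
    define N where "N = inv_into U x ` Z \<inter> V"
    have NT: "openin T N"
      using inv_chart_image_openin[OF *(1,3,5)] chart_open[OF Vy] by (auto simp: N_def)
    have N: "openin T N" "N \<subseteq> V" "N \<subseteq> U" "q \<in> N"
      using NT inv_chart(2)[OF *(1) subsetD[OF *(5)]] imageI[OF *(4), of "inv_into U x"]
        chart_inv[OF *(1,2)] q(1) by (auto simp: N_def)
    have xN: "x q' \<in> Z" if q': "q' \<in> N" for q'
    proof -
      obtain z where z: "z \<in> Z" "q' = inv_into U x z" using q' by (auto simp: N_def)
      then show ?thesis using inv_chart(1)[OF *(1) subsetD[OF *(5)]] by simp
    qed
    have "smooth_on (y ` N) (\<lambda>z. f (inv_into U x (x (inv_into V y z))))"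
    proof (rule smooth_on_compose[OF *(6)])
      show "smooth_on (y ` N) (\<lambda>z. x (inv_into V y z))"
        by (rule smooth_on_subset[OF smooth_transition[OF Vy *(1)]]) (use N in auto)
      show "open (y ` N)" using chart_image_openin[OF Vy N(1,2)] .
      show "(\<lambda>z. x (inv_into V y z)) ` y ` N \<subseteq> Z"
      proof (clarsimp)
        fix q' assume "q' \<in> N"
        then show "x (inv_into V y (y q')) \<in> Z"
          using xN chart_inv[OF Vy subsetD[OF N(2)]] by simp
      qed
    qed
    then have "smooth_on (y ` N) (f \<circ> inv_into V y)"
      by (rule smooth_on_cong) (use chart_image_openin[OF Vy N(1,2)] subsetD[OF N(2)] subsetD[OF N(3)]
          chart_inv[OF Vy] chart_inv[OF *(1)] in auto)
    then show "\<exists>N. open N \<and> z \<in> N \<and> smooth_on N (f \<circ> inv_into V y)"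
      using chart_image_openin[OF Vy N(1,2)] N(4) q(2) by blast
  qed
qed

lemma smooth_fun_cong:
  assumes "smooth_fun A f" "\<And>q. q \<in> carrier A \<Longrightarrow> f q = h q"
  shows "smooth_fun A h"
  unfolding smooth_fun_def
proof clarify
  fix U x assume Ux: "(U, x) \<in> A"
  show "smooth_on (x ` U) (h \<circ> inv_into U x)"
  proof (rule smooth_on_cong[OF smooth_fun_chart[OF Ux assms(1)] chart_image_open[OF Ux]])
    fix z assume "z \<in> x ` U"
    then show "f (inv_into U x z) = (h \<circ> inv_into U x) z"
      using assms(2) inv_chart(2)[OF Ux] chart_subset[OF Ux] by auto
  qed
qed

lemma smooth_fun_const: "smooth_fun A (\<lambda>q. c)"
  by (auto simp: smooth_fun_def o_def smooth_on_const)

lemma smooth_fun_add: "smooth_fun A f \<Longrightarrow> smooth_fun A h \<Longrightarrow> smooth_fun A (\<lambda>q. f q + h q)"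
  using chart_image_open by (auto simp: smooth_fun_def o_def intro!: smooth_on_add)

lemma smooth_fun_mult: "smooth_fun A f \<Longrightarrow> smooth_fun A h \<Longrightarrow> smooth_fun A (\<lambda>q. f q * h q)"
  using chart_image_open
  by (auto simp: smooth_fun_def o_def intro!: smooth_on_bilinear[OF bounded_bilinear_mult])

lemma smooth_fun_diff: "smooth_fun A f \<Longrightarrow> smooth_fun A h \<Longrightarrow> smooth_fun A (\<lambda>q. f q - h q)"
  using chart_image_open by (auto simp: smooth_fun_def o_def intro!: smooth_on_diff)

lemma smooth_fun_sum:
  "(\<And>i. i \<in> I \<Longrightarrow> smooth_fun A (f i)) \<Longrightarrow> smooth_fun A (\<lambda>q. \<Sum>i\<in>I. f i q)"
  by (induction I rule: infinite_finite_induct) (auto intro: smooth_fun_const smooth_fun_add)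

text \<open>Multiply \<open>h\<close> by a bump function supported inside \<open>Z\<close> and
  extend by zero. The agreement with \<open>h\<close> on a smaller ball is all that a derivation at
  \<open>p\<close> can see.\<close>

lemma local_extension:
  assumes Ux: "(U, x) \<in> A" and "p \<in> U" and Z: "open Z" "x p \<in> Z" "Z \<subseteq> x ` U" and h: "smooth_on Z h"
  obtains f r where "r > 0" "ball (x p) r \<subseteq> Z" "smooth_fun A f"
    "\<And>z. z \<in> ball (x p) r \<Longrightarrow> f (inv_into U x z) = h z"
    "\<And>q. q \<in> carrier A \<Longrightarrow> q \<notin> inv_into U x ` Z \<Longrightarrow> f q = 0"
proof -
  obtain R where R: "R > 0" "cball (x p) R \<subseteq> Z"
    using Z open_contains_cball by blast
  obtain b where b: "smooth_on UNIV b" "\<And>z. z \<in> ball (x p) (R / 2) \<Longrightarrow> b z = 1"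
    "\<And>z. z \<notin> ball (x p) R \<Longrightarrow> b z = (0::real)"
    using exists_bump[OF R(1)] by blast
  define f where "f q = (if q \<in> inv_into U x ` Z then b (x q) * h (x q) else 0)" for q
  have fZ: "f (inv_into U x z) = b z * h z" if "z \<in> Z" for z
    using that Z(3) inv_chart(1)[OF Ux] by (auto simp: f_def)
  have "smooth_fun A f"
  proof (rule smooth_funI)
    fix q assume q: "q \<in> carrier A"
    show "\<exists>U x Z. (U, x) \<in> A \<and> q \<in> U \<and> open Z \<and> x q \<in> Z \<and> Z \<subseteq> x ` U \<and>
        smooth_on Z (\<lambda>z. f (inv_into U x z))"
    proof (cases "q \<in> inv_into U x ` Z")
      case True
      then have "q \<in> U" "x q \<in> Z" using Z(3) inv_chart[OF Ux] by auto
      moreover have "smooth_on Z (\<lambda>z. f (inv_into U x z))"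
        by (rule smooth_on_cong[OF smooth_on_bilinear[OF bounded_bilinear_mult
                smooth_on_subset[OF b(1)] h Z(1)] Z(1)]) (use fZ in auto)
      ultimately show ?thesis using Ux Z by blast
    next
      case False
      \<comment> \<open>K contains the support of f. It is compact, hence closed in the Hausdorff
        space M, so q has a chart neighbourhood outside K, on which f is zero.\<close>
      define K where "K = inv_into U x ` cball (x p) R"
      have K: "closedin T K"
        unfolding K_def by (rule inv_chart_image_closedin[OF Ux]) (use R Z in auto)
      obtain V y where Vy: "(V, y) \<in> A" "q \<in> V" using carrierE[OF q] .
      define N where "N = V - K"
      have N: "openin T N" "N \<subseteq> V" "q \<in> N"
        using openin_diff[OF chart_open[OF Vy(1)] K] False R(2) Vy by (auto simp: N_def K_def)
      have f0: "f q' = 0" if "q' \<in> N" for q'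
      proof (cases "q' \<in> inv_into U x ` Z")
        case True
        then obtain z where z: "z \<in> Z" "q' = inv_into U x z" by auto
        then have "z \<notin> ball (x p) R" using that by (auto simp: N_def K_def)
        then show ?thesis using fZ[OF z(1)] b(3) z(2) by simp
      qed (simp add: f_def)
      have "smooth_on (y ` N) (\<lambda>z. f (inv_into V y z))"
        by (rule smooth_on_cong[OF smooth_on_const[of _ 0] chart_image_openin[OF Vy(1) N(1,2)]])
          (use f0 N(2) chart_inv[OF Vy(1)] in auto)
      then show ?thesis
        using Vy N chart_image_openin[OF Vy(1) N(1,2)] by blast
    qed
  qed
  moreover have "ball (x p) (R / 2) \<subseteq> Z" using R by (auto simp: subset_iff)
  moreover have "f (inv_into U x z) = h z" if "z \<in> ball (x p) (R / 2)" for z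
    using fZ[of z] b(2)[OF that] that \<open>ball (x p) (R / 2) \<subseteq> Z\<close> by auto
  ultimately show ?thesis
    using that[of "R / 2" f] R(1) by (auto simp: f_def)
qed

section \<open>Algebra and locality of derivations at a point\<close>

context
  fixes p v assumes v: "v \<in> tangent_space A p"
begin

lemma tangent_nonsmooth: "\<not> smooth_fun A f \<Longrightarrow> v f = 0"
  using v by (auto simp: tangent_space_def)

lemma tangent_cong: "smooth_fun A f \<Longrightarrow> (\<And>q. q \<in> carrier A \<Longrightarrow> f q = h q) \<Longrightarrow> v f = v h"
  using v smooth_fun_cong[of f h] by (auto simp: tangent_space_def)

lemma tangent_linear:
  "smooth_fun A f \<Longrightarrow> smooth_fun A h \<Longrightarrow> v (\<lambda>q. a * f q + b * h q) = a * v f + b * v h"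
  using v by (auto simp: tangent_space_def)

lemma tangent_add: "smooth_fun A f \<Longrightarrow> smooth_fun A h \<Longrightarrow> v (\<lambda>q. f q + h q) = v f + v h"
  using tangent_linear[of f h 1 1] by simp

lemma tangent_diff: "smooth_fun A f \<Longrightarrow> smooth_fun A h \<Longrightarrow> v (\<lambda>q. f q - h q) = v f - v h"
  using tangent_linear[of f h 1 "-1"] by simp

lemma tangent_mult:
  "smooth_fun A f \<Longrightarrow> smooth_fun A h \<Longrightarrow> v (\<lambda>q. f q * h q) = f p * v h + h p * v f"
  using v by (auto simp: tangent_space_def)

lemma tangent_const: "v (\<lambda>q. c) = 0"
proof -
  have "v (\<lambda>q. 1) = 0"
    using tangent_mult[OF smooth_fun_const[of 1] smooth_fun_const[of 1]] by simp
  then show ?thesis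
    using tangent_linear[OF smooth_fun_const[of 1] smooth_fun_const[of 1], of c 0] by simp
qed

lemma tangent_sum:
  "(\<And>i. i \<in> I \<Longrightarrow> smooth_fun A (f i)) \<Longrightarrow> v (\<lambda>q. \<Sum>i\<in>I. f i q) = (\<Sum>i\<in>I. v (f i))"
  by (induction I rule: infinite_finite_induct) (auto simp: tangent_const tangent_add smooth_fun_sum)

text \<open>Take a bump function b supported in N with b p = 1. Then f b = 0 everywhere, and the
  product rule gives 0 = v(f b) = f(p) v(b) + b(p) v(f) = v(f).\<close>

lemma tangent_local_0:
  assumes f: "smooth_fun A f" and N: "openin T N" "p \<in> N" "\<And>q. q \<in> N \<Longrightarrow> f q = 0"
  shows "v f = 0"
proof -
  obtain U x where Ux: "(U, x) \<in> A" "p \<in> U"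
    using N openin_subset topspace carrierE by blast
  have Z: "open (x ` (U \<inter> N))" "x p \<in> x ` (U \<inter> N)" "x ` (U \<inter> N) \<subseteq> x ` U"
    using chart_image_openin[OF Ux(1), of "U \<inter> N"] chart_open[OF Ux(1)] N Ux by auto
  obtain b r where b: "r > 0" "smooth_fun A b"
    "\<And>z. z \<in> ball (x p) r \<Longrightarrow> b (inv_into U x z) = 1"
    "\<And>q. q \<in> carrier A \<Longrightarrow> q \<notin> inv_into U x ` (x ` (U \<inter> N)) \<Longrightarrow> b q = (0::real)"
    using local_extension[OF Ux Z smooth_on_const[of _ 1]] by metis
  have "b p = 1" using b(3)[of "x p"] chart_inv[OF Ux] b(1) by simp
  moreover have "f q * b q = 0" if "q \<in> carrier A" for q
  proof (cases "q \<in> N")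
    case False
    then have "q \<notin> inv_into U x ` (x ` (U \<inter> N))"
      using chart_inv[OF Ux(1)] by auto
    then show ?thesis using b(4)[OF that] by simp
  qed (simp add: N(3))
  then have "v (\<lambda>q. f q * b q) = v (\<lambda>q. 0)"
    by (intro tangent_cong smooth_fun_mult f b) auto
  ultimately show ?thesis
    using tangent_mult[OF f b(2)] tangent_const[of 0] N by simp
qed

lemma tangent_local:
  assumes "smooth_fun A f" "smooth_fun A h" "openin T N" "p \<in> N" "\<And>q. q \<in> N \<Longrightarrow> f q = h q"
  shows "v f = v h"
  using tangent_local_0[OF smooth_fun_diff[OF assms(1,2)] assms(3,4)] assms(5)
    tangent_diff[OF assms(1,2)] by simp

end

text \<open>The tangent vector with components \<open>c\<close> in the chart. The value 0 on
  non-smooth functions is the normalisation that \<open>tangent_space\<close> requires, so that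
  equality of tangent vectors is equality of functions.\<close>

definition chart_vec :: "'p set \<Rightarrow> ('p \<Rightarrow> 'e) \<Rightarrow> 'p \<Rightarrow> 'e \<Rightarrow> 'p tangent" where
  "chart_vec U x p c =
    (\<lambda>f. if smooth_fun A f then frechet_derivative (\<lambda>z. f (inv_into U x z)) (at (x p)) c else 0)"

context
  fixes U x p assumes Ux: "(U, x) \<in> A" and p: "p \<in> U"
begin

lemma smooth_fun_has_derivative:
  assumes "smooth_fun A f"
  shows "((\<lambda>z. f (inv_into U x z)) has_derivative
    frechet_derivative (\<lambda>z. f (inv_into U x z)) (at (x p))) (at (x p))"
  using smooth_on_has_derivative[OF smooth_fun_chart[OF Ux assms]] p by blast

lemma chart_vec_eq:
  "smooth_fun A f \<Longrightarrow> ((\<lambda>z. f (inv_into U x z)) has_derivative D) (at (x p)) \<Longrightarrow>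
    chart_vec U x p c f = D c"
  using frechet_derivative_at[of "\<lambda>z. f (inv_into U x z)" D "x p"] by (simp add: chart_vec_def)

lemma chart_vec_tangent: "chart_vec U x p c \<in> tangent_space A p"
  unfolding tangent_space_def
proof (intro CollectI conjI allI impI; (elim conjE)?)
  show "chart_vec U x p c f = 0" if "\<not> smooth_fun A f" for f
    using that by (simp add: chart_vec_def)
next
  fix f h assume fh: "smooth_fun A f" "smooth_fun A h"
  note D = smooth_fun_has_derivative[OF fh(1)] smooth_fun_has_derivative[OF fh(2)]
  show "chart_vec U x p c f = chart_vec U x p c h" if eq: "\<forall>q\<in>carrier A. f q = h q"
  proof -
    have "f (inv_into U x z) = h (inv_into U x z)" if "z \<in> x ` U" for z
      using eq inv_chart(2)[OF Ux that] chart_subset[OF Ux] by auto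
    then have "frechet_derivative (\<lambda>z. f (inv_into U x z)) (at (x p)) =
        frechet_derivative (\<lambda>z. h (inv_into U x z)) (at (x p))"
      by (rule frechet_derivative_cong[OF chart_image_open[OF Ux] imageI[OF p]])
    then show ?thesis using fh by (simp add: chart_vec_def)
  qed
  show "chart_vec U x p c (\<lambda>q. a * f q + b * h q) = a * chart_vec U x p c f + b * chart_vec U x p c h" for a b
    by (subst (1) chart_vec_eq[where D = "\<lambda>c. a * frechet_derivative (\<lambda>z. f (inv_into U x z)) (at (x p)) c +
          b * frechet_derivative (\<lambda>z. h (inv_into U x z)) (at (x p)) c"])
      (use fh D in \<open>auto intro!: smooth_fun_add smooth_fun_mult smooth_fun_const derivative_intros
        simp: chart_vec_def\<close>)
  show "chart_vec U x p c (\<lambda>q. f q * h q) = f p * chart_vec U x p c h + h p * chart_vec U x p c f"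
    by (subst (1) chart_vec_eq[OF smooth_fun_mult[OF fh] has_derivative_mult[OF D]])
      (use fh chart_inv[OF Ux p] in \<open>simp add: chart_vec_def\<close>)
qed

lemma chart_vec_linear:
  "chart_vec U x p (a *\<^sub>R c + b *\<^sub>R d) = (\<lambda>f. a * chart_vec U x p c f + b * chart_vec U x p d f)"
  using has_derivative_linear[OF smooth_fun_has_derivative]
  by (auto simp: chart_vec_def fun_eq_iff linear_add linear_scale)

lemma chart_vec_sum:
  "chart_vec U x p (\<Sum>i\<in>I. a i *\<^sub>R c i) = (\<lambda>f. \<Sum>i\<in>I. a i * chart_vec U x p (c i) f)"
  using has_derivative_linear[OF smooth_fun_has_derivative]
  by (auto simp: chart_vec_def fun_eq_iff linear_sum linear_scale)

text \<open>Coordinate functions exist on the chart only and have to be cut off, each with its own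
  radius. Cutting off only the basis coordinates and combining them linearly gives one radius that
  serves all directions i.\<close>

lemma chart_coordinate:
  obtains f r where "r > 0" "ball (x p) r \<subseteq> x ` U" "\<And>i. smooth_fun A (f i)"
    "\<And>i z. z \<in> ball (x p) r \<Longrightarrow> f i (inv_into U x z) = z \<bullet> i"
proof -
  have h: "smooth_on (x ` U) (\<lambda>z. z \<bullet> i)" for i
    by (intro smooth_on_linear[OF bounded_linear_inner_left] smooth_on_ident chart_image_open[OF Ux])
  have "\<exists>f r. r > 0 \<and> ball (x p) r \<subseteq> x ` U \<and> smooth_fun A f \<and>
      (\<forall>z\<in>ball (x p) r. f (inv_into U x z) = z \<bullet> i)" for i
    using local_extension[OF Ux p chart_image_open[OF Ux] imageI[OF p] subset_refl h[of i]] by metis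
  then obtain f r where f: "\<And>i. r i > 0" "\<And>i. ball (x p) (r i) \<subseteq> x ` U" "\<And>i. smooth_fun A (f i)"
    "\<And>i z. z \<in> ball (x p) (r i) \<Longrightarrow> f i (inv_into U x z) = z \<bullet> i"
    by metis
  define F where "F i q = (\<Sum>j\<in>Basis. (i \<bullet> j) * f j q)" for i q
  define R where "R = Min (r ` Basis)"
  have R: "R > 0" "\<And>j. j \<in> Basis \<Longrightarrow> R \<le> r j" using f(1) by (auto simp: R_def)
  show ?thesis
  proof (rule that[of R F])
    show "ball (x p) R \<subseteq> x ` U"
      using f(2) R(2) subset_ball SOME_Basis by (meson order_trans)
    show "smooth_fun A (F i)" for i
      unfolding F_def by (intro smooth_fun_sum smooth_fun_mult smooth_fun_const f)
    show "F i (inv_into U x z) = z \<bullet> i" if "z \<in> ball (x p) R" for i z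
    proof -
      have "f j (inv_into U x z) = z \<bullet> j" if "j \<in> Basis" for j
        using f(4)[of z j] R(2)[OF that] \<open>z \<in> ball (x p) R\<close> by auto
      then have "F i (inv_into U x z) = (\<Sum>j\<in>Basis. (i \<bullet> j) * (z \<bullet> j))"
        by (simp add: F_def)
      also have "\<dots> = z \<bullet> i"
        by (metis euclidean_inner inner_commute)
      finally show ?thesis .
    qed
  qed (use R in auto)
qed

lemma chart_vec_local:
  assumes "smooth_fun A f" "open Z" "x p \<in> Z" "\<And>z. z \<in> Z \<Longrightarrow> f (inv_into U x z) = h z"
    "(h has_derivative D) (at (x p))"
  shows "chart_vec U x p c f = D c"
proof (rule chart_vec_eq[OF assms(1)])
  show "((\<lambda>z. f (inv_into U x z)) has_derivative D) (at (x p))"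
    by (rule has_derivative_transform_within_open[OF assms(5,2,3)]) (use assms(4) in auto)
qed

lemma chart_vec_coordinate:
  assumes "smooth_fun A f" "open Z" "x p \<in> Z" "\<And>z. z \<in> Z \<Longrightarrow> f (inv_into U x z) = z \<bullet> i"
  shows "chart_vec U x p c f = c \<bullet> i"
  by (rule chart_vec_local[OF assms]) (auto intro!: derivative_eq_intros)

lemma chart_vec_inject:
  assumes "chart_vec U x p c = chart_vec U x p d"
  shows "c = d"
proof -
  obtain f r where f: "r > 0" "\<And>i. smooth_fun A (f i)"
    "\<And>i z. z \<in> ball (x p) r \<Longrightarrow> f i (inv_into U x z) = z \<bullet> i"
    using chart_coordinate by metis
  have "chart_vec U x p c (f i) = c \<bullet> i" for c i
    by (rule chart_vec_coordinate[OF f(2) open_ball _ f(3)]) (use f(1) in auto)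
  then have "c \<bullet> i = d \<bullet> i" for i
    using assms by metis
  then show ?thesis by (rule euclidean_eqI)
qed

text \<open>Derivations are directional derivatives: in the Hadamard expansion of f at p each
  summand is a product whose first factor vanishes at p, so the product rule leaves v(coordinate i)
  times the i-th partial derivative of f.\<close>

lemma tangent_chart_vec:
  assumes v: "v \<in> tangent_space A p"
  obtains c where "v = chart_vec U x p c"
proof -
  obtain X r where X: "r > 0" "ball (x p) r \<subseteq> x ` U" "\<And>i. smooth_fun A (X i)"
    "\<And>i z. z \<in> ball (x p) r \<Longrightarrow> X i (inv_into U x z) = z \<bullet> i"
    using chart_coordinate by metis
  define c where "c = (\<Sum>i\<in>Basis. v (X i) *\<^sub>R i)"
  have "v f = chart_vec U x p c f" if f: "smooth_fun A f" for f
  proof -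
    let ?f = "\<lambda>z. f (inv_into U x z)"
    obtain h where h: "\<And>i. smooth_on (ball (x p) r) (h i)"
      "\<And>z. z \<in> ball (x p) r \<Longrightarrow> ?f z = ?f (x p) + (\<Sum>i\<in>Basis. ((z - x p) \<bullet> i) * h i z)"
      "\<And>i. h i (x p) = frechet_derivative ?f (at (x p)) i"
      using Hadamard_expansion[OF smooth_on_subset[OF smooth_fun_chart[OF Ux f] X(2)] X(1)] by metis
    have "\<exists>H s. s > 0 \<and> ball (x p) s \<subseteq> ball (x p) r \<and> smooth_fun A H \<and>
        (\<forall>z\<in>ball (x p) s. H (inv_into U x z) = h i z)" for i
      using local_extension[OF Ux p open_ball _ X(2) h(1)] X(1) centre_in_ball by metis
    then obtain H s where H: "\<And>i. s i > 0" "\<And>i. ball (x p) (s i) \<subseteq> ball (x p) r" "\<And>i. smooth_fun A (H i)"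
      "\<And>i z. z \<in> ball (x p) (s i) \<Longrightarrow> H i (inv_into U x z) = h i z"
      by metis
    define S where "S = Min (s ` Basis)"
    have S: "S > 0" "\<And>j. j \<in> Basis \<Longrightarrow> S \<le> s j" using H(1) by (auto simp: S_def)
    have Sr: "ball (x p) S \<subseteq> ball (x p) r"
      using H(2) S(2) subset_ball SOME_Basis by (meson order_trans)
    \<comment> \<open>The Hadamard expansion with coordinates and coefficients replaced by their
      global extensions; it agrees with f near p, which suffices by
      \<open>tangent_local\<close>.\<close>
    define F where "F q = f p + (\<Sum>i\<in>Basis. (X i q - x p \<bullet> i) * H i q)" for q
    have smF: "smooth_fun A (\<lambda>q. (X i q - x p \<bullet> i) * H i q)" for i
      by (intro smooth_fun_mult smooth_fun_diff X H smooth_fun_const)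
    have F: "smooth_fun A F"
      unfolding F_def by (intro smooth_fun_add smooth_fun_sum smF smooth_fun_const)
    have "v f = v F"
    proof (rule tangent_local[OF v f F inv_chart_image_openin[OF Ux open_ball]])
      show "ball (x p) S \<subseteq> x ` U" using Sr X(2) by blast
      show "p \<in> inv_into U x ` ball (x p) S"
        using S(1) chart_inv[OF Ux p] by (metis centre_in_ball imageI)
      fix q assume "q \<in> inv_into U x ` ball (x p) S"
      then obtain z where z: "q = inv_into U x z" "z \<in> ball (x p) S" by auto
      have "H i q = h i z" if "i \<in> Basis" for i
        using H(4)[of z i] S(2)[OF that] z by auto
      moreover have "X i q = z \<bullet> i" for i
        using X(4) z Sr by blast
      ultimately show "f q = F q"
        using h(2)[of z] z Sr chart_inv[OF Ux p] by (auto simp: F_def inner_diff_left)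
    qed
    also have "\<dots> = (\<Sum>i\<in>Basis. v (X i) * h i (x p))"
    proof -
      have "v (\<lambda>q. (X i q - x p \<bullet> i) * H i q) = v (X i) * h i (x p)" for i
      proof -
        have "X i p = x p \<bullet> i" "H i p = h i (x p)"
          using X(4)[of "x p" i] H(4)[of "x p" i] X(1) H(1) chart_inv[OF Ux p] by auto
        then show ?thesis
          using tangent_mult[OF v smooth_fun_diff[OF X(3) smooth_fun_const] H(3)]
            tangent_diff[OF v X(3) smooth_fun_const] tangent_const[OF v] by simp
      qed
      moreover have "v F = v (\<lambda>q. f p) + v (\<lambda>q. \<Sum>i\<in>Basis. (X i q - x p \<bullet> i) * H i q)"
        unfolding F_def by (intro tangent_add[OF v] smooth_fun_const smooth_fun_sum smF)
      moreover have "v (\<lambda>q. \<Sum>i\<in>Basis. (X i q - x p \<bullet> i) * H i q) =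
          (\<Sum>i\<in>Basis. v (\<lambda>q. (X i q - x p \<bullet> i) * H i q))"
        by (intro tangent_sum[OF v] smF)
      ultimately show ?thesis using tangent_const[OF v] by simp
    qed
    also have "\<dots> = chart_vec U x p c f"
      using has_derivative_linear[OF smooth_fun_has_derivative[OF f]] f
      by (simp add: chart_vec_def c_def h(3) linear_sum linear_scale)
    finally show ?thesis .
  qed
  then have "v = chart_vec U x p c"
    using tangent_nonsmooth[OF v] by (auto simp: chart_vec_def fun_eq_iff)
  then show ?thesis using that by blast
qed

lemma tangent_combination:
  assumes "u \<in> tangent_space A p" "v \<in> tangent_space A p"
  shows "(\<lambda>f. a * u f + b * v f) \<in> tangent_space A p"
proof -
  obtain c where c: "u = chart_vec U x p c" using tangent_chart_vec[OF assms(1)] .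
  obtain d where d: "v = chart_vec U x p d" using tangent_chart_vec[OF assms(2)] .
  show ?thesis
    using chart_vec_tangent[of "a *\<^sub>R c + b *\<^sub>R d"] by (simp only: c d chart_vec_linear)
qed

end

section \<open>Vector fields and Lie brackets in coordinates\<close>

lemma vector_field_tangent: "vector_field A X \<Longrightarrow> p \<in> carrier A \<Longrightarrow> X p \<in> tangent_space A p"
  by (auto simp: vector_field_def)

lemma vector_field_smooth:
  assumes "vector_field A X"
  shows "smooth_fun A (\<lambda>p. X p f)"
proof (cases "smooth_fun A f")
  case False
  show ?thesis
    by (rule smooth_fun_cong[OF smooth_fun_const[of 0]])
      (use False tangent_nonsmooth vector_field_tangent[OF assms] in metis)
qed (use assms in \<open>auto simp: vector_field_def\<close>)

text \<open>The components are recovered by applying X to extended coordinate functions, and this is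
  smooth by the definition of a vector field.\<close>

lemma vector_field_coords:
  assumes X: "vector_field A X" and Ux: "(U, x) \<in> A"
  obtains c where "smooth_on (x ` U) c" "\<And>p. p \<in> U \<Longrightarrow> X p = chart_vec U x p (c (x p))"
proof -
  have "\<forall>p\<in>U. \<exists>c. X p = chart_vec U x p c"
    using tangent_chart_vec[OF Ux] vector_field_tangent[OF X] chart_subset[OF Ux] by (metis subsetD)
  then obtain c' where c': "\<And>p. p \<in> U \<Longrightarrow> X p = chart_vec U x p (c' p)" by metis
  define c where "c z = c' (inv_into U x z)" for z
  have c: "X p = chart_vec U x p (c (x p))" if "p \<in> U" for p
    using c' that chart_inv[OF Ux that] by (simp add: c_def)
  have "smooth_on (x ` U) c"
  proof (rule smooth_on_local)
    fix z assume "z \<in> x ` U"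
    then obtain p where p: "p \<in> U" "z = x p" by auto
    obtain f r where f: "r > 0" "ball (x p) r \<subseteq> x ` U" "\<And>i. smooth_fun A (f i)"
      "\<And>i z. z \<in> ball (x p) r \<Longrightarrow> f i (inv_into U x z) = z \<bullet> i"
      using chart_coordinate[OF Ux p(1)] by metis
    have eq: "X (inv_into U x z) (f i) = c z \<bullet> i" if z: "z \<in> ball (x p) r" for z i
    proof -
      have zU: "z \<in> x ` U" using z f(2) by blast
      then have q: "inv_into U x z \<in> U" "x (inv_into U x z) = z" using inv_chart[OF Ux] by auto
      have "chart_vec U x (inv_into U x z) (c z) (f i) = c z \<bullet> i"
        by (rule chart_vec_coordinate[OF Ux q(1) f(3) open_ball _ f(4)]) (use z q(2) in auto)
      then show ?thesis using c[OF q(1)] q(2) by simp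
    qed
    have "smooth_on (ball (x p) r) (\<lambda>z. \<Sum>i\<in>Basis. X (inv_into U x z) (f i) *\<^sub>R i)"
      by (intro smooth_on_sum smooth_on_linear[OF bounded_linear_scaleR_left] open_ball
          smooth_on_subset[OF smooth_fun_chart[OF Ux vector_field_smooth[OF X]] f(2)])
    then have "smooth_on (ball (x p) r) c"
      by (rule smooth_on_cong) (auto simp: eq euclidean_representation)
    then show "\<exists>V. open V \<and> z \<in> V \<and> smooth_on V c"
      using f(1) p(2) centre_in_ball open_ball by blast
  qed
  then show ?thesis using that c by blast
qed

text \<open>In the product rule the mixed terms X(f) Y(h) and X(h) Y(f) cancel. The identities for
  the inner field hold on the carrier only and are passed through the outer derivation by
  \<open>tangent_cong\<close>.\<close>

lemma lie_bracket_tangent: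
  assumes X: "vector_field A X" and Y: "vector_field A Y" and p: "p \<in> carrier A"
  shows "lie_bracket X Y p \<in> tangent_space A p"
proof -
  note t = vector_field_tangent[OF X] vector_field_tangent[OF Y]
  note s = vector_field_smooth[OF X] vector_field_smooth[OF Y]
  show ?thesis
    unfolding tangent_space_def lie_bracket_def
  proof (intro CollectI conjI allI impI; (elim conjE)?)
    fix f assume f: "\<not> smooth_fun A f"
    have "X p (\<lambda>q. Y q f) = X p (\<lambda>q. 0)" "Y p (\<lambda>q. X q f) = Y p (\<lambda>q. 0)"
      using tangent_cong[OF t(1)[OF p] s(2), of f "\<lambda>q. 0"] tangent_cong[OF t(2)[OF p] s(1), of f "\<lambda>q. 0"]
        tangent_nonsmooth[OF t(1) f] tangent_nonsmooth[OF t(2) f] by auto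
    then show "X p (\<lambda>q. Y q f) - Y p (\<lambda>q. X q f) = 0"
      using tangent_const[OF t(1)[OF p]] tangent_const[OF t(2)[OF p]] by simp
  next
    fix f h assume fh: "smooth_fun A f" "smooth_fun A h"
    {
      assume eq: "\<forall>q\<in>carrier A. f q = h q"
      have "X p (\<lambda>q. Y q f) = X p (\<lambda>q. Y q h)"
        by (rule tangent_cong[OF t(1)[OF p] s(2)]) (use tangent_cong[OF t(2) fh(1), of _ h] eq in auto)
      moreover have "Y p (\<lambda>q. X q f) = Y p (\<lambda>q. X q h)"
        by (rule tangent_cong[OF t(2)[OF p] s(1)]) (use tangent_cong[OF t(1) fh(1), of _ h] eq in auto)
      ultimately show "X p (\<lambda>q. Y q f) - Y p (\<lambda>q. X q f) = X p (\<lambda>q. Y q h) - Y p (\<lambda>q. X q h)" by simp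
    }
    {
      fix a b :: real
      have "X p (\<lambda>q. Y q (\<lambda>q. a * f q + b * h q)) = X p (\<lambda>q. a * Y q f + b * Y q h)"
        by (rule tangent_cong[OF t(1)[OF p] s(2)]) (use tangent_linear[OF t(2) fh] in auto)
      moreover have "Y p (\<lambda>q. X q (\<lambda>q. a * f q + b * h q)) = Y p (\<lambda>q. a * X q f + b * X q h)"
        by (rule tangent_cong[OF t(2)[OF p] s(1)]) (use tangent_linear[OF t(1) fh] in auto)
      ultimately show "X p (\<lambda>q. Y q (\<lambda>q. a * f q + b * h q)) - Y p (\<lambda>q. X q (\<lambda>q. a * f q + b * h q))
          = a * (X p (\<lambda>q. Y q f) - Y p (\<lambda>q. X q f)) + b * (X p (\<lambda>q. Y q h) - Y p (\<lambda>q. X q h))"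
        by (simp add: tangent_linear[OF t(1)[OF p] s(2) s(2)] tangent_linear[OF t(2)[OF p] s(1) s(1)]
            algebra_simps)
    }
    have "X p (\<lambda>q. Y q (\<lambda>q. f q * h q)) = X p (\<lambda>q. f q * Y q h + h q * Y q f)"
      by (rule tangent_cong[OF t(1)[OF p] s(2)]) (use tangent_mult[OF t(2) fh] in auto)
    moreover have "Y p (\<lambda>q. X q (\<lambda>q. f q * h q)) = Y p (\<lambda>q. f q * X q h + h q * X q f)"
      by (rule tangent_cong[OF t(2)[OF p] s(1)]) (use tangent_mult[OF t(1) fh] in auto)
    ultimately show "X p (\<lambda>q. Y q (\<lambda>q. f q * h q)) - Y p (\<lambda>q. X q (\<lambda>q. f q * h q))
        = f p * (X p (\<lambda>q. Y q h) - Y p (\<lambda>q. X q h)) + h p * (X p (\<lambda>q. Y q f) - Y p (\<lambda>q. X q f))"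
      by (simp add: tangent_add[OF t(1)[OF p]] tangent_add[OF t(2)[OF p]] smooth_fun_mult fh s
          tangent_mult[OF t(1)[OF p]] tangent_mult[OF t(2)[OF p]] algebra_simps)
  qed
qed

lemma lie_bracket_vector_field:
  assumes X: "vector_field A X" and Y: "vector_field A Y"
  shows "vector_field A (lie_bracket X Y)"
  unfolding vector_field_def
proof (intro conjI ballI allI impI)
  show "lie_bracket X Y p \<in> tangent_space A p" if "p \<in> carrier A" for p
    using lie_bracket_tangent[OF X Y that] .
  show "smooth_fun A (\<lambda>p. lie_bracket X Y p f)" for f
    unfolding lie_bracket_def
    by (intro smooth_fun_diff vector_field_smooth X Y)
qed

text \<open>The bracket is known to be some coordinate vector e; evaluating it on the extended
  coordinate functions identifies the components of e.\<close>

lemma lie_bracket_coords: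
  assumes X: "vector_field A X" and Y: "vector_field A Y" and Ux: "(U, x) \<in> A" and p: "p \<in> U"
    and c: "smooth_on (x ` U) c" "\<And>p. p \<in> U \<Longrightarrow> X p = chart_vec U x p (c (x p))"
    and d: "smooth_on (x ` U) d" "\<And>p. p \<in> U \<Longrightarrow> Y p = chart_vec U x p (d (x p))"
  shows "lie_bracket X Y p = chart_vec U x p
    (frechet_derivative d (at (x p)) (c (x p)) - frechet_derivative c (at (x p)) (d (x p)))"
proof -
  have "p \<in> carrier A" using p chart_subset[OF Ux] by auto
  then obtain e where e: "lie_bracket X Y p = chart_vec U x p e"
    using tangent_chart_vec[OF Ux p lie_bracket_tangent[OF X Y]] by metis
  obtain f r where f: "r > 0" "ball (x p) r \<subseteq> x ` U" "\<And>i. smooth_fun A (f i)"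
    "\<And>i z. z \<in> ball (x p) r \<Longrightarrow> f i (inv_into U x z) = z \<bullet> i"
    using chart_coordinate[OF Ux p] by metis
  have coord: "V (inv_into U x z) (f i) = k z \<bullet> i" if z: "z \<in> ball (x p) r"
    and k: "\<And>p. p \<in> U \<Longrightarrow> V p = chart_vec U x p (k (x p))" for V k i z
  proof -
    have zU: "z \<in> x ` U" using z f(2) by blast
    then have q: "inv_into U x z \<in> U" "x (inv_into U x z) = z" using inv_chart[OF Ux] by auto
    have "chart_vec U x (inv_into U x z) (k z) (f i) = k z \<bullet> i"
      by (rule chart_vec_coordinate[OF Ux q(1) f(3) open_ball _ f(4)]) (use z q(2) in auto)
    then show ?thesis using k[OF q(1)] q(2) by simp
  qed
  have D: "chart_vec U x p k (\<lambda>q. V q (f i)) = frechet_derivative l (at (x p)) k \<bullet> i"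
    if V: "vector_field A V" and l: "smooth_on (x ` U) l" "\<And>p. p \<in> U \<Longrightarrow> V p = chart_vec U x p (l (x p))"
    for V l i k
  proof (rule chart_vec_local[OF Ux p vector_field_smooth[OF V] open_ball])
    show "x p \<in> ball (x p) r" using f(1) by simp
    show "((\<lambda>z. l z \<bullet> i) has_derivative (\<lambda>k. frechet_derivative l (at (x p)) k \<bullet> i)) (at (x p))"
      using has_derivative_inner_left[OF smooth_on_has_derivative[OF l(1)]] p by blast
  qed (use coord l(2) in blast)
  have "e \<bullet> i = (frechet_derivative d (at (x p)) (c (x p)) - frechet_derivative c (at (x p)) (d (x p))) \<bullet> i" for i
  proof -
    have "chart_vec U x p e (f i) = e \<bullet> i"
      by (rule chart_vec_coordinate[OF Ux p f(3) open_ball _ f(4)]) (use f(1) in auto)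
    then have "e \<bullet> i = lie_bracket X Y p (f i)" using e by simp
    also have "\<dots> = chart_vec U x p (c (x p)) (\<lambda>q. Y q (f i)) - chart_vec U x p (d (x p)) (\<lambda>q. X q (f i))"
      by (simp add: lie_bracket_def c(2)[OF p] d(2)[OF p])
    finally show ?thesis using D[OF X c] D[OF Y d] by (simp add: inner_diff_left)
  qed
  then have "e = frechet_derivative d (at (x p)) (c (x p)) - frechet_derivative c (at (x p)) (d (x p))"
    by (rule euclidean_eqI)
  then show ?thesis using e by simp
qed

end

section \<open>Integrable total differential equations\<close>

text \<open>Smoothness yields continuity of the derivative only in each fixed direction, so the
  uniform bound is assembled from the basis directions.\<close>

lemma smooth_on_derivative_bound:
  fixes f :: "'a::euclidean_space \<Rightarrow> 'b::real_normed_vector"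
  assumes f: "smooth_on U f" and K: "compact K" "K \<subseteq> U"
  obtains C where "C \<ge> 0" "\<And>z w. z \<in> K \<Longrightarrow> norm (frechet_derivative f (at z) w) \<le> C * norm w"
proof -
  let ?D = "\<lambda>z. frechet_derivative f (at z)"
  have "\<exists>B\<ge>0. \<forall>z\<in>K. norm (?D z i) \<le> B" for i
  proof -
    have "continuous_on K (\<lambda>z. ?D z i)"
      using continuous_on_subset[OF smooth_on_continuous[OF smooth_on_derivative[OF f]] K(2)] .
    then have "bounded ((\<lambda>z. ?D z i) ` K)"
      using compact_continuous_image[OF _ K(1)] compact_imp_bounded by blast
    then obtain B where "B > 0" "\<forall>z\<in>K. norm (?D z i) \<le> B"
      unfolding bounded_pos by blast
    then show ?thesis using less_imp_le by blast
  qed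
  then obtain B where B: "\<And>i. B i \<ge> 0" "\<And>i z. z \<in> K \<Longrightarrow> norm (?D z i) \<le> B i" by metis
  have "norm (?D z w) \<le> (\<Sum>i\<in>Basis. B i) * norm w" if z: "z \<in> K" for z w
  proof -
    have "linear (?D z)"
      using has_derivative_linear[OF smooth_on_has_derivative[OF f]] z K(2) by blast
    then have "norm (?D z w) = norm (\<Sum>i\<in>Basis. (w \<bullet> i) *\<^sub>R ?D z i)"
      using linear_sum_Basis by metis
    also have "\<dots> \<le> (\<Sum>i\<in>Basis. norm w * B i)"
      by (intro sum_norm_le) (auto intro!: mult_mono B z simp: Basis_le_norm)
    finally show ?thesis by (simp add: sum_distrib_left mult.commute)
  qed
  moreover have "(\<Sum>i\<in>Basis. B i) \<ge> 0" using B(1) by (simp add: sum_nonneg)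
  ultimately show ?thesis using that by blast
qed

lemma smooth_on_Lipschitz:
  fixes f :: "'a::euclidean_space \<Rightarrow> 'b::real_normed_vector"
  assumes f: "smooth_on U f" and K: "compact K" "convex K" "K \<subseteq> U"
  obtains C where "C \<ge> 0" "\<And>z w. z \<in> K \<Longrightarrow> w \<in> K \<Longrightarrow> norm (f w - f z) \<le> C * norm (w - z)"
proof -
  obtain C where C: "C \<ge> 0" "\<And>z w. z \<in> K \<Longrightarrow> norm (frechet_derivative f (at z) w) \<le> C * norm w"
    using smooth_on_derivative_bound[OF f K(1,3)] by blast
  have "norm (f w - f z) \<le> C * norm (w - z)" if "z \<in> K" "w \<in> K" for z w
  proof (rule differentiable_bound[OF K(2) _ _ that(2,1)])
    show "(f has_derivative frechet_derivative f (at x)) (at x within K)" if "x \<in> K" for x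
      using has_derivative_at_withinI[OF smooth_on_has_derivative[OF f]] that K(3) by blast
    show "onorm (frechet_derivative f (at x)) \<le> C" if "x \<in> K" for x
      by (rule onorm_le) (rule C(2)[OF that])
  qed
  then show ?thesis using that C(1) by blast
qed

text \<open>The directional derivatives are Lipschitz on K, so along the segment from z to w the
  derivative differs from the one at z by at most C |w - z|; the mean value inequality supplies the
  second factor.\<close>

lemma smooth_on_quadratic_remainder:
  fixes f :: "'a::euclidean_space \<Rightarrow> 'b::real_normed_vector"
  assumes f: "smooth_on U f" and K: "compact K" "convex K" "K \<subseteq> U"
  obtains C where "C \<ge> 0" "\<And>z w. z \<in> K \<Longrightarrow> w \<in> K \<Longrightarrow>
    norm (f w - f z - frechet_derivative f (at z) (w - z)) \<le> C * (norm (w - z))\<^sup>2"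
proof -
  let ?D = "\<lambda>z. frechet_derivative f (at z)"
  have "\<exists>B\<ge>0. \<forall>z\<in>K. \<forall>w\<in>K. norm (?D w i - ?D z i) \<le> B * norm (w - z)" for i
    using smooth_on_Lipschitz[OF smooth_on_derivative[OF f, of i] K] by metis
  then obtain B where B: "\<And>i. B i \<ge> 0"
    "\<And>i z w. z \<in> K \<Longrightarrow> w \<in> K \<Longrightarrow> norm (?D w i - ?D z i) \<le> B i * norm (w - z)" by metis
  define C where "C = (\<Sum>i\<in>Basis. B i)"
  have C0: "C \<ge> 0" using B(1) by (simp add: C_def sum_nonneg)
  have D: "(f has_derivative ?D z) (at z)" if "z \<in> K" for z
    using smooth_on_has_derivative[OF f] that K(3) by blast
  have CD: "norm (?D w v - ?D z v) \<le> (C * norm (w - z)) * norm v" if z: "z \<in> K" "w \<in> K" for z w v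
  proof -
    have "norm (?D w v - ?D z v) = norm (\<Sum>i\<in>Basis. (v \<bullet> i) *\<^sub>R (?D w i - ?D z i))"
      using linear_sum_Basis[OF has_derivative_linear[OF D[OF z(1)]], of v]
        linear_sum_Basis[OF has_derivative_linear[OF D[OF z(2)]], of v]
      by (simp add: sum_subtractf scaleR_diff_right)
    also have "\<dots> \<le> (\<Sum>i\<in>Basis. norm v * (B i * norm (w - z)))"
      by (intro sum_norm_le) (auto intro!: mult_mono B z simp: Basis_le_norm)
    also have "\<dots> = (C * norm (w - z)) * norm v"
      by (simp add: C_def sum_distrib_left sum_distrib_right mult_ac)
    finally show ?thesis .
  qed
  have "norm (f w - f z - ?D z (w - z)) \<le> C * (norm (w - z))\<^sup>2" if z: "z \<in> K" "w \<in> K" for z w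
  proof -
    have sub: "closed_segment z w \<subseteq> K"
      using closed_segment_subset[OF z K(2)] .
    have "norm (f w - f z - ?D z (w - z)) \<le> norm (w - z) * (C * norm (w - z))"
    proof (rule differentiable_bound_linearization[of z w "closed_segment z w"])
      show "z + t *\<^sub>R (w - z) \<in> closed_segment z w" if "t \<in> {0..1}" for t
        using that by (auto simp: in_segment algebra_simps intro!: exI[of _ t])
      show "(f has_derivative ?D x) (at x within closed_segment z w)" if "x \<in> closed_segment z w" for x
        using D sub that has_derivative_at_withinI by blast
      show "onorm (?D x - ?D z) \<le> C * norm (w - z)" if x: "x \<in> closed_segment z w" for x
      proof (rule onorm_le)
        fix v :: 'a
        have "norm (x - z) \<le> norm (w - z)"
          using segment_bound(1)[OF x] .
        then have "(C * norm (x - z)) * norm v \<le> (C * norm (w - z)) * norm v"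
          by (intro mult_right_mono mult_left_mono C0) auto
        then show "norm ((?D x - ?D z) v) \<le> (C * norm (w - z)) * norm v"
          using CD[OF z(1) subsetD[OF sub x], of v] by simp
      qed
    qed auto
    then show ?thesis by (simp add: power2_eq_square mult_ac)
  qed
  then show ?thesis using that C0 by blast
qed

text \<open>A Gronwall estimate without exponentials: where |f| attains its maximum, at t0, the mean
  value inequality on an interval of length at most 1 gives |f t0| \<le> |f t0| / 2 + e.\<close>

lemma norm_le_of_derivative_le:
  fixes f :: "real \<Rightarrow> 'b::real_normed_vector"
  assumes der: "\<And>t. t \<in> {0..1} \<Longrightarrow> (f has_vector_derivative f' t) (at t within {0..1})"
    and f0: "f 0 = 0" and le: "\<And>t. t \<in> {0..1} \<Longrightarrow> norm (f' t) \<le> norm (f t) / 2 + e"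
    and t: "t \<in> {0..1}"
  shows "norm (f t) \<le> 2 * e"
proof -
  have "continuous_on {0..1} f"
    using der has_vector_derivative_continuous continuous_on_eq_continuous_within by blast
  then obtain t0 where t0: "t0 \<in> {0..1}" "\<And>t. t \<in> {0..1} \<Longrightarrow> norm (f t) \<le> norm (f t0)"
    using continuous_attains_sup[of "{0..1::real}" "\<lambda>t. norm (f t)"] continuous_on_norm by fastforce
  let ?B = "norm (f t0) / 2 + e"
  have B: "norm (f' t) \<le> ?B" if "t \<in> {0..1}" for t
    using le[OF that] t0(2)[OF that] by simp
  have B0: "?B \<ge> 0" using order_trans[OF norm_ge_zero B[of 0]] by simp
  have "norm (f t0 - f 0) \<le> ?B * norm (t0 - 0)"
  proof (rule differentiable_bound[of "{0..1}" f "\<lambda>t s. s *\<^sub>R f' t"])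
    show "onorm (\<lambda>s. s *\<^sub>R f' t) \<le> ?B" if "t \<in> {0..1}" for t
      by (rule onorm_le) (use mult_right_mono[OF B[OF that]] in \<open>simp add: mult.commute\<close>)
  qed (use der t0(1) in \<open>auto simp: has_vector_derivative_def\<close>)
  also have "\<dots> \<le> ?B * 1"
    using t0(1) B0 by (intro mult_left_mono) auto
  finally have "norm (f t0) \<le> 2 * e" using f0 by simp
  then show ?thesis using t0(2)[OF t] by simp
qed

text \<open>Data for the system F'(s) = Y(F(s)): \<open>Y z\<close> is the linear map prescribed as
  the derivative where F takes the value z. Along a ray this is an ordinary differential equation;
  the compatibility of different rays enters with \<open>solution\<close>.\<close>

locale total_differential_equation =
  fixes Y :: "'b::euclidean_space \<Rightarrow> 'a::euclidean_space \<Rightarrow> 'b" and z0 :: 'b and R L M :: real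
  assumes R: "R > 0" and L: "L \<ge> 0" and M: "M \<ge> 0"
    and cont: "continuous_on (cball z0 R \<times> UNIV) (\<lambda>(z, s). Y z s)"
    and lin: "z \<in> cball z0 R \<Longrightarrow> linear (Y z)"
    and Lip: "z \<in> cball z0 R \<Longrightarrow> w \<in> cball z0 R \<Longrightarrow> norm (Y z s - Y w s) \<le> L * norm (z - w) * norm s"
    and bound: "z \<in> cball z0 R \<Longrightarrow> norm (Y z s) \<le> M * norm s"
begin

text \<open>The first bound makes the Picard operator a contraction with factor 1/2, the second
  keeps its values in the ball of radius R; the summands 1 guard against L = 0 and M = 0.\<close>

definition r where "r = min (1 / (2 * (L + 1))) (R / (M + 1))"

lemma r: "r > 0" "L * r \<le> 1 / 2" "M * r \<le> R"
proof -
  show "r > 0" using R L M by (auto simp: r_def)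
  have "L * r \<le> L * (1 / (2 * (L + 1)))" using L by (intro mult_left_mono) (auto simp: r_def)
  also have "\<dots> \<le> 1 / 2" using L by (simp add: field_simps)
  finally show "L * r \<le> 1 / 2" .
  have "M * r \<le> M * (R / (M + 1))" using M by (intro mult_left_mono) (auto simp: r_def)
  also have "\<dots> \<le> R" using M R by (simp add: field_simps)
  finally show "M * r \<le> R" .
qed

text \<open>The Picard operator along the rays from the origin; the two nearest point projections make
  it a contraction of the whole space of bounded continuous functions.\<close>

definition picard :: "('a \<Rightarrow>\<^sub>C 'b) \<Rightarrow> 'a \<Rightarrow> 'b" where
  "picard G s = z0 + integral (cbox 0 1) (\<lambda>t::real.
     Y (closest_point (cball z0 R) (G (t *\<^sub>R closest_point (cball 0 r) s))) (closest_point (cball 0 r) s))"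

lemma closest: "closest_point (cball z0 R) z \<in> cball z0 R" "norm (closest_point (cball 0 r) s) \<le> r"
  using closest_point_in_set[of "cball z0 R" z] closest_point_in_set[of "cball 0 r" s] R r(1) by auto

lemma picard_integrand_continuous:
  "continuous_on (UNIV \<times> cbox 0 1) (\<lambda>(s, t::real).
     Y (closest_point (cball z0 R) (apply_bcontfun G (t *\<^sub>R closest_point (cball 0 r) s))) (closest_point (cball 0 r) s))"
proof -
  have c: "continuous_on UNIV (closest_point (cball z0 R))" "continuous_on UNIV (closest_point (cball (0::'a) r))"
    using R r(1) by (auto intro!: continuous_on_closest_point)
  have G: "continuous_on UNIV (apply_bcontfun G)" by (simp add: continuous_on_apply_bcontfun)
  show ?thesis
    unfolding case_prod_unfold
    by (rule continuous_on_compose2[OF cont[unfolded case_prod_unfold], where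
          f = "\<lambda>x. (closest_point (cball z0 R) (apply_bcontfun G (snd x *\<^sub>R closest_point (cball 0 r) (fst x))),
            closest_point (cball 0 r) (fst x))", simplified])
      (auto intro!: continuous_intros continuous_on_compose2[OF c(1)] continuous_on_compose2[OF c(2)]
        continuous_on_compose2[OF G] closest[simplified])
qed

lemma picard_integrable: "(\<lambda>t::real. Y (closest_point (cball z0 R) (apply_bcontfun G (t *\<^sub>R closest_point (cball 0 r) s)))
    (closest_point (cball 0 r) s)) integrable_on cbox 0 1"
proof (rule integrable_continuous)
  show "continuous_on (cbox 0 1) (\<lambda>t::real. Y (closest_point (cball z0 R) (apply_bcontfun G
      (t *\<^sub>R closest_point (cball 0 r) s))) (closest_point (cball 0 r) s))"
    using continuous_on_compose2[OF picard_integrand_continuous[unfolded case_prod_unfold, of G]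
        continuous_on_Pair[OF continuous_on_const[of "cbox 0 1" s] continuous_on_id]]
    by auto
qed

lemma picard_bound: "norm (picard G s - z0) \<le> M * r"
proof -
  have "norm (picard G s - z0) \<le> M * r * measure lborel (cbox 0 (1::real))"
    unfolding picard_def add_diff_cancel_left'
  proof (rule integrable_bound[OF _ picard_integrable])
    show "norm (Y (closest_point (cball z0 R) (apply_bcontfun G (t *\<^sub>R closest_point (cball 0 r) s)))
        (closest_point (cball 0 r) s)) \<le> M * r" for t
      using order_trans[OF bound[OF closest(1)] mult_left_mono[OF closest(2) M]] .
  qed (use M r in auto)
  then show ?thesis by simp
qed

lemma picard_bcontfun: "picard G \<in> bcontfun"
proof (rule bcontfun_normI)
  show "continuous_on UNIV (picard G)"
    unfolding picard_def
    by (intro continuous_intros integral_continuous_on_param picard_integrand_continuous)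
  show "norm (picard G s) \<le> norm z0 + M * r" for s
    using norm_triangle_ineq[of z0 "picard G s - z0"] picard_bound[of G s] by simp
qed

lemma picard_contraction: "dist (Bcontfun (picard G)) (Bcontfun (picard H)) \<le> (1 / 2) * dist G H"
proof (rule dist_bound)
  fix s :: 'a
  let ?w = "closest_point (cball 0 r) s"
  let ?y = "\<lambda>G (t::real). Y (closest_point (cball z0 R) (apply_bcontfun G (t *\<^sub>R ?w))) ?w"
  have "norm (?y G t - ?y H t) \<le> (1 / 2) * dist G H" for t
  proof -
    let ?u = "closest_point (cball z0 R) (apply_bcontfun G (t *\<^sub>R ?w))"
    let ?v = "closest_point (cball z0 R) (apply_bcontfun H (t *\<^sub>R ?w))"
    have "norm (?u - ?v) \<le> dist (apply_bcontfun G (t *\<^sub>R ?w)) (apply_bcontfun H (t *\<^sub>R ?w))"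
      unfolding dist_norm[symmetric] by (rule closest_point_lipschitz) (use R in auto)
    also have "\<dots> \<le> dist G H" by (rule dist_bounded)
    finally have "L * norm (?u - ?v) * norm ?w \<le> L * dist G H * r"
      by (intro mult_mono closest mult_nonneg_nonneg L) auto
    also have "\<dots> \<le> (1 / 2) * dist G H"
      using mult_right_mono[OF r(2), of "dist G H"] by (simp add: mult_ac)
    finally show ?thesis using Lip[OF closest(1) closest(1)] order_trans by blast
  qed
  then have "norm (integral (cbox 0 1) (\<lambda>t. ?y G t - ?y H t)) \<le> (1 / 2) * dist G H * measure lborel (cbox 0 (1::real))"
    by (intro integrable_bound integrable_diff picard_integrable) auto
  then have "norm (picard G s - picard H s) \<le> (1 / 2) * dist G H"
    using integral_diff[OF picard_integrable[of G s] picard_integrable[of H s]]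
    by (simp add: picard_def)
  then show "dist (apply_bcontfun (Bcontfun (picard G)) s) (apply_bcontfun (Bcontfun (picard H)) s)
      \<le> (1 / 2) * dist G H"
    by (simp add: Bcontfun_inverse picard_bcontfun dist_norm)
qed

text \<open>The fixed point equation expresses F(s) by an integral over the whole ray only. Applied
  to all points of the ray through s, it becomes an integral equation in the ray parameter, which
  can be differentiated.\<close>

lemma ray_solution:
  obtains F where "F 0 = z0" "\<And>s. F s \<in> cball z0 R"
    "\<And>s t. s \<in> cball 0 r \<Longrightarrow> t \<in> {0..1} \<Longrightarrow>
      ((\<lambda>t. F (t *\<^sub>R s)) has_vector_derivative Y (F (t *\<^sub>R s)) s) (at t within {0..1})"
proof -
  have "\<exists>!G. Bcontfun (picard G) = G"
    by (rule banach_fix_type[of "1 / 2"]) (use picard_contraction in auto)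
  then obtain G where "Bcontfun (picard G) = G" by blast
  then have G: "picard G s = apply_bcontfun G s" for s
    using Bcontfun_inverse[OF picard_bcontfun, of G] by simp
  define F where "F = apply_bcontfun G"
  have F: "F s \<in> cball z0 R" for s
    using picard_bound[of G s] r(3) G[of s] by (simp add: F_def dist_norm norm_minus_commute)
  \<comment> \<open>Both projections are inactive here: s lies in the ball of radius r, and the
    values of F lie in the ball of radius R.\<close>
  have int: "F s = z0 + integral (cbox 0 1) (\<lambda>t::real. Y (F (t *\<^sub>R s)) s)" if "s \<in> cball 0 r" for s
    using G[of s] closest_point_self[OF that] closest_point_self[OF F]
    by (simp add: picard_def F_def)
  have Fc: "continuous_on UNIV F" by (simp add: F_def continuous_on_apply_bcontfun)
  show ?thesis
  proof (rule that[of F])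
    show "F 0 = z0"
      using int[of 0] r(1) linear_0[OF lin[OF F]] by simp
    fix s :: 'a and t :: real assume s: "s \<in> cball 0 r" and t: "t \<in> {0..1}"
    let ?k = "\<lambda>u::real. Y (F (u *\<^sub>R s)) s"
    let ?K = "\<lambda>\<tau>. integral {0..\<tau>} ?k"
    have k: "continuous_on {0..1} ?k"
    proof -
      have "continuous_on {0..1} (\<lambda>u. (F (u *\<^sub>R s), s))"
        by (intro continuous_intros continuous_on_compose2[OF Fc]) auto
      moreover have "(\<lambda>u. (F (u *\<^sub>R s), s)) ` {0..1} \<subseteq> cball z0 R \<times> UNIV"
        using F by blast
      ultimately show ?thesis
        using continuous_on_compose2[OF cont[unfolded case_prod_unfold]] by fastforce
    qed
    have K: "(?K has_vector_derivative ?k \<tau>) (at \<tau> within {0..1})" if "\<tau> \<in> {0..1}" for \<tau>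
      using integral_has_vector_derivative[OF k that] .
    \<comment> \<open>Substitute u \<tau> for the integration variable; linearity of Y in its second
      argument absorbs the factor \<tau> of the substitution into the direction \<tau> s.\<close>
    have eq: "F (\<tau> *\<^sub>R s) = z0 + ?K \<tau>" if \<tau>: "\<tau> \<in> {0..1}" for \<tau>
    proof -
      have ts: "\<tau> *\<^sub>R s \<in> cball 0 r"
        using s \<tau> mult_mono[of \<tau> 1 "norm s" r] by simp
      have tau: "u * \<tau> \<in> {0..1}" if "u \<in> {0..1}" for u
        using that \<tau> mult_mono[of u 1 \<tau> 1] by auto
      have "((\<lambda>u. ?K (u * \<tau>)) has_vector_derivative \<tau> *\<^sub>R ?k (u * \<tau>)) (at u within {0..1})"
        if u: "u \<in> {0..1}" for u
      proof (rule vector_diff_chain_within[of "\<lambda>u. u * \<tau>" \<tau> u "{0..1}" ?K, unfolded o_def])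
        show "((\<lambda>u. u * \<tau>) has_vector_derivative \<tau>) (at u within {0..1})"
          by (auto intro!: derivative_eq_intros)
        show "(?K has_vector_derivative ?k (u * \<tau>)) (at (u * \<tau>) within (\<lambda>u. u * \<tau>) ` {0..1})"
          by (rule has_vector_derivative_within_subset[OF K[OF tau[OF u]]]) (use tau in auto)
      qed
      then have "((\<lambda>u. \<tau> *\<^sub>R ?k (u * \<tau>)) has_integral (?K (1 * \<tau>) - ?K (0 * \<tau>))) {0..1}"
        by (intro fundamental_theorem_of_calculus) auto
      moreover have "\<tau> *\<^sub>R ?k (u * \<tau>) = Y (F (u *\<^sub>R (\<tau> *\<^sub>R s))) (\<tau> *\<^sub>R s)" for u
        using linear_scale[OF lin[OF F]] by simp
      ultimately show ?thesis
        using int[OF ts] by (simp add: integral_unique)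
    qed
    show "((\<lambda>t. F (t *\<^sub>R s)) has_vector_derivative Y (F (t *\<^sub>R s)) s) (at t within {0..1})"
    proof (rule has_vector_derivative_transform[OF t])
      show "((\<lambda>\<tau>. z0 + ?K \<tau>) has_vector_derivative Y (F (t *\<^sub>R s)) s) (at t within {0..1})"
        using has_vector_derivative_add[OF has_vector_derivative_const K[OF t]] by simp
    qed (use eq in auto)
  qed (use F in auto)
qed

text \<open>If the system is integrable, the error E of the first order expansion satisfies, along the
  ray through s, the inequality |E'| \<le> |E|/2 + C |v|^2.\<close>

lemma solution:
  fixes D :: "'b \<Rightarrow> 'a \<Rightarrow> 'b \<Rightarrow> 'b"
  assumes Q: "Q \<ge> 0"
    and D: "\<And>z s. z \<in> cball z0 R \<Longrightarrow> ((\<lambda>z. Y z s) has_derivative D z s) (at z)"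
    and D_bound: "\<And>z s w. z \<in> cball z0 R \<Longrightarrow> norm (D z s w) \<le> L * norm s * norm w"
    and remainder: "\<And>z w s. z \<in> cball z0 R \<Longrightarrow> w \<in> cball z0 R \<Longrightarrow>
      norm (Y w s - Y z s - D z s (w - z)) \<le> Q * norm s * (norm (w - z))\<^sup>2"
    and integrable: "\<And>z s v. z \<in> cball z0 R \<Longrightarrow> D z s (Y z v) = D z v (Y z s)"
  obtains F where "F 0 = z0" "\<And>s. F s \<in> cball z0 R"
    "\<And>s. s \<in> ball 0 r \<Longrightarrow> (F has_derivative Y (F s)) (at s)"
proof -
  obtain F where F0: "F 0 = z0" and F: "\<And>s. F s \<in> cball z0 R" and
    ray: "\<And>s t. s \<in> cball 0 r \<Longrightarrow> t \<in> {0..1} \<Longrightarrow>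
      ((\<lambda>t. F (t *\<^sub>R s)) has_vector_derivative Y (F (t *\<^sub>R s)) s) (at t within {0..1})"
    by (rule ray_solution) (rule that)
  \<comment> \<open>The first summand collects the quadratic remainder of Y in direction s, the
    second the Lipschitz error in direction v, both with the distance bound 2 M |v| for the two
    rays.\<close>
  define C where "C = Q * r * (2 * M)\<^sup>2 + L * (2 * M)"
  have C: "C * (norm v)\<^sup>2 = Q * r * (2 * (M * norm v))\<^sup>2 + L * (2 * (M * norm v)) * norm v" for v :: 'a
    by (simp add: C_def power2_eq_square algebra_simps)
  have main: "norm (F (s + v) - F s - Y (F s) v) \<le> 2 * (C * (norm v)\<^sup>2)"
    if s: "s \<in> cball 0 r" and sv: "s + v \<in> cball 0 r" for s v
  proof -
    let ?F1 = "\<lambda>t. F (t *\<^sub>R s)" and ?F2 = "\<lambda>t. F (t *\<^sub>R (s + v))"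
    have half: "L * norm (z - w) * norm u \<le> norm (z - w) / 2" if "u \<in> cball 0 r" for u :: 'a and z w :: 'b
    proof -
      have "L * norm u \<le> 1 / 2" using mult_left_mono[of "norm u" r L] L r(2) that by auto
      from mult_right_mono[OF this, of "norm (z - w)"] show ?thesis by (simp add: mult_ac)
    qed
    \<comment> \<open>The rays through s and s + v start at the same point and their equations
      differ by at most M |v| apart from the Lipschitz term, so the Gronwall estimate bounds their
      distance.\<close>
    have d1: "norm (?F2 t - ?F1 t) \<le> 2 * (M * norm v)" if t: "t \<in> {0..1}" for t
    proof (rule norm_le_of_derivative_le[where f' = "\<lambda>t. Y (?F2 t) (s + v) - Y (?F1 t) s", OF _ _ _ t])
      show "((\<lambda>t. ?F2 t - ?F1 t) has_vector_derivative Y (?F2 t) (s + v) - Y (?F1 t) s) (at t within {0..1})"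
        if "t \<in> {0..1}" for t
        by (intro has_vector_derivative_diff ray s sv that)
      show "norm (Y (?F2 t) (s + v) - Y (?F1 t) s) \<le> norm (?F2 t - ?F1 t) / 2 + M * norm v"
        if "t \<in> {0..1}" for t
      proof -
        have "Y (?F2 t) (s + v) - Y (?F1 t) s = (Y (?F2 t) (s + v) - Y (?F1 t) (s + v)) + Y (?F1 t) v"
          using linear_add[OF lin[OF F[of "t *\<^sub>R s"]], of s v] by simp
        then have "norm (Y (?F2 t) (s + v) - Y (?F1 t) s) \<le>
            norm (Y (?F2 t) (s + v) - Y (?F1 t) (s + v)) + norm (Y (?F1 t) v)"
          using norm_triangle_ineq by metis
        then show ?thesis
          using Lip[OF F[of "t *\<^sub>R (s + v)"] F[of "t *\<^sub>R s"], of "s + v"] half[OF sv, of "?F2 t" "?F1 t"]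
            bound[OF F[of "t *\<^sub>R s"], of v] by linarith
      qed
    qed simp
    \<comment> \<open>If F is differentiable, moving s to s + v should move the ray at time t by
      Y(F(t s)) applied to t v. At t = 1, E is the error of the first order expansion at s.\<close>
    let ?E = "\<lambda>t. ?F2 t - ?F1 t - t *\<^sub>R Y (?F1 t) v"
    let ?E' = "\<lambda>t. Y (?F2 t) (s + v) - Y (?F1 t) s - (t *\<^sub>R D (?F1 t) v (Y (?F1 t) s) + Y (?F1 t) v)"
    have "norm (?E 1) \<le> 2 * (C * (norm v)\<^sup>2)"
    proof (rule norm_le_of_derivative_le[where f' = ?E' and f = ?E])
      fix t :: real assume t: "t \<in> {0..1}"
      have "((\<lambda>t. Y (?F1 t) v) has_vector_derivative D (?F1 t) v (Y (?F1 t) s)) (at t within {0..1})"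
        using vector_derivative_diff_chain_within[OF ray[OF s t] has_derivative_at_withinI[OF D[OF F]], of v]
        by (simp add: o_def)
      then have "((\<lambda>t. t *\<^sub>R Y (?F1 t) v) has_vector_derivative
          t *\<^sub>R D (?F1 t) v (Y (?F1 t) s) + 1 *\<^sub>R Y (?F1 t) v) (at t within {0..1})"
        by (intro has_vector_derivative_scaleR) (auto intro!: derivative_eq_intros)
      then show "(?E has_vector_derivative ?E' t) (at t within {0..1})"
        by (intro has_vector_derivative_diff ray s sv t) simp
      have lD: "linear (D (?F1 t) s)"
        using has_derivative_linear[OF D[OF F]] .
      \<comment> \<open>E' splits into a Taylor remainder, a product of two quantities of order |v|,
        and the linearised equation applied to E itself; the first two are of order |v|^2, the third
        is at most |E|/2 by the choice of r.\<close>
      define e1 e2 e3 where "e1 = Y (?F2 t) s - Y (?F1 t) s - D (?F1 t) s (?F2 t - ?F1 t)"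
        and "e2 = Y (?F2 t) v - Y (?F1 t) v" and "e3 = D (?F1 t) s (?E t)"
      have E1: "Y (?F2 t) (s + v) = Y (?F2 t) s + Y (?F2 t) v"
        by (rule linear_add[OF lin[OF F]])
      \<comment> \<open>This is where \<open>integrable\<close> acts: it turns t D s (Y v) into t D
        v (Y s), the term that arises from differentiating Y(F(t s)) v along the ray, so the two
        cancel.\<close>
      have E3: "e3 = D (?F1 t) s (?F2 t - ?F1 t) - t *\<^sub>R D (?F1 t) v (Y (?F1 t) s)"
        unfolding e3_def linear_diff[OF lD, of "?F2 t - ?F1 t"] linear_scale[OF lD] integrable[OF F] ..
      have "?E' t = e1 + e2 + e3"
        unfolding E3 e1_def e2_def E1 by simp
      then have "norm (?E' t) \<le> norm e1 + norm e2 + norm e3"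
        using norm_triangle_ineq[of "e1 + e2" e3] norm_triangle_ineq[of e1 e2] by simp
      moreover have "norm e1 \<le> Q * r * (2 * (M * norm v))\<^sup>2"
      proof -
        have "Q * norm s * (norm (?F2 t - ?F1 t))\<^sup>2 \<le> Q * r * (2 * (M * norm v))\<^sup>2"
          using s r(1) d1[OF t] Q by (intro mult_mono power_mono) auto
        then show ?thesis
          unfolding e1_def using remainder[OF F[of "t *\<^sub>R s"] F[of "t *\<^sub>R (s + v)"], of s] by linarith
      qed
      moreover have "norm e2 \<le> L * (2 * (M * norm v)) * norm v"
      proof -
        have "L * norm (?F2 t - ?F1 t) * norm v \<le> L * (2 * (M * norm v)) * norm v"
          by (intro mult_right_mono mult_left_mono d1[OF t] L norm_ge_zero)
        then show ?thesis
          unfolding e2_def using Lip[OF F[of "t *\<^sub>R (s + v)"] F[of "t *\<^sub>R s"], of v] by linarith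
      qed
      moreover have "norm e3 \<le> norm (?E t) / 2"
        using D_bound[OF F[of "t *\<^sub>R s"], of s "?E t"] half[OF s, of "?E t" 0]
        by (simp add: e3_def mult_ac)
      ultimately show "norm (?E' t) \<le> norm (?E t) / 2 + C * (norm v)\<^sup>2"
        unfolding C by linarith
    qed (use F0 in simp_all)
    then show ?thesis by simp
  qed
  have der: "(F has_derivative Y (F s)) (at s)" if s: "s \<in> ball 0 r" for s
    unfolding has_derivative_at
  proof
    show "bounded_linear (Y (F s))"
      using lin[OF F] linear_conv_bounded_linear by blast
    define d where "d = r - norm s"
    have d: "d > 0" using s by (simp add: d_def)
    show "(\<lambda>h. norm (F (s + h) - F s - Y (F s) h) / norm h) \<midarrow>0\<rightarrow> 0"
    proof (rule Lim_null_comparison)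
      show "\<forall>\<^sub>F h in at 0. norm (norm (F (s + h) - F s - Y (F s) h) / norm h) \<le> 2 * (C * norm h)"
        unfolding eventually_at
      proof (intro exI conjI ballI impI)
        fix h :: 'a assume h: "h \<noteq> 0 \<and> dist h 0 < d"
        then have "s + h \<in> cball 0 r"
          using norm_triangle_ineq[of s h] by (simp add: d_def)
        then have "norm (F (s + h) - F s - Y (F s) h) \<le> 2 * (C * (norm h)\<^sup>2)"
          using main s by simp
        then show "norm (norm (F (s + h) - F s - Y (F s) h) / norm h) \<le> 2 * (C * norm h)"
          using h by (simp add: field_simps power2_eq_square)
      qed (rule d)
      show "((\<lambda>h::'a. 2 * (C * norm h)) \<longlongrightarrow> 0) (at 0)"
        by (auto intro!: tendsto_eq_intros)
    qed
  qed
  show ?thesis using that F0 F der by blast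
qed

end

text \<open>A small closed ball in U supplies the constants by compactness. For regularity, the
  derivative of F in direction v is Y(F(s)) v, which is C^k as soon as F is, so F is
  C^(k+1).\<close>

lemma exists_integral_graph:
  fixes Y :: "'b::euclidean_space \<Rightarrow> 'a::euclidean_space \<Rightarrow> 'b"
  assumes U: "open U" "z0 \<in> U" and smooth: "\<And>s. smooth_on U (\<lambda>z. Y z s)"
    and lin: "\<And>z. z \<in> U \<Longrightarrow> linear (Y z)"
    and integrable: "\<And>z s v. z \<in> U \<Longrightarrow>
      frechet_derivative (\<lambda>z. Y z s) (at z) (Y z v) = frechet_derivative (\<lambda>z. Y z v) (at z) (Y z s)"
  obtains F r where "r > 0" "F 0 = z0" "F ` ball 0 r \<subseteq> U" "smooth_on (ball 0 r) F"
    "\<And>s. s \<in> ball 0 r \<Longrightarrow> (F has_derivative Y (F s)) (at s)"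
proof -
  obtain R where K0: "R > 0" "cball z0 R \<subseteq> U"
    using U open_contains_cball by blast
  define D where "D z s = frechet_derivative (\<lambda>z. Y z s) (at z)" for z s
  have D: "((\<lambda>z. Y z s) has_derivative D z s) (at z)" if "z \<in> U" for z s
    using smooth_on_has_derivative[OF smooth that] by (simp add: D_def)
  have Yrep: "Y z s = (\<Sum>i\<in>Basis. (s \<bullet> i) *\<^sub>R Y z i)" if "z \<in> U" for z s
    using linear_sum_Basis[OF lin[OF that]] .
  have Drep: "D z s w = (\<Sum>i\<in>Basis. (s \<bullet> i) *\<^sub>R D z i w)" if z: "z \<in> U" for z s w
  proof -
    have "((\<lambda>z. \<Sum>i\<in>Basis. (s \<bullet> i) *\<^sub>R Y z i) has_derivative (\<lambda>w. \<Sum>i\<in>Basis. (s \<bullet> i) *\<^sub>R D z i w)) (at z)"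
      by (intro has_derivative_sum has_derivative_scaleR_right D z)
    then have "((\<lambda>z. Y z s) has_derivative (\<lambda>w. \<Sum>i\<in>Basis. (s \<bullet> i) *\<^sub>R D z i w)) (at z)"
      by (rule has_derivative_transform_within_open[OF _ U(1) z]) (use Yrep in auto)
    then show ?thesis
      using has_derivative_unique[OF D[OF z]] by metis
  qed
  have K: "compact (cball z0 R)" "convex (cball z0 R)" by auto
  have "\<exists>C\<ge>0. \<forall>z\<in>cball z0 R. norm (Y z i) \<le> C" for i
  proof -
    have "bounded ((\<lambda>z. Y z i) ` cball z0 R)"
      using compact_continuous_image[OF continuous_on_subset[OF smooth_on_continuous[OF smooth] K0(2)] K(1)]
        compact_imp_bounded by blast
    then show ?thesis unfolding bounded_pos by (meson image_eqI less_imp_le)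
  qed
  then obtain B1 where B1: "\<And>i. B1 i \<ge> 0" "\<And>i z. z \<in> cball z0 R \<Longrightarrow> norm (Y z i) \<le> B1 i" by metis
  have "\<exists>C\<ge>0. \<forall>z\<in>cball z0 R. \<forall>w\<in>cball z0 R. norm (Y z i - Y w i) \<le> C * norm (z - w)" for i
    using smooth_on_Lipschitz[OF smooth K K0(2)] by metis
  then obtain B2 where B2: "\<And>i. B2 i \<ge> 0"
    "\<And>i z w. z \<in> cball z0 R \<Longrightarrow> w \<in> cball z0 R \<Longrightarrow> norm (Y z i - Y w i) \<le> B2 i * norm (z - w)" by metis
  have "\<exists>C\<ge>0. \<forall>z\<in>cball z0 R. \<forall>w. norm (D z i w) \<le> C * norm w" for i
    using smooth_on_derivative_bound[OF smooth K(1) K0(2)] unfolding D_def by metis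
  then obtain B3 where B3: "\<And>i. B3 i \<ge> 0" "\<And>i z w. z \<in> cball z0 R \<Longrightarrow> norm (D z i w) \<le> B3 i * norm w" by metis
  have "\<exists>C\<ge>0. \<forall>z\<in>cball z0 R. \<forall>w\<in>cball z0 R. norm (Y w i - Y z i - D z i (w - z)) \<le> C * (norm (w - z))\<^sup>2" for i
    using smooth_on_quadratic_remainder[OF smooth K K0(2)] unfolding D_def by metis
  then obtain B4 where B4: "\<And>i. B4 i \<ge> 0" "\<And>i z w. z \<in> cball z0 R \<Longrightarrow> w \<in> cball z0 R \<Longrightarrow>
    norm (Y w i - Y z i - D z i (w - z)) \<le> B4 i * (norm (w - z))\<^sup>2" by metis
  \<comment> \<open>The estimates are available in basis directions only; linearity in s carries
    them over to all s.\<close>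
  have sum_bound: "norm (\<Sum>i\<in>Basis. (s \<bullet> i) *\<^sub>R k i) \<le> (\<Sum>i\<in>Basis. B i) * norm s * e"
    if "\<And>i. norm (k i) \<le> B i * e" for s :: 'a and k :: "'a \<Rightarrow> 'b" and B e
  proof -
    have "norm (\<Sum>i\<in>Basis. (s \<bullet> i) *\<^sub>R k i) \<le> (\<Sum>i\<in>Basis. norm s * (B i * e))"
      by (intro sum_norm_le) (auto intro!: mult_mono that simp: Basis_le_norm)
    then show ?thesis by (simp add: sum_distrib_left sum_distrib_right mult_ac)
  qed
  define M where "M = (\<Sum>i\<in>Basis. B1 i)"
  define L2 where "L2 = (\<Sum>i\<in>Basis. B2 i)"
  define L3 where "L3 = (\<Sum>i\<in>Basis. B3 i)"
  define Q where "Q = (\<Sum>i\<in>Basis. B4 i)"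
  have nn: "M \<ge> 0" "L2 \<ge> 0" "L3 \<ge> 0" "Q \<ge> 0"
    using B1(1) B2(1) B3(1) B4(1) by (auto simp: M_def L2_def L3_def Q_def sum_nonneg)
  \<comment> \<open>One constant must serve both as Lipschitz constant of Y and as bound of its
    derivative in z, hence the sum \<open>L2 + L3\<close>.\<close>
  have tde: "total_differential_equation Y z0 R (L2 + L3) M"
  proof (rule total_differential_equation.intro)
    have "continuous_on (cball z0 R \<times> UNIV) (\<lambda>(z, s). \<Sum>i\<in>Basis. (s \<bullet> i) *\<^sub>R Y z i)"
      unfolding case_prod_unfold
      by (intro continuous_intros continuous_on_compose2[OF smooth_on_continuous[OF smooth]])
        (use K0(2) in auto)
    then show "continuous_on (cball z0 R \<times> UNIV) (\<lambda>(z, s). Y z s)"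
      by (rule continuous_on_eq) (use Yrep K0(2) in auto)
    show "linear (Y z)" if "z \<in> cball z0 R" for z using lin K0(2) that by blast
    show "norm (Y z s) \<le> M * norm s" if z: "z \<in> cball z0 R" for z s
      using sum_bound[of "Y z" B1 1 s] B1(2)[OF z] Yrep[of z s] z K0(2) by (auto simp: M_def)
    show "norm (Y z s - Y w s) \<le> (L2 + L3) * norm (z - w) * norm s"
      if z: "z \<in> cball z0 R" "w \<in> cball z0 R" for z w s
    proof -
      have "norm (Y z s - Y w s) \<le> L2 * norm s * norm (z - w)"
        using sum_bound[of "\<lambda>i. Y z i - Y w i" B2 "norm (z - w)" s] B2(2)[OF z] Yrep[of z s] Yrep[of w s]
          subsetD[OF K0(2) z(1)] subsetD[OF K0(2) z(2)]
        by (auto simp: L2_def sum_subtractf scaleR_diff_right)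
      also have "\<dots> \<le> (L2 + L3) * norm (z - w) * norm s"
        using nn by (simp add: algebra_simps)
      finally show ?thesis .
    qed
  qed (use K0 nn in auto)
  interpret total_differential_equation Y z0 R "L2 + L3" M by (rule tde)
  obtain F where F: "F 0 = z0" "\<And>s. F s \<in> cball z0 R"
    "\<And>s. s \<in> ball 0 r \<Longrightarrow> (F has_derivative Y (F s)) (at s)"
  proof (rule solution[OF nn(4), of D])
    show "((\<lambda>z. Y z s) has_derivative D z s) (at z)" if "z \<in> cball z0 R" for z s
      using D K0(2) that by blast
    show "norm (D z s w) \<le> (L2 + L3) * norm s * norm w" if z: "z \<in> cball z0 R" for z s w
    proof -
      have "norm (D z s w) \<le> L3 * norm s * norm w"
        using sum_bound[of "\<lambda>i. D z i w" B3 "norm w" s] B3(2)[OF z] Drep[of z s w] z K0(2)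
        by (auto simp: L3_def)
      also have "\<dots> \<le> (L2 + L3) * norm s * norm w"
        using nn by (simp add: algebra_simps)
      finally show ?thesis .
    qed
    show "norm (Y w s - Y z s - D z s (w - z)) \<le> Q * norm s * (norm (w - z))\<^sup>2"
      if z: "z \<in> cball z0 R" "w \<in> cball z0 R" for z w s
      using sum_bound[of "\<lambda>i. Y w i - Y z i - D z i (w - z)" B4 "(norm (w - z))\<^sup>2" s] B4(2)[OF z]
        Yrep[of z s] Yrep[of w s] Drep[of z s "w - z"] subsetD[OF K0(2) z(1)] subsetD[OF K0(2) z(2)]
      by (auto simp: Q_def sum_subtractf scaleR_diff_right)
    show "D z s (Y z v) = D z v (Y z s)" if "z \<in> cball z0 R" for z s v
      using integrable K0(2) that by (auto simp: D_def)
  qed auto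
  have sub: "F ` ball 0 r \<subseteq> U" using F(2) K0(2) by auto
  have "C_diff_on k (ball 0 r) F" for k
  proof (induction k)
    case 0
    have "isCont F s" if "s \<in> ball 0 r" for s
      using has_derivative_continuous[OF F(3)[OF that]] .
    then show ?case by (simp add: continuous_at_imp_continuous_on)
  next
    case (Suc k)
    have "C_diff_on k (ball 0 r) (\<lambda>s. frechet_derivative F (at s) v)" for v
    proof (rule C_diff_on_cong[OF open_ball])
      show "Y (F s) v = frechet_derivative F (at s) v" if "s \<in> ball 0 r" for s
        using fun_cong[OF frechet_derivative_at[OF F(3)[OF that]]] .
      show "C_diff_on k (ball 0 r) (\<lambda>s. Y (F s) v)"
        using C_diff_on_compose[OF _ Suc.IH open_ball sub, of "\<lambda>z. Y z v"] smooth[of v]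
        by (simp add: smooth_on_def)
    qed
    moreover have "F differentiable (at s)" if "s \<in> ball 0 r" for s
      using F(3)[OF that] unfolding differentiable_def by blast
    ultimately show ?case by simp
  qed
  then show ?thesis
    using that[of r F] r(1) F(1,3) sub by (auto simp: smooth_on_def)
qed

section \<open>The Frobenius theorem for distributions of rank three\<close>

text \<open>Cramer's rule, with the determinants written as triple products.\<close>

lemma cross3_expansion:
  fixes u v w s :: "real ^ 3"
  shows "(s \<bullet> cross3 v w) *\<^sub>R u + (s \<bullet> cross3 w u) *\<^sub>R v + (s \<bullet> cross3 u v) *\<^sub>R w
    = (u \<bullet> cross3 v w) *\<^sub>R s"
  by (simp add: vec_eq_iff forall_3 cross3_def inner_vec_def sum_3; algebra)

text \<open>Up to the determinant, the cross products are the basis dual to u, v, w.\<close>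

lemma cross3_coefficients:
  fixes u v w :: "real ^ 3"
  shows "(a *\<^sub>R u + b *\<^sub>R v + c *\<^sub>R w) \<bullet> cross3 v w = a * (u \<bullet> cross3 v w)"
    "(a *\<^sub>R u + b *\<^sub>R v + c *\<^sub>R w) \<bullet> cross3 w u = b * (u \<bullet> cross3 v w)"
    "(a *\<^sub>R u + b *\<^sub>R v + c *\<^sub>R w) \<bullet> cross3 u v = c * (u \<bullet> cross3 v w)"
  by (simp_all add: cross3_def inner_vec_def sum_3; algebra)+

text \<open>The normalised system is Y z = G z composed with the inverse of P \<circ> G z. The
  commutator of two normalised fields lies in the range of \<open>G z\<close> by involutivity and in
  the kernel of P by the normalisation, and these meet in 0 only.\<close>

lemma exists_integral_graph_3:
  fixes c :: "3 \<Rightarrow> 'b::euclidean_space \<Rightarrow> 'b"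
  defines "G \<equiv> \<lambda>z (a::real ^ 3). \<Sum>i\<in>UNIV. (a $ i) *\<^sub>R c i z"
  assumes U: "open U" "z0 \<in> U" and c: "\<And>i. smooth_on U (c i)"
    and independent: "\<And>a. G z0 a = 0 \<Longrightarrow> a = 0"
    and involutive: "\<And>z i j. z \<in> U \<Longrightarrow>
      \<exists>a. frechet_derivative (c i) (at z) (c j z) - frechet_derivative (c j) (at z) (c i z) = G z a"
  obtains P :: "'b \<Rightarrow> real ^ 3" and F r Y where "linear P" "r > 0" "F 0 = z0" "F ` ball 0 r \<subseteq> U"
    "smooth_on (ball 0 r) F" "\<And>s. s \<in> ball 0 r \<Longrightarrow> P (F s) = P z0 + s"
    "\<And>s. s \<in> ball 0 r \<Longrightarrow> (F has_derivative Y s) (at s)"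
    "\<And>s. s \<in> ball 0 r \<Longrightarrow> range (Y s) = range (G (F s))"
    "\<And>s k. s \<in> ball 0 r \<Longrightarrow> P (Y s k) = k"
proof -
  have G3: "G z a = (a $ 1) *\<^sub>R c 1 z + (a $ 2) *\<^sub>R c 2 z + (a $ 3) *\<^sub>R c 3 z" for z a
    by (simp add: G_def sum_3)
  have lG: "linear (G z)" for z
    by (rule linearI) (simp_all add: G3 algebra_simps)
  have "inj (G z0)"
    using linear_injective_0[OF lG] independent by blast
  then obtain P where lP: "linear P" and P0: "P \<circ> G z0 = id"
    using linear_injective_left_inverse[OF lG] by blast
  have bP: "bounded_linear P" using lP linear_conv_bounded_linear by blast
  define w where "w i z = P (c i z)" for i z
  have PG: "P (G z a) = (a $ 1) *\<^sub>R w 1 z + (a $ 2) *\<^sub>R w 2 z + (a $ 3) *\<^sub>R w 3 z" for z a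
    by (simp add: G3 w_def linear_add[OF lP] linear_scale[OF lP])
  define d where "d z = w 1 z \<bullet> cross3 (w 2 z) (w 3 z)" for z
  \<comment> \<open>The inverse of P \<circ> G z by Cramer's rule; the explicit formula shows that
    it depends smoothly on z.\<close>
  define N :: "'b \<Rightarrow> real ^ 3 \<Rightarrow> real ^ 3" where "N z s = inverse (d z) *\<^sub>R
    vector [s \<bullet> cross3 (w 2 z) (w 3 z), s \<bullet> cross3 (w 3 z) (w 1 z), s \<bullet> cross3 (w 1 z) (w 2 z)]" for z s
  define Y where "Y z s = G z (N z s)" for z s
  have bc: "bounded_bilinear cross3"
    using bilinear_cross bilinear_conv_bounded_bilinear by blast
  have w: "smooth_on U (w i)" for i
    unfolding w_def by (rule smooth_on_linear[OF bP c U(1)])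
  have cr: "smooth_on U (\<lambda>z. cross3 (w i z) (w j z))" for i j
    by (rule smooth_on_bilinear[OF bc w w U(1)])
  have d: "smooth_on U d"
    unfolding d_def by (rule smooth_on_bilinear[OF bounded_bilinear_inner w cr U(1)])
  \<comment> \<open>The open set where P is still injective on the distribution. It contains z0,
    because P is a left inverse of \<open>G z0\<close>, which makes the \<open>w i z0\<close> the
    standard basis and the determinant 1.\<close>
  define O' where "O' = {z \<in> U. d z \<noteq> 0}"
  have O': "open O'" "O' \<subseteq> U" "\<And>z. z \<in> O' \<Longrightarrow> d z \<noteq> 0"
  proof -
    have "open (U \<inter> d -` (- {0}))"
      by (intro continuous_open_preimage smooth_on_continuous d U) auto
    moreover have "O' = U \<inter> d -` (- {0})" by (auto simp: O'_def)
    ultimately show "open O'" by simp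
  qed (auto simp: O'_def)
  have "w i z0 = axis i 1" for i
  proof -
    have "G z0 (axis i 1) = c i z0"
      by (simp add: G_def axis_def if_distrib[of "\<lambda>x. x *\<^sub>R _"] cong: if_cong)
    then show ?thesis using P0 by (auto simp: w_def fun_eq_iff o_def dest: spec[of _ "axis i 1"])
  qed
  then have "d z0 = 1"
    by (simp add: d_def cross3_def inner_vec_def sum_3 axis_def)
  then have z0: "z0 \<in> O'" using U(2) by (simp add: O'_def)
  have PY: "P (Y z s) = s" if "z \<in> O'" for z s
  proof -
    have "P (Y z s) = inverse (d z) *\<^sub>R ((s \<bullet> cross3 (w 2 z) (w 3 z)) *\<^sub>R w 1 z
        + (s \<bullet> cross3 (w 3 z) (w 1 z)) *\<^sub>R w 2 z + (s \<bullet> cross3 (w 1 z) (w 2 z)) *\<^sub>R w 3 z)"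
      by (simp add: Y_def PG N_def scaleR_add_right)
    then show ?thesis
      unfolding cross3_expansion using O'(3)[OF that] by (simp add: d_def)
  qed
  have NG: "N z (P (G z a)) = a" if "z \<in> O'" for z a
    unfolding N_def PG cross3_coefficients d_def[symmetric]
    using O'(3)[OF that] by (simp add: vec_eq_iff forall_3)
  have lN: "linear (N z)" for z
    by (rule linearI) (simp_all add: N_def vec_eq_iff forall_3 inner_add_left algebra_simps)
  have N: "smooth_on O' (\<lambda>z. N z s $ i)" for s i
  proof -
    have sm: "smooth_on O' (\<lambda>z. inverse (d z) * (s \<bullet> cross3 (w j z) (w k z)))" for j k
      by (intro smooth_on_bilinear[OF bounded_bilinear_mult] smooth_on_inverse O'
          smooth_on_linear[OF bounded_linear_inner_right] smooth_on_subset[OF d] smooth_on_subset[OF cr])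
    consider "i = 1" | "i = 2" | "i = 3" using exhaust_3[of i] by blast
    then show ?thesis
      using sm[of 2 3] sm[of 3 1] sm[of 1 2] by cases (simp_all add: N_def)
  qed
  have c': "smooth_on O' (c i)" for i using smooth_on_subset[OF c O'(2)] .
  have Y: "smooth_on O' (\<lambda>z. Y z s)" for s
    unfolding Y_def G_def
    by (intro smooth_on_sum smooth_on_bilinear[OF bounded_bilinear_scaleR] N c' O')
  have lY: "linear (Y z)" for z
    unfolding Y_def using linear_compose[OF lN lG] by (simp add: o_def)
  \<comment> \<open>Differentiating the coefficients of Y contributes a vector in the range of
    \<open>G z\<close>. Modulo that range only derivatives of the fields \<open>c i\<close> remain,
    and they combine to brackets in the commutator.\<close>
  have DY: "frechet_derivative (\<lambda>z. Y z s) (at z) h = G z (\<chi> i. frechet_derivative (\<lambda>z. N z s $ i) (at z) h)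
      + (\<Sum>i\<in>UNIV. (N z s $ i) *\<^sub>R frechet_derivative (c i) (at z) h)" if z: "z \<in> O'" for z s h
  proof -
    have "((\<lambda>z. Y z s) has_derivative (\<lambda>h. \<Sum>i\<in>UNIV. (N z s $ i) *\<^sub>R frechet_derivative (c i) (at z) h
        + frechet_derivative (\<lambda>z. N z s $ i) (at z) h *\<^sub>R c i z)) (at z)"
      unfolding Y_def G_def
      by (intro has_derivative_sum has_derivative_scaleR smooth_on_has_derivative[OF N z]
          smooth_on_has_derivative[OF c' z])
    from fun_cong[OF frechet_derivative_at[OF this], of h] show ?thesis
      by (simp add: G_def sum.distrib add.commute)
  qed
  have integrable: "frechet_derivative (\<lambda>z. Y z s) (at z) (Y z v) = frechet_derivative (\<lambda>z. Y z v) (at z) (Y z s)"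
    if z: "z \<in> O'" for z s v
  proof -
    let ?D = "\<lambda>i. frechet_derivative (c i) (at z)"
    have lD: "linear (?D i)" for i
      using has_derivative_linear[OF smooth_on_has_derivative[OF c' z]] .
    have sub: "subspace (range (G z))"
      by (rule linear_subspace_image[OF lG subspace_UNIV])
    have DG: "?D i (Y z v) = (\<Sum>j\<in>UNIV. (N z v $ j) *\<^sub>R ?D i (c j z))" for i v
      by (simp add: Y_def G_def linear_sum[OF lD] linear_scale[OF lD])
    have "(\<Sum>i\<in>UNIV. (N z s $ i) *\<^sub>R ?D i (Y z v)) - (\<Sum>i\<in>UNIV. (N z v $ i) *\<^sub>R ?D i (Y z s))
        = (\<Sum>i\<in>UNIV. \<Sum>j\<in>UNIV. ((N z s $ i) * (N z v $ j)) *\<^sub>R (?D i (c j z) - ?D j (c i z)))"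
    proof -
      have "(\<Sum>i\<in>UNIV. (N z v $ i) *\<^sub>R ?D i (Y z s))
          = (\<Sum>j\<in>UNIV. \<Sum>i\<in>UNIV. ((N z s $ i) * (N z v $ j)) *\<^sub>R ?D j (c i z))"
        by (simp add: DG scaleR_sum_right mult.commute)
      also have "\<dots> = (\<Sum>i\<in>UNIV. \<Sum>j\<in>UNIV. ((N z s $ i) * (N z v $ j)) *\<^sub>R ?D j (c i z))"
        by (rule sum.swap)
      finally show ?thesis
        by (simp add: DG scaleR_sum_right sum_subtractf scaleR_diff_right)
    qed
    also have "\<dots> \<in> range (G z)"
      using involutive z O'(2) by (intro subspace_sum subspace_scale sub) blast
    finally have "frechet_derivative (\<lambda>z. Y z s) (at z) (Y z v) - frechet_derivative (\<lambda>z. Y z v) (at z) (Y z s)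
        \<in> range (G z)"
      using subspace_add[OF sub] subspace_diff[OF sub] unfolding DY[OF z]
      by (simp add: add_diff_add)
    then obtain b where b: "frechet_derivative (\<lambda>z. Y z s) (at z) (Y z v)
        - frechet_derivative (\<lambda>z. Y z v) (at z) (Y z s) = G z b" by blast
    \<comment> \<open>P (Y z s) = s does not depend on z. So P annihilates the commutator G z b, and
      \<open>NG\<close> gives b = 0.\<close>
    have "P (frechet_derivative (\<lambda>z. Y z s) (at z) h) = 0" for s h
    proof -
      have 1: "((\<lambda>z. P (Y z s)) has_derivative (\<lambda>h. P (frechet_derivative (\<lambda>z. Y z s) (at z) h))) (at z)"
        by (rule bounded_linear.has_derivative[OF bP smooth_on_has_derivative[OF Y z]])
      have "((\<lambda>z. P (Y z s)) has_derivative (\<lambda>h. 0)) (at z)"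
        by (rule has_derivative_transform_within_open[OF has_derivative_const[of s] O'(1) z]) (simp add: PY)
      from fun_cong[OF has_derivative_unique[OF 1 this], of h] show ?thesis .
    qed
    then have "P (G z b) = 0"
      unfolding b[symmetric] by (simp add: linear_diff[OF lP])
    then have "b = 0" using NG[OF z, of b] linear_0[OF lN] by simp
    then show ?thesis using b linear_0[OF lG] by simp
  qed
  obtain F r where F: "r > 0" "F 0 = z0" "F ` ball 0 r \<subseteq> O'" "smooth_on (ball 0 r) F"
    "\<And>s. s \<in> ball 0 r \<Longrightarrow> (F has_derivative Y (F s)) (at s)"
    using exists_integral_graph[OF O'(1) z0 Y lY integrable] by metis
  \<comment> \<open>P composed with the derivative of F is the identity. Thus P recovers the
    parameter s from F s, which later provides the chart of the leaf.\<close>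
  have "\<exists>k. \<forall>s\<in>ball 0 r. P (F s) - s = k"
  proof (rule has_derivative_zero_constant[OF convex_ball])
    fix s assume s: "s \<in> ball (0::real ^ 3) r"
    have "((\<lambda>s. P (F s) - s) has_derivative (\<lambda>h. P (Y (F s) h) - h)) (at s)"
      by (intro has_derivative_diff bounded_linear.has_derivative[OF bP F(5)[OF s]] has_derivative_ident)
    moreover have "F s \<in> O'" using F(3) s by blast
    ultimately show "((\<lambda>s. P (F s) - s) has_derivative (\<lambda>h. 0)) (at s within ball 0 r)"
      using has_derivative_at_withinI PY by simp
  qed
  then obtain k where k: "\<And>s. s \<in> ball 0 r \<Longrightarrow> P (F s) - s = k" by blast
  have "P (F s) = P z0 + s" if "s \<in> ball 0 r" for s
    using k[OF that] k[of 0] F(1,2) by (simp add: algebra_simps)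
  moreover have "range (Y (F s)) = range (G (F s))" if "s \<in> ball 0 r" for s
  proof -
    have "F s \<in> O'" using F(3) that by blast
    then have "G (F s) a = Y (F s) (P (G (F s) a))" for a
      by (simp add: Y_def NG)
    then show ?thesis by (auto simp: Y_def)
  qed
  moreover have "P (Y (F s) k) = k" if "s \<in> ball 0 r" for s k
    using PY F(3) that by blast
  ultimately show ?thesis
    using that[of P r F "\<lambda>s. Y (F s)"] lP F O'(2) by blast
qed

lemma smooth_fun_pullback:
  assumes "smooth_manifold T A" "smooth_manifold S B" "smooth_map B A F" "smooth_fun A f"
  shows "smooth_fun B (f \<circ> F)"
proof -
  interpret A: smooth_mfd T A using assms(1) by unfold_locales
  interpret B: smooth_mfd S B using assms(2) by unfold_locales
  show ?thesis
  proof (rule B.smooth_funI)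
    fix q assume q: "q \<in> carrier B"
    then obtain V y where Vy: "(V, y) \<in> B" "q \<in> V" by (rule B.carrierE)
    have "F q \<in> carrier A" using assms(3) q by (auto simp: smooth_map_def)
    then obtain U x where Ux: "(U, x) \<in> A" "F q \<in> U" by (rule A.carrierE)
    let ?Z = "y ` (V \<inter> F -` U)"
    have Z: "open ?Z" and sm: "smooth_on ?Z (x \<circ> F \<circ> inv_into V y)"
      using assms(3) Vy(1) Ux(1) by (auto simp: smooth_map_def)
    have FU: "F (inv_into V y z) \<in> U" if "z \<in> ?Z" for z
      using that B.chart_inv[OF Vy(1)] by auto
    have "smooth_on ?Z (\<lambda>z. f (inv_into U x ((x \<circ> F \<circ> inv_into V y) z)))"
      by (rule smooth_on_compose[OF A.smooth_fun_chart[OF Ux(1) assms(4)] sm Z]) (use FU in auto)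
    then have "smooth_on ?Z (\<lambda>z. (f \<circ> F) (inv_into V y z))"
      by (rule smooth_on_cong[OF _ Z]) (use FU A.chart_inv[OF Ux(1)] in auto)
    then show "\<exists>U x Z. (U, x) \<in> B \<and> q \<in> U \<and> open Z \<and> x q \<in> Z \<and> Z \<subseteq> x ` U \<and>
        smooth_on Z (\<lambda>z. (f \<circ> F) (inv_into U x z))"
      using Vy Ux(2) Z by blast
  qed
qed

context smooth_mfd
begin

lemma inv_chart_continuous_map:
  assumes Ux: "(U, x) \<in> A"
  shows "continuous_map (top_of_set (x ` U)) (subtopology T U) (inv_into U x)"
proof -
  have top: "topspace (subtopology T U) = U"
    using openin_subset[OF chart_open[OF Ux]] by auto
  obtain g where g: "homeomorphic_maps (subtopology T U) (top_of_set (x ` U)) x g"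
    using chart_homeo[OF Ux] homeomorphic_map_maps by blast
  then have "continuous_map (top_of_set (x ` U)) (subtopology T U) g"
    by (simp add: homeomorphic_maps_def)
  then show ?thesis
  proof (rule continuous_map_eq)
    fix z assume "z \<in> topspace (top_of_set (x ` U))"
    then obtain q where "q \<in> U" "z = x q" by auto
    then show "g z = inv_into U x z"
      using g top chart_inv[OF Ux] by (simp add: homeomorphic_maps_def)
  qed
qed

text \<open>The integral manifold is the image of the solution F, pulled back to M, with an atlas of
  a single chart. A linear projection of the ambient chart inverts the parametrisation, so the
  subspace topology is the right one, and the same projection shows that the inclusion is an
  immersion.\<close>

lemma Frobenius_3:
  fixes X :: "3 \<Rightarrow> 'p vfield"
  defines "D \<equiv> \<lambda>p. range (\<lambda>a::real ^ 3. \<lambda>f. \<Sum>i\<in>UNIV. a $ i * X i p f)"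
  assumes X: "\<And>i. vector_field A (X i)"
    and independent: "\<And>p a. p \<in> carrier A \<Longrightarrow> (\<lambda>f. \<Sum>i\<in>UNIV. a $ i * X i p f) = (\<lambda>f. 0) \<Longrightarrow> a = 0"
    and involutive: "\<And>p i j. p \<in> carrier A \<Longrightarrow> lie_bracket (X i) (X j) p \<in> D p"
  shows "integrable_distribution TYPE(real ^ 3) A D"
  unfolding integrable_distribution_def
proof
  fix p0 assume "p0 \<in> carrier A"
  then obtain U x where Ux: "(U, x) \<in> A" and p0: "p0 \<in> U" by (rule carrierE)
  note Usub = chart_subset[OF Ux] and xU = chart_image_open[OF Ux]
  have "\<exists>c. smooth_on (x ` U) c \<and> (\<forall>p\<in>U. X i p = chart_vec U x p (c (x p)))" for i
    using vector_field_coords[OF X Ux] by metis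
  then obtain c where c: "\<And>i. smooth_on (x ` U) (c i)"
    "\<And>i p. p \<in> U \<Longrightarrow> X i p = chart_vec U x p (c i (x p))" by metis
  define G where "G z a = (\<Sum>i\<in>UNIV. (a $ i) *\<^sub>R c i z)" for z and a :: "real ^ 3"
  have G_abs: "(\<lambda>a. \<Sum>i\<in>UNIV. (a $ i) *\<^sub>R c i z) = G z" for z
    by (simp add: G_def fun_eq_iff)
  have chG: "chart_vec U x p (G (x p) a) = (\<lambda>f. \<Sum>i\<in>UNIV. a $ i * X i p f)" if "p \<in> U" for p a
    unfolding G_def chart_vec_sum[OF Ux that] using c(2)[OF that] by simp
  have "chart_vec U x p0 0 = (\<lambda>f. 0)"
    using chart_vec_sum[OF Ux p0, of "\<lambda>_. 0" "\<lambda>_. 0" "{}"] by simp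
  then have indep: "a = 0" if "G (x p0) a = 0" for a
    using chG[OF p0, of a] independent[of p0 a] that p0 Usub by auto
  have inv: "\<exists>a. frechet_derivative (c i) (at z) (c j z) - frechet_derivative (c j) (at z) (c i z) = G z a"
    if z: "z \<in> x ` U" for z i j
  proof -
    obtain p where p: "p \<in> U" "z = x p" using z by blast
    \<comment> \<open>The order of the indices is reversed because the bracket of fields with
      components c, d has components D d(c) - D c(d).\<close>
    obtain a where "lie_bracket (X j) (X i) p = chart_vec U x p (G (x p) a)"
      using involutive[of p j i] p(1) Usub chG[OF p(1)] by (auto simp: D_def)
    then show ?thesis
      using lie_bracket_coords[OF X X Ux p(1) c(1) c(2) c(1) c(2), of j i] chart_vec_inject[OF Ux p(1)] p(2)
      by metis
  qed
  obtain P :: "'e \<Rightarrow> real ^ 3" and F r Y where lP: "linear P" and r: "r > 0" and F0: "F 0 = x p0"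
    and FU: "F ` ball 0 r \<subseteq> x ` U" and F: "smooth_on (ball 0 r) F"
    and PF: "\<And>s. s \<in> ball 0 r \<Longrightarrow> P (F s) = P (x p0) + s"
    and DF: "\<And>s. s \<in> ball 0 r \<Longrightarrow> (F has_derivative Y s) (at s)"
    and ranY: "\<And>s. s \<in> ball 0 r \<Longrightarrow> range (Y s) = range (G (F s))"
    and PY: "\<And>s k. s \<in> ball 0 r \<Longrightarrow> P (Y s k) = k"
  proof (rule exists_integral_graph_3[where c = c, OF xU imageI[OF p0] c(1)], goal_cases)
    case (1 a)
    then show ?case using indep by (simp add: G_def)
  next
    case (2 z i j)
    then show ?case using inv unfolding G_def by blast
  next
    case (3 P F r Y)
    have ran: "range (Y s) = range (G (F s))" if "s \<in> ball 0 r" for s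
      using 3(9)[OF that] unfolding G_abs .
    show ?case by (rule 3(1)[OF 3(2-8) ran 3(10)])
  qed
  define \<psi> where "\<psi> = inv_into U x"
  define S where "S = (\<lambda>s. \<psi> (F s)) ` ball 0 r"
  \<comment> \<open>The inverse of the parametrisation: P (F s) = P (x p0) + s. Being a restriction
    of a map defined on U, it is continuous for the subspace topology.\<close>
  define e where "e q = P (x q) - P (x p0)" for q
  define B where "B = {(S, e)}"
  define TS where "TS = subtopology T S"
  have \<psi>: "\<psi> (F s) \<in> U" "x (\<psi> (F s)) = F s" if "s \<in> ball 0 r" for s
  proof -
    have "F s \<in> x ` U" using FU that by blast
    then show "\<psi> (F s) \<in> U" "x (\<psi> (F s)) = F s" using inv_chart[OF Ux] by (simp_all add: \<psi>_def)
  qed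
  have e: "e (\<psi> (F s)) = s" if "s \<in> ball 0 r" for s
    using \<psi>(2)[OF that] PF[OF that] by (simp add: e_def)
  have SU: "S \<subseteq> U" using \<psi>(1) by (auto simp: S_def)
  have eS: "e ` S = ball 0 r" using e by (force simp: S_def)
  have inj: "inj_on e S" by (rule inj_onI) (auto simp: S_def e)
  have inv_e: "inv_into S e s = \<psi> (F s)" if "s \<in> ball 0 r" for s
    using inv_into_f_f[OF inj, of "\<psi> (F s)"] that e by (auto simp: S_def)
  have cB: "carrier B = S" by (simp add: B_def carrier_def)
  have ST: "S \<subseteq> topspace T" using SU Usub topspace by simp
  have Pc: "continuous_on UNIV (\<lambda>z. P z - P (x p0))"
    using linear_continuous_on[of P UNIV] lP by (auto simp: linear_conv_bounded_linear intro!: continuous_intros)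
  have x_cont: "continuous_map (subtopology T U) euclidean x"
    using homeomorphic_imp_continuous_map[OF chart_homeo[OF Ux]] continuous_map_in_subtopology by blast
  have homeo: "homeomorphic_map TS (top_of_set (ball 0 r)) e"
    unfolding homeomorphic_map_maps homeomorphic_maps_def
  proof (intro exI conjI ballI)
    have "continuous_map TS euclidean ((\<lambda>z. P z - P (x p0)) \<circ> x)"
    proof (rule continuous_map_compose)
      show "continuous_map TS euclidean x"
        unfolding TS_def using continuous_map_from_subtopology_mono[OF x_cont SU] .
      show "continuous_map euclidean euclidean (\<lambda>z. P z - P (x p0))" using Pc by simp
    qed
    then have "continuous_map TS euclidean e" by (simp add: o_def e_def[abs_def])
    then show "continuous_map TS (top_of_set (ball 0 r)) e"
      using eS by (auto simp: TS_def continuous_map_in_subtopology)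
    have "continuous_map (top_of_set (ball 0 r)) (top_of_set (x ` U)) F"
      using smooth_on_continuous[OF F] FU by (auto simp: continuous_map_in_subtopology)
    from continuous_map_compose[OF this inv_chart_continuous_map[OF Ux]]
    have "continuous_map (top_of_set (ball 0 r)) T (\<lambda>s. \<psi> (F s))"
      by (simp add: o_def \<psi>_def continuous_map_in_subtopology)
    then show "continuous_map (top_of_set (ball 0 r)) TS (\<lambda>s. \<psi> (F s))"
      by (auto simp: TS_def continuous_map_in_subtopology S_def)
  qed (use ST e in \<open>auto simp: TS_def S_def\<close>)
  have smB: "smooth_manifold TS B"
    unfolding smooth_manifold_def
  proof (intro conjI)
    show "Hausdorff_space TS" unfolding TS_def by (rule Hausdorff_space_subtopology[OF Hausdorff])
    show "second_countable TS"
      unfolding TS_def using smooth_manifold by (auto simp: smooth_manifold_def intro: second_countable_subtopology)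
    show "topspace TS = carrier B" using ST cB by (auto simp: TS_def)
    have [simp]: "subtopology TS S = TS" by (simp add: TS_def subtopology_subtopology)
    have "openin TS S" using ST by (auto simp: TS_def openin_subtopology_refl)
    then show "\<forall>(U, x)\<in>B. openin TS U \<and> open (x ` U) \<and> homeomorphic_map (subtopology TS U) (top_of_set (x ` U)) x"
      using homeo eS by (simp add: B_def)
    have "smooth_on (ball 0 r) (e \<circ> inv_into S e)"
      by (rule smooth_on_cong[OF smooth_on_ident open_ball]) (simp add: inv_e e)
    then show "\<forall>(U, x)\<in>B. \<forall>(V, y)\<in>B. smooth_on (x ` (U \<inter> V)) (y \<circ> inv_into U x)"
      using eS by (simp add: B_def)
  qed
  interpret B: smooth_mfd TS B using smB by unfold_locales
  have Se: "(S, e) \<in> B" by (simp add: B_def)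
  have incl_chart: "open (e ` (S \<inter> id -` V))" "smooth_on (e ` (S \<inter> id -` V)) (y \<circ> id \<circ> inv_into S e)"
    if Vy: "(V, y) \<in> A" for V y
  proof -
    let ?Z = "e ` (S \<inter> id -` V)"
    have UV: "open (x ` (U \<inter> V))"
      by (rule chart_image_openin[OF Ux]) (use chart_open[OF Ux] chart_open[OF Vy] in auto)
    have "?Z = ball 0 r \<inter> F -` (x ` (U \<inter> V))"
    proof (intro equalityI subsetI)
      fix s assume "s \<in> ?Z"
      then obtain t where t: "t \<in> ball 0 r" "\<psi> (F t) \<in> V" "s = t" using e by (auto simp: S_def)
      then show "s \<in> ball 0 r \<inter> F -` (x ` (U \<inter> V))"
        using \<psi>[OF t(1)] by (auto intro: rev_image_eqI)
    next
      fix s assume s: "s \<in> ball 0 r \<inter> F -` (x ` (U \<inter> V))"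
      then obtain q where q: "q \<in> U" "q \<in> V" "F s = x q" by auto
      then have "\<psi> (F s) \<in> V" using chart_inv[OF Ux] by (simp add: \<psi>_def)
      then show "s \<in> ?Z" using s e[of s] by (auto simp: S_def intro!: rev_image_eqI[of "\<psi> (F s)"])
    qed
    moreover have oZ: "open (ball 0 r \<inter> F -` (x ` (U \<inter> V)))"
      by (rule continuous_open_preimage[OF smooth_on_continuous[OF F] open_ball UV])
    moreover have "smooth_on (ball 0 r \<inter> F -` (x ` (U \<inter> V))) (y \<circ> id \<circ> inv_into S e)"
    proof (rule smooth_on_cong[OF _ oZ])
      show "smooth_on (ball 0 r \<inter> F -` (x ` (U \<inter> V))) (\<lambda>s. y (inv_into U x (F s)))"
        by (rule smooth_on_compose[OF smooth_transition[OF Ux Vy] smooth_on_subset[OF F] oZ]) auto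
    qed (auto simp: inv_e \<psi>_def)
    ultimately show "open (e ` (S \<inter> id -` V))" "smooth_on (e ` (S \<inter> id -` V)) (y \<circ> id \<circ> inv_into S e)"
      by simp_all
  qed
  have incl: "smooth_map B A id"
    unfolding smooth_map_def
  proof
    show "id ` carrier B \<subseteq> carrier A" using cB SU Usub by auto
    show "\<forall>(U, x)\<in>B. \<forall>(V, y)\<in>A. open (x ` (U \<inter> id -` V)) \<and>
        smooth_on (x ` (U \<inter> id -` V)) (y \<circ> id \<circ> inv_into U x)"
      using incl_chart by (auto simp: B_def)
  qed
  \<comment> \<open>The inclusion reads F in the charts e and x, so it maps components k to Y(e q)
    k. Applying P recovers k, and the range of Y is the distribution.\<close>
  have diff: "differential A id (B.chart_vec S e q k) = chart_vec U x q (Y (e q) k)" if q: "q \<in> S" for q k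
  proof -
    obtain s where s: "s \<in> ball 0 r" "q = \<psi> (F s)" using q by (auto simp: S_def)
    have qU: "q \<in> U" using q SU by blast
    have es: "e q = s" and xs: "x q = F s" using s e \<psi> by auto
    have "B.chart_vec S e q k (f \<circ> id) = chart_vec U x q (Y (e q) k) f" if f: "smooth_fun A f" for f
    proof -
      have f': "smooth_fun B (f \<circ> id)"
        by (rule smooth_fun_pullback[OF smooth_manifold smB incl f])
      have "((\<lambda>s. f (inv_into U x (F s))) has_derivative
          (\<lambda>k. frechet_derivative (\<lambda>z. f (inv_into U x z)) (at (x q)) (Y s k))) (at s)"
        using has_derivative_compose[OF DF[OF s(1)], of "\<lambda>z. f (inv_into U x z)"]
          smooth_fun_has_derivative[OF Ux qU f] xs by simp
      then have "((\<lambda>s. (f \<circ> id) (inv_into S e s)) has_derivative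
          (\<lambda>k. frechet_derivative (\<lambda>z. f (inv_into U x z)) (at (x q)) (Y s k))) (at (e q))"
        unfolding es by (rule has_derivative_transform_within_open[OF _ open_ball s(1)])
          (simp add: inv_e \<psi>_def)
      from B.chart_vec_eq[OF Se q f' this] show ?thesis
        using f by (simp add: chart_vec_def es)
    qed
    then show ?thesis by (auto simp: differential_def chart_vec_def fun_eq_iff)
  qed
  have tangB: "tangent_space B q = range (B.chart_vec S e q)" if q: "q \<in> S" for q
    using B.tangent_chart_vec[OF Se q] B.chart_vec_tangent[OF Se q] by blast
  have eq_ball: "e q \<in> ball 0 r" "x q = F (e q)" if "q \<in> S" for q
    using that e \<psi> by (auto simp: S_def)
  have "integral_manifold A D TS B"
    unfolding integral_manifold_def immersed_submanifold_def cB
  proof (intro conjI ballI smB incl)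
    fix q assume q: "q \<in> S"
    have qU: "q \<in> U" using q SU by blast
    show "inj_on (differential A id) (tangent_space B q)"
    proof (rule inj_onI)
      fix u v assume uv: "u \<in> tangent_space B q" "v \<in> tangent_space B q"
        and eq: "differential A id u = differential A id v"
      obtain k l where kl: "u = B.chart_vec S e q k" "v = B.chart_vec S e q l"
        using uv tangB[OF q] by auto
      have "Y (e q) k = Y (e q) l"
        using eq diff[OF q] chart_vec_inject[OF Ux qU] unfolding kl by metis
      then show "u = v" using PY[OF eq_ball(1)[OF q]] kl by metis
    qed
    have "submanifold_tangent_space A B q = chart_vec U x q ` range (Y (e q))"
      unfolding submanifold_tangent_space_def tangB[OF q] using diff[OF q] by (auto simp: image_image)
    also have "\<dots> = chart_vec U x q ` range (G (x q))"
      using ranY[OF eq_ball(1)[OF q]] eq_ball(2)[OF q] by simp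
    also have "\<dots> = D q"
      unfolding D_def by (simp add: image_image chG[OF qU])
    finally show "submanifold_tangent_space A B q = D q" .
  qed
  moreover have "p0 \<in> carrier B"
    using r F0 chart_inv[OF Ux p0] unfolding cB S_def \<psi>_def by (auto intro!: image_eqI[of _ _ 0])
  ultimately show "\<exists>S. \<exists>B::('p, real ^ 3) atlas. integral_manifold A D S B \<and> p0 \<in> carrier B" by blast
qed

end

section \<open>Quasi-Sasakian structures\<close>

context smooth_mfd
begin

lemma tangent_zero: "(\<lambda>f. 0) \<in> tangent_space A p"
  by (simp add: tangent_space_def)

lemma tangent_comb:
  assumes "p \<in> carrier A" "u \<in> tangent_space A p" "v \<in> tangent_space A p"
  shows "(\<lambda>f. a * u f + b * v f) \<in> tangent_space A p"
  using assms(1) by (rule carrierE) (rule tangent_combination[OF _ _ assms(2,3)])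

lemma tangent_weighted_sum:
  assumes "p \<in> carrier A" "\<And>i. i \<in> I \<Longrightarrow> u i \<in> tangent_space A p"
  shows "(\<lambda>f. \<Sum>i\<in>I. k i * u i f) \<in> tangent_space A p"
  using assms(2)
proof (induction I rule: infinite_finite_induct)
  case (insert i I)
  have "(\<lambda>f. k i * u i f + 1 * (\<Sum>i\<in>I. k i * u i f)) \<in> tangent_space A p"
    by (rule tangent_comb[OF assms(1)]) (use insert in auto)
  then show ?case using insert by simp
qed (simp_all add: tangent_zero)

lemma vector_field_weighted_sum:
  assumes "\<And>i. i \<in> I \<Longrightarrow> vector_field A (X i)" "\<And>i. i \<in> I \<Longrightarrow> smooth_fun A (h i)"
  shows "vector_field A (\<lambda>p f. \<Sum>i\<in>I. h i p * X i p f)"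
  unfolding vector_field_def
proof (intro conjI ballI allI impI)
  show "(\<lambda>f. \<Sum>i\<in>I. h i p * X i p f) \<in> tangent_space A p" if "p \<in> carrier A" for p
    by (rule tangent_weighted_sum[OF that]) (use assms vector_field_tangent that in blast)
  show "smooth_fun A (\<lambda>p. \<Sum>i\<in>I. h i p * X i p f)" for f
    by (intro smooth_fun_sum smooth_fun_mult assms vector_field_smooth)
qed

lemma vector_field_comb:
  assumes "vector_field A X" "vector_field A Y" "smooth_fun A h" "smooth_fun A k"
  shows "vector_field A (\<lambda>p f. h p * X p f + k p * Y p f)"
  unfolding vector_field_def
proof (intro conjI ballI allI impI)
  show "(\<lambda>f. h p * X p f + k p * Y p f) \<in> tangent_space A p" if "p \<in> carrier A" for p
    by (intro tangent_comb that vector_field_tangent assms)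
  show "smooth_fun A (\<lambda>p. h p * X p f + k p * Y p f)" for f
    by (intro smooth_fun_add smooth_fun_mult assms vector_field_smooth)
qed

lemma lie_bracket_cong:
  assumes "vector_field A X" "vector_field A Y" "p \<in> carrier A"
    "\<And>q. q \<in> carrier A \<Longrightarrow> X q = X' q" "\<And>q. q \<in> carrier A \<Longrightarrow> Y q = Y' q"
  shows "lie_bracket X Y p = lie_bracket X' Y' p"
proof
  fix f
  have "X p (\<lambda>q. Y q f) = X p (\<lambda>q. Y' q f)"
    using assms(5) by (intro tangent_cong[OF vector_field_tangent[OF assms(1,3)] vector_field_smooth[OF assms(2)]]) simp
  moreover have "Y p (\<lambda>q. X q f) = Y p (\<lambda>q. X' q f)"
    using assms(4) by (intro tangent_cong[OF vector_field_tangent[OF assms(2,3)] vector_field_smooth[OF assms(1)]]) simp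
  ultimately show "lie_bracket X Y p f = lie_bracket X' Y' p f"
    using assms(3-5) by (simp add: lie_bracket_def)
qed

lemma lie_bracket_swap: "lie_bracket Y X p = (\<lambda>f. - lie_bracket X Y p f)"
  by (simp add: lie_bracket_def)

lemma lie_bracket_zero_right:
  assumes "vector_field A X" "p \<in> carrier A"
  shows "lie_bracket X (\<lambda>p f. 0) p = (\<lambda>f. 0)"
  using tangent_const[OF vector_field_tangent[OF assms]] by (simp add: lie_bracket_def)

end

section \<open>Pointwise algebra of the metric\<close>

locale riemannian_mfd = smooth_mfd T A
  for T :: "'p topology" and A :: "('p, 'e::euclidean_space) atlas" +
  fixes g :: "'p \<Rightarrow> 'p tangent \<Rightarrow> 'p tangent \<Rightarrow> real"
  assumes metric: "riemannian_metric A g"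
begin

lemma metric_smooth: "vector_field A X \<Longrightarrow> vector_field A Y \<Longrightarrow> smooth_fun A (\<lambda>p. g p (X p) (Y p))"
  using metric by (auto simp: riemannian_metric_def)

context
  fixes p assumes p: "p \<in> carrier A"
begin

lemma metric_sym: "u \<in> tangent_space A p \<Longrightarrow> v \<in> tangent_space A p \<Longrightarrow> g p u v = g p v u"
  using metric p by (auto simp: riemannian_metric_def)

lemma metric_comb_left:
  "u \<in> tangent_space A p \<Longrightarrow> v \<in> tangent_space A p \<Longrightarrow> w \<in> tangent_space A p \<Longrightarrow>
    g p (\<lambda>f. a * u f + b * v f) w = a * g p u w + b * g p v w"
  using metric p by (auto simp: riemannian_metric_def)

lemma metric_comb_right:
  "u \<in> tangent_space A p \<Longrightarrow> v \<in> tangent_space A p \<Longrightarrow> w \<in> tangent_space A p \<Longrightarrow>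
    g p w (\<lambda>f. a * u f + b * v f) = a * g p w u + b * g p w v"
  using metric_comb_left[of u v w a b] metric_sym[of w "\<lambda>f. a * u f + b * v f"] metric_sym[of u w]
    metric_sym[of v w] tangent_comb[OF p, of u v a b] by simp

lemma metric_zero: "w \<in> tangent_space A p \<Longrightarrow> g p (\<lambda>f. 0) w = 0" "w \<in> tangent_space A p \<Longrightarrow> g p w (\<lambda>f. 0) = 0"
  using metric_comb_left[of w w w 0 0] metric_comb_right[of w w w 0 0] by simp_all

lemma metric_minus: "u \<in> tangent_space A p \<Longrightarrow> w \<in> tangent_space A p \<Longrightarrow> g p (\<lambda>f. - u f) w = - g p u w"
  "u \<in> tangent_space A p \<Longrightarrow> w \<in> tangent_space A p \<Longrightarrow> g p w (\<lambda>f. - u f) = - g p w u"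
  using metric_comb_left[of u u w "-1" 0] metric_comb_right[of u u w "-1" 0] by simp_all

lemma metric_diff: "u \<in> tangent_space A p \<Longrightarrow> v \<in> tangent_space A p \<Longrightarrow> w \<in> tangent_space A p \<Longrightarrow>
    g p (\<lambda>f. u f - v f) w = g p u w - g p v w"
  using metric_comb_left[of u v w 1 "-1"] by simp

lemma metric_sum:
  assumes "\<And>i. i \<in> I \<Longrightarrow> u i \<in> tangent_space A p" "w \<in> tangent_space A p"
  shows "g p (\<lambda>f. \<Sum>i\<in>I. k i * u i f) w = (\<Sum>i\<in>I. k i * g p (u i) w)"
  using assms(1)
proof (induction I rule: infinite_finite_induct)
  case (insert i I)
  have "g p (\<lambda>f. k i * u i f + 1 * (\<Sum>i\<in>I. k i * u i f)) w
      = k i * g p (u i) w + 1 * g p (\<lambda>f. \<Sum>i\<in>I. k i * u i f) w"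
    by (rule metric_comb_left) (use insert assms(2) tangent_weighted_sum[OF p, of I u k] in auto)
  then show ?case using insert by simp
qed (simp_all add: metric_zero assms(2))

lemma metric_eq_zero:
  assumes "u \<in> tangent_space A p" "g p u u = 0"
  shows "u = (\<lambda>f. 0)"
proof (rule ccontr)
  assume "u \<noteq> (\<lambda>f. 0)"
  then have "g p u u > 0"
    using metric p assms(1) unfolding riemannian_metric_def by blast
  then show False using assms(2) by simp
qed

end

end

locale quasi_sasakian = riemannian_mfd T A g
  for T :: "'p topology" and A :: "('p, 'e::euclidean_space) atlas" and g +
  fixes \<phi> :: "'p \<Rightarrow> 'p tangent \<Rightarrow> 'p tangent" and \<xi> :: "'p vfield" and \<eta> :: "'p \<Rightarrow> 'p tangent \<Rightarrow> real"
  assumes contact: "almost_contact_structure A \<phi> \<xi> \<eta>"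
    and compatible: "compatible_metric A \<phi> \<eta> g"
    and normal: "normal_structure A \<phi> \<xi> \<eta>"
    and closed: "closed_2_form A (fundamental_form \<phi> g)"
begin

lemma reeb_field: "vector_field A \<xi>"
  using contact by (auto simp: almost_contact_structure_def)

lemma phi_field: "vector_field A X \<Longrightarrow> vector_field A (\<lambda>p. \<phi> p (X p))"
  using contact by (auto simp: almost_contact_structure_def tensor_field_1_1_def)

lemma eta_smooth: "vector_field A X \<Longrightarrow> smooth_fun A (\<lambda>p. \<eta> p (X p))"
  using contact by (auto simp: almost_contact_structure_def one_form_def)

context
  fixes p assumes p: "p \<in> carrier A"
begin

lemma reeb_tangent: "\<xi> p \<in> tangent_space A p"
  using vector_field_tangent[OF reeb_field p] .

lemma phi_tangent: "v \<in> tangent_space A p \<Longrightarrow> \<phi> p v \<in> tangent_space A p"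
  using contact p by (auto simp: almost_contact_structure_def tensor_field_1_1_def)

lemma phi_comb: "u \<in> tangent_space A p \<Longrightarrow> v \<in> tangent_space A p \<Longrightarrow>
    \<phi> p (\<lambda>f. a * u f + b * v f) = (\<lambda>f. a * \<phi> p u f + b * \<phi> p v f)"
  using contact p by (auto simp: almost_contact_structure_def tensor_field_1_1_def)

lemma eta_comb: "u \<in> tangent_space A p \<Longrightarrow> v \<in> tangent_space A p \<Longrightarrow>
    \<eta> p (\<lambda>f. a * u f + b * v f) = a * \<eta> p u + b * \<eta> p v"
  using contact p by (auto simp: almost_contact_structure_def one_form_def)

lemma phi_phi: "v \<in> tangent_space A p \<Longrightarrow> \<phi> p (\<phi> p v) = (\<lambda>f. (-1) * v f + \<eta> p v * \<xi> p f)"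
  using contact p by (auto simp: almost_contact_structure_def)

lemma eta_reeb: "\<eta> p (\<xi> p) = 1"
  using contact p by (auto simp: almost_contact_structure_def)

lemma phi_zero: "\<phi> p (\<lambda>f. 0) = (\<lambda>f. 0)"
  using phi_comb[OF reeb_tangent reeb_tangent, of 0 0] by simp

lemma eta_zero: "\<eta> p (\<lambda>f. 0) = 0"
  using eta_comb[OF reeb_tangent reeb_tangent, of 0 0] by simp

lemma eta_minus: "v \<in> tangent_space A p \<Longrightarrow> \<eta> p (\<lambda>f. - v f) = - \<eta> p v"
  using eta_comb[of v v "-1" 0] by simp

lemma reeb_multiple_zero: "(\<lambda>f. k * \<xi> p f) = (\<lambda>f. 0) \<Longrightarrow> k = 0"
  using eta_comb[OF reeb_tangent reeb_tangent, of k 0] eta_reeb eta_zero by simp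

text \<open>The formula for \<phi>^2 gives \<phi>^2 \<xi> = 0. Applied to \<phi> \<xi> it then gives
  \<phi> \<xi> = k \<xi> with k = \<eta>(\<phi> \<xi>), so 0 = \<phi>^2 \<xi> = k^2 \<xi> and k =
  0.\<close>

lemma phi_reeb: "\<phi> p (\<xi> p) = (\<lambda>f. 0)"
proof -
  define k where "k = \<eta> p (\<phi> p (\<xi> p))"
  have 0: "\<phi> p (\<phi> p (\<xi> p)) = (\<lambda>f. 0)"
    using phi_phi[OF reeb_tangent] eta_reeb by simp
  then have "(\<lambda>f. (-1) * \<phi> p (\<xi> p) f + k * \<xi> p f) = (\<lambda>f. 0)"
    using phi_phi[OF phi_tangent[OF reeb_tangent]] phi_zero by (simp only: k_def)
  then have k: "\<phi> p (\<xi> p) = (\<lambda>f. k * \<xi> p f)"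
    by (auto simp: fun_eq_iff)
  have "\<phi> p (\<lambda>f. k * \<xi> p f) = (\<lambda>f. k * \<phi> p (\<xi> p) f)"
    using phi_comb[OF reeb_tangent reeb_tangent, of k 0] by simp
  then have "(\<lambda>f. (k * k) * \<xi> p f) = (\<lambda>f. 0)"
    using 0 unfolding k by (simp add: mult.assoc)
  from reeb_multiple_zero[OF this] show ?thesis using k by simp
qed

text \<open>Compute \<phi>^3 v in two ways: as \<phi> applied to \<phi>^2 v, and as \<phi>^2 applied
  to \<phi> v. The difference is \<eta>(\<phi> v) \<xi>.\<close>

lemma eta_phi: "v \<in> tangent_space A p \<Longrightarrow> \<eta> p (\<phi> p v) = 0"
proof (rule reeb_multiple_zero)
  assume v: "v \<in> tangent_space A p"
  have "\<phi> p (\<phi> p (\<phi> p v)) = (\<lambda>f. (-1) * \<phi> p v f)"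
    using phi_comb[OF v reeb_tangent, of "-1" "\<eta> p v"] phi_phi[OF v] phi_reeb by simp
  then show "(\<lambda>f. \<eta> p (\<phi> p v) * \<xi> p f) = (\<lambda>f. 0)"
    using phi_phi[OF phi_tangent[OF v]] by (auto simp: fun_eq_iff)
qed

lemma metric_phi_phi: "u \<in> tangent_space A p \<Longrightarrow> v \<in> tangent_space A p \<Longrightarrow>
    g p (\<phi> p u) (\<phi> p v) = g p u v - \<eta> p u * \<eta> p v"
  using compatible p by (auto simp: compatible_metric_def)

lemma metric_reeb: "v \<in> tangent_space A p \<Longrightarrow> g p v (\<xi> p) = \<eta> p v"
  using metric_phi_phi[OF _ reeb_tangent, of v] eta_reeb phi_reeb metric_zero(2)[OF p phi_tangent, of v] by simp

lemma metric_reeb': "v \<in> tangent_space A p \<Longrightarrow> g p (\<xi> p) v = \<eta> p v"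
  using metric_reeb metric_sym[OF p reeb_tangent] by simp

text \<open>Compatibility for the pair \<phi> u, v, combined with the formula for \<phi>^2 u; all
  terms with \<eta> drop out because \<eta> vanishes on the image of \<phi>.\<close>

lemma metric_phi:
  assumes u: "u \<in> tangent_space A p" and v: "v \<in> tangent_space A p"
  shows "g p (\<phi> p u) v = - g p u (\<phi> p v)"
proof -
  have "g p (\<phi> p (\<phi> p u)) (\<phi> p v) = g p (\<phi> p u) v"
    using metric_phi_phi[OF phi_tangent[OF u] v] eta_phi[OF u] by simp
  moreover have "g p (\<phi> p (\<phi> p u)) (\<phi> p v) = - g p u (\<phi> p v)"
    using metric_comb_left[OF p u reeb_tangent phi_tangent[OF v], of "-1" "\<eta> p u"]
      phi_phi[OF u] metric_reeb'[OF phi_tangent[OF v]] eta_phi[OF v] by simp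
  ultimately show ?thesis by simp
qed

lemma phi_eq_zero:
  assumes "v \<in> tangent_space A p" "\<phi> p v = (\<lambda>f. 0)"
  shows "v = (\<lambda>f. \<eta> p v * \<xi> p f)"
  using phi_phi[OF assms(1)] assms(2) phi_zero by (auto simp: fun_eq_iff)

end

text \<open>The normality tensor at \<open>(\<xi>, X)\<close> is \<open>\<phi>(\<phi>[\<xi>, X] - [\<xi>, \<phi> X]) + 2 d\<eta>(\<xi>, X) \<xi>\<close>; its
  components in the image of \<open>\<phi>\<close> and along \<open>\<xi>\<close> vanish separately.\<close>

lemma
  assumes p: "p \<in> carrier A" and X: "vector_field A X"
  shows reeb_eta: "\<xi> p (\<lambda>q. \<eta> q (X q)) = \<eta> p (lie_bracket \<xi> X p)"
    and phi_lie_bracket_reeb: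
      "\<phi> p (\<lambda>f. 1 * \<phi> p (lie_bracket \<xi> X p) f + (-1) * lie_bracket \<xi> (\<lambda>q. \<phi> q (X q)) p f) = (\<lambda>f. 0)"
proof -
  define a where "a = lie_bracket \<xi> X p"
  define b where "b = lie_bracket \<xi> (\<lambda>q. \<phi> q (X q)) p"
  define e where "e = 2 * ext_deriv1 \<eta> \<xi> X p"
  have a: "a \<in> tangent_space A p" and b: "b \<in> tangent_space A p"
    unfolding a_def b_def using lie_bracket_tangent[OF reeb_field] X phi_field p by blast+
  have phireeb: "vector_field A (\<lambda>q. \<phi> q (\<xi> q))" by (rule phi_field[OF reeb_field])
  \<comment> \<open>The two brackets in the Nijenhuis tensor whose first argument is \<phi> \<xi>
    drop out, since \<phi> \<xi> = 0 on the whole carrier.\<close>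
  have zero: "lie_bracket (\<lambda>q. \<phi> q (\<xi> q)) Z p = (\<lambda>f. 0)" if Z: "vector_field A Z" for Z
  proof -
    have "lie_bracket Z (\<lambda>q. \<phi> q (\<xi> q)) p = lie_bracket Z (\<lambda>q f. 0) p"
    proof (rule lie_bracket_cong[OF Z phireeb p refl])
      show "\<phi> q (\<xi> q) = (\<lambda>f. 0)" if "q \<in> carrier A" for q
        using phi_reeb[OF that] .
    qed
    also have "\<dots> = (\<lambda>f. 0)" by (rule lie_bracket_zero_right[OF Z p])
    finally show ?thesis using lie_bracket_swap[of "\<lambda>q. \<phi> q (\<xi> q)" Z p] by simp
  qed
  have "nijenhuis \<phi> \<xi> X p f + e * \<xi> p f = 0" for f
    using normal X reeb_field p by (auto simp: normal_structure_def e_def)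
  then have "\<phi> p (\<phi> p a) f - \<phi> p b f + e * \<xi> p f = 0" for f
    by (simp add: nijenhuis_def zero[OF X] zero[OF phi_field[OF X]] phi_zero[OF p] a_def b_def)
  moreover have "\<phi> p (\<lambda>f. 1 * \<phi> p a f + (-1) * b f) = (\<lambda>f. \<phi> p (\<phi> p a) f - \<phi> p b f)"
    using phi_comb[OF p phi_tangent[OF p a] b, of 1 "-1"] by simp
  ultimately have *: "\<phi> p (\<lambda>f. 1 * \<phi> p a f + (-1) * b f) = (\<lambda>f. (- e) * \<xi> p f)"
    by (auto simp: fun_eq_iff) (smt (verit))
  have "\<eta> p (\<lambda>f. (- e) * \<xi> p f) = - e"
    using eta_comb[OF p reeb_tangent[OF p] reeb_tangent[OF p], of "- e" 0] eta_reeb[OF p] by simp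
  moreover have "\<eta> p (\<phi> p (\<lambda>f. 1 * \<phi> p a f + (-1) * b f)) = 0"
    by (intro eta_phi[OF p] tangent_comb[OF p] phi_tangent[OF p] a b)
  ultimately have e0: "e = 0" using * by simp
  \<comment> \<open>\<eta>(\<xi>) is the constant 1, so 2 d\<eta>(\<xi>, X) reduces to
    \<xi>(\<eta>(X)) - \<eta>([\<xi>, X]).\<close>
  have "X p (\<lambda>q. \<eta> q (\<xi> q)) = X p (\<lambda>q. 1)"
    by (rule tangent_cong[OF vector_field_tangent[OF X p] eta_smooth[OF reeb_field]])
      (use contact in \<open>auto simp: almost_contact_structure_def\<close>)
  then show "\<xi> p (\<lambda>q. \<eta> q (X q)) = \<eta> p (lie_bracket \<xi> X p)"
    using e0 tangent_const[OF vector_field_tangent[OF X p]] by (simp add: e_def ext_deriv1_def)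
  show "\<phi> p (\<lambda>f. 1 * \<phi> p (lie_bracket \<xi> X p) f + (-1) * lie_bracket \<xi> (\<lambda>q. \<phi> q (X q)) p f) = (\<lambda>f. 0)"
    using * e0 by (simp add: a_def b_def)
qed

text \<open>The difference of the two sides is annihilated by \<phi>, hence a multiple of \<xi>. It
  is also annihilated by \<eta>: apply \<open>reeb_eta\<close> to \<phi> X, whose \<eta> is zero. So
  \<phi> is invariant under \<xi>.\<close>

lemma lie_bracket_reeb_phi:
  assumes p: "p \<in> carrier A" and X: "vector_field A X"
  shows "lie_bracket \<xi> (\<lambda>q. \<phi> q (X q)) p = \<phi> p (lie_bracket \<xi> X p)"
proof -
  define a where "a = lie_bracket \<xi> X p"
  define b where "b = lie_bracket \<xi> (\<lambda>q. \<phi> q (X q)) p"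
  have a: "a \<in> tangent_space A p" and b: "b \<in> tangent_space A p"
    unfolding a_def b_def using lie_bracket_tangent[OF reeb_field] X phi_field p by blast+
  let ?c = "\<lambda>f. 1 * \<phi> p a f + (-1) * b f"
  have c: "?c \<in> tangent_space A p"
    by (intro tangent_comb[OF p] phi_tangent[OF p] a b)
  have "\<xi> p (\<lambda>q. \<eta> q (\<phi> q (X q))) = \<xi> p (\<lambda>q. 0)"
    by (rule tangent_cong[OF reeb_tangent[OF p] eta_smooth[OF phi_field[OF X]]])
      (use eta_phi vector_field_tangent[OF X] in auto)
  then have "\<eta> p b = 0"
    using reeb_eta[OF p phi_field[OF X]] tangent_const[OF reeb_tangent[OF p]] by (simp add: b_def)
  then have "\<eta> p ?c = 0"
    using eta_comb[OF p phi_tangent[OF p a] b, of 1 "-1"] eta_phi[OF p a] by simp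
  moreover have "\<phi> p ?c = (\<lambda>f. 0)"
    using phi_lie_bracket_reeb[OF p X] by (simp add: a_def b_def)
  ultimately have "?c = (\<lambda>f. 0)"
    using phi_eq_zero[OF p c] by simp
  then show ?thesis
    by (auto simp: fun_eq_iff a_def b_def)
qed

text \<open>Invariance of \<Phi> under \<xi> is the claim for second arguments of the form \<phi> Z.
  Taking Z = \<phi> Y and expanding \<phi>^2 gives the claim for Y up to terms \<eta>(X) \<eta>(Y),
  and these are invariant by \<open>reeb_eta\<close>.\<close>

lemma reeb_killing:
  assumes p: "p \<in> carrier A" and X: "vector_field A X" and Y: "vector_field A Y"
  shows "\<xi> p (\<lambda>q. g q (X q) (Y q)) = g p (lie_bracket \<xi> X p) (Y p) + g p (X p) (lie_bracket \<xi> Y p)"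
proof -
  have t: "X p \<in> tangent_space A p" "Y p \<in> tangent_space A p" "lie_bracket \<xi> X p \<in> tangent_space A p"
    "lie_bracket \<xi> Y p \<in> tangent_space A p"
    using vector_field_tangent X Y lie_bracket_tangent reeb_field p by blast+
  note x = reeb_tangent[OF p]
  \<comment> \<open>Cartan's formula in disguise: \<Phi> is closed and vanishes when one argument is
    \<xi>, so its Lie derivative along \<xi> is zero.\<close>
  have phi_case: "\<xi> p (\<lambda>q. g q (X q) (\<phi> q (Z q)))
      = g p (lie_bracket \<xi> X p) (\<phi> p (Z p)) + g p (X p) (\<phi> p (lie_bracket \<xi> Z p))"
    if Z: "vector_field A Z" for Z
  proof -
    let ?F = "fundamental_form \<phi> g"
    have z: "Z p \<in> tangent_space A p" "lie_bracket \<xi> Z p \<in> tangent_space A p"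
      "lie_bracket X Z p \<in> tangent_space A p"
      using vector_field_tangent X Z lie_bracket_tangent reeb_field p by blast+
    have "ext_deriv2 ?F \<xi> X Z p = 0"
      using closed reeb_field X Z p by (simp add: closed_2_form_def)
    moreover have "X p (\<lambda>q. ?F q (Z q) (\<xi> q)) = X p (\<lambda>q. 0)"
      by (rule tangent_cong[OF t(1) smooth_fun_cong[OF smooth_fun_const[of 0]], symmetric, THEN sym])
        (use phi_reeb metric_zero(2) vector_field_tangent[OF Z] in \<open>auto simp: fundamental_form_def\<close>)
    moreover have "Z p (\<lambda>q. ?F q (\<xi> q) (X q)) = Z p (\<lambda>q. 0)"
      by (rule tangent_cong[OF z(1) smooth_fun_cong[OF smooth_fun_const[of 0]], symmetric, THEN sym])
        (use metric_reeb' eta_phi phi_tangent vector_field_tangent[OF X] in \<open>auto simp: fundamental_form_def\<close>)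
    moreover have "?F p (lie_bracket X Z p) (\<xi> p) = 0"
      using phi_reeb[OF p] metric_zero(2)[OF p z(3)] by (simp add: fundamental_form_def)
    moreover have "?F p (lie_bracket Z \<xi> p) (X p) = g p (X p) (\<phi> p (lie_bracket \<xi> Z p))"
    proof -
      have "?F p (lie_bracket Z \<xi> p) (X p) = - g p (lie_bracket \<xi> Z p) (\<phi> p (X p))"
        using metric_minus(1)[OF p z(2) phi_tangent[OF p t(1)]] lie_bracket_swap[of Z \<xi> p]
        by (simp add: fundamental_form_def)
      also have "\<dots> = g p (\<phi> p (lie_bracket \<xi> Z p)) (X p)"
        using metric_phi[OF p z(2) t(1)] by simp
      also have "\<dots> = g p (X p) (\<phi> p (lie_bracket \<xi> Z p))"
        by (rule metric_sym[OF p phi_tangent[OF p z(2)] t(1)])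
      finally show ?thesis .
    qed
    ultimately show ?thesis
      using tangent_const[OF t(1)] tangent_const[OF z(1)]
      by (simp add: ext_deriv2_def fundamental_form_def)
  qed
  have pp: "g q (X q) (\<phi> q (\<phi> q (Y q))) = - g q (X q) (Y q) + \<eta> q (X q) * \<eta> q (Y q)" if q: "q \<in> carrier A" for q
    using metric_comb_right[OF q vector_field_tangent[OF Y q] reeb_tangent[OF q] vector_field_tangent[OF X q],
        of "-1" "\<eta> q (Y q)"] phi_phi[OF q vector_field_tangent[OF Y q]]
      metric_reeb[OF q vector_field_tangent[OF X q]] by simp
  have "\<xi> p (\<lambda>q. g q (X q) (\<phi> q (\<phi> q (Y q)))) = \<xi> p (\<lambda>q. - g q (X q) (Y q) + \<eta> q (X q) * \<eta> q (Y q))"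
    by (rule tangent_cong[OF x metric_smooth[OF X phi_field[OF phi_field[OF Y]]]]) (rule pp)
  also have "\<dots> = \<xi> p (\<lambda>q. (-1) * g q (X q) (Y q) + 1 * (\<eta> q (X q) * \<eta> q (Y q)))" by simp
  also have "\<dots> = - \<xi> p (\<lambda>q. g q (X q) (Y q))
      + (\<eta> p (X p) * \<eta> p (lie_bracket \<xi> Y p) + \<eta> p (Y p) * \<eta> p (lie_bracket \<xi> X p))"
    by (subst tangent_linear[OF x metric_smooth[OF X Y] smooth_fun_mult[OF eta_smooth[OF X] eta_smooth[OF Y]]])
      (simp add: tangent_mult[OF x eta_smooth[OF X] eta_smooth[OF Y]] reeb_eta[OF p] X Y)
  finally have 1: "\<xi> p (\<lambda>q. g q (X q) (\<phi> q (\<phi> q (Y q)))) = \<dots>" .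
  have 2: "g p (lie_bracket \<xi> X p) (\<phi> p (\<phi> p (Y p))) =
      - g p (lie_bracket \<xi> X p) (Y p) + \<eta> p (lie_bracket \<xi> X p) * \<eta> p (Y p)"
    using metric_comb_right[OF p t(2) x t(3), of "-1" "\<eta> p (Y p)"] phi_phi[OF p t(2)] metric_reeb[OF p t(3)] by simp
  have 3: "g p (X p) (\<phi> p (lie_bracket \<xi> (\<lambda>q. \<phi> q (Y q)) p)) =
      - g p (X p) (lie_bracket \<xi> Y p) + \<eta> p (X p) * \<eta> p (lie_bracket \<xi> Y p)"
    using metric_comb_right[OF p t(4) x t(1), of "-1" "\<eta> p (lie_bracket \<xi> Y p)"] phi_phi[OF p t(4)]
      metric_reeb[OF p t(1)] by (simp add: lie_bracket_reeb_phi[OF p Y] mult.commute)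
  show ?thesis
    using phi_case[OF phi_field[OF Y]] 1 2 3 by (simp add: mult.commute)
qed

end

section \<open>3-quasi-Sasakian manifolds\<close>

locale three_quasi_sasakian =
  fixes n :: nat
    and T :: "'p topology"
    and A :: "('p, 'e::euclidean_space) atlas"
    and \<phi> :: "nat \<Rightarrow> 'p \<Rightarrow> 'p tangent \<Rightarrow> 'p tangent"
    and \<xi> :: "nat \<Rightarrow> 'p vfield"
    and \<eta> :: "nat \<Rightarrow> 'p \<Rightarrow> 'p tangent \<Rightarrow> real"
    and g :: "'p \<Rightarrow> 'p tangent \<Rightarrow> 'p tangent \<Rightarrow> real"
  assumes three_quasi_sasakian: "three_quasi_sasakian_manifold n T A \<phi> \<xi> \<eta> g"
begin

sublocale riemannian_mfd T A g
  using three_quasi_sasakian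
  by unfold_locales (auto simp: three_quasi_sasakian_manifold_def almost_3_contact_metric_manifold_def)

lemma quasi_sasakian: "\<alpha> \<in> {1, 2, 3} \<Longrightarrow> quasi_sasakian T A g (\<phi> \<alpha>) (\<xi> \<alpha>) (\<eta> \<alpha>)"
  using three_quasi_sasakian
  by unfold_locales (auto simp: three_quasi_sasakian_manifold_def almost_3_contact_metric_manifold_def)

lemmas reeb_field = quasi_sasakian.reeb_field[OF quasi_sasakian]
  and eta_smooth = quasi_sasakian.eta_smooth[OF quasi_sasakian]
  and reeb_tangent = quasi_sasakian.reeb_tangent[OF quasi_sasakian]
  and metric_reeb = quasi_sasakian.metric_reeb[OF quasi_sasakian]
  and metric_reeb' = quasi_sasakian.metric_reeb'[OF quasi_sasakian]
  and reeb_killing = quasi_sasakian.reeb_killing[OF quasi_sasakian]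

section \<open>Orthonormality and brackets of the three Reeb fields\<close>

definition even_perms :: "(nat \<times> nat \<times> nat) set" where
  "even_perms = {(1, 2, 3), (2, 3, 1), (3, 1, 2)}"

context
  fixes \<alpha> \<beta> \<gamma> assumes perm: "(\<alpha>, \<beta>, \<gamma>) \<in> even_perms"
begin

lemma perm_range: "\<alpha> \<in> {1, 2, 3}" "\<beta> \<in> {1, 2, 3}" "\<gamma> \<in> {1, 2, 3}"
  using perm by (auto simp: even_perms_def)

lemma perm_cycle: "(\<gamma>, \<alpha>, \<beta>) \<in> even_perms"
  using perm by (auto simp: even_perms_def)

lemma phi_reeb_next:
  assumes "p \<in> carrier A"
  shows "\<phi> \<alpha> p (\<xi> \<beta> p) = \<xi> \<gamma> p" "\<phi> \<beta> p (\<xi> \<alpha> p) = (\<lambda>f. - \<xi> \<gamma> p f)"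
proof -
  have "almost_3_contact_metric_manifold n T A \<phi> \<xi> \<eta> g"
    using three_quasi_sasakian by (simp add: three_quasi_sasakian_manifold_def)
  note all = this[unfolded almost_3_contact_metric_manifold_def, THEN conjunct2, THEN conjunct2,
      THEN conjunct2, THEN conjunct2, THEN conjunct2]
  note rel = bspec[OF all perm[unfolded even_perms_def], unfolded prod.case, THEN bspec, OF assms]
  note 1 = rel[THEN conjunct2, THEN conjunct1] and 2 = rel[THEN conjunct2, THEN conjunct2, THEN conjunct1]
  show "\<phi> \<alpha> p (\<xi> \<beta> p) = \<xi> \<gamma> p" using 1 ..
  show "\<phi> \<beta> p (\<xi> \<alpha> p) = (\<lambda>f. - \<xi> \<gamma> p f)"
    unfolding 2 by simp
qed

end

lemma phi_reeb_prev:
  assumes "(\<alpha>, \<beta>, \<gamma>) \<in> even_perms" "p \<in> carrier A"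
  shows "\<phi> \<alpha> p (\<xi> \<gamma> p) = (\<lambda>f. - \<xi> \<beta> p f)"
  using phi_reeb_next(2)[OF perm_cycle[OF assms(1)] assms(2)] .

text \<open>Up to sign, both other Reeb fields are values of \<phi> \<alpha>, and \<eta> \<alpha>
  vanishes on the image of \<phi> \<alpha>.\<close>

lemma eta_reeb_perm:
  assumes perm: "(\<alpha>, \<beta>, \<gamma>) \<in> even_perms" and p: "p \<in> carrier A"
  shows "\<eta> \<alpha> p (\<xi> \<beta> p) = 0" "\<eta> \<alpha> p (\<xi> \<gamma> p) = 0"
proof -
  interpret a: quasi_sasakian T A g "\<phi> \<alpha>" "\<xi> \<alpha>" "\<eta> \<alpha>"
    using quasi_sasakian perm_range(1)[OF perm] .
  note t = reeb_tangent[OF perm_range(2)[OF perm] p] reeb_tangent[OF perm_range(3)[OF perm] p]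
  show "\<eta> \<alpha> p (\<xi> \<gamma> p) = 0"
    using a.eta_phi[OF p t(1)] phi_reeb_next(1)[OF perm p] by simp
  show "\<eta> \<alpha> p (\<xi> \<beta> p) = 0"
    using a.eta_phi[OF p t(2)] phi_reeb_prev[OF perm p] a.eta_minus[OF p t(1)] by simp
qed

lemma eta_reeb:
  assumes "p \<in> carrier A" "\<alpha> \<in> {1, 2, 3}" "\<beta> \<in> {1, 2, 3}"
  shows "\<eta> \<alpha> p (\<xi> \<beta> p) = (if \<alpha> = \<beta> then 1 else 0)"
proof (cases "\<alpha> = \<beta>")
  case True
  then show ?thesis using quasi_sasakian.eta_reeb[OF quasi_sasakian assms(1)] assms(2) by simp
next
  case False
  then have "\<exists>\<gamma>. (\<alpha>, \<beta>, \<gamma>) \<in> even_perms \<or> (\<alpha>, \<gamma>, \<beta>) \<in> even_perms"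
    using assms(2,3) by (auto simp: even_perms_def)
  then show ?thesis using False eta_reeb_perm assms(1) by auto
qed

text \<open>Evaluate the closedness of the fundamental form \<open>\<Phi>\<close> of the structure \<open>\<alpha>\<close> on
  \<open>(\<xi> \<beta>, \<xi> \<gamma>, X)\<close>: since \<open>\<Phi>(\<xi> \<gamma>, X) = \<eta> \<beta> X\<close> and \<open>\<Phi>(X, \<xi> \<beta>) = \<eta> \<gamma> X\<close>, all terms
  but \<open>\<Phi>([\<xi> \<beta>, \<xi> \<gamma>], X)\<close> cancel by \<open>reeb_eta\<close>.\<close>

lemma lie_bracket_reeb:
  assumes perm: "(\<alpha>, \<beta>, \<gamma>) \<in> even_perms" and p: "p \<in> carrier A"
  shows "lie_bracket (\<xi> \<beta>) (\<xi> \<gamma>) p = (\<lambda>f. \<eta> \<alpha> p (lie_bracket (\<xi> \<beta>) (\<xi> \<gamma>) p) * \<xi> \<alpha> p f)"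
proof -
  note r = perm_range[OF perm]
  interpret a: quasi_sasakian T A g "\<phi> \<alpha>" "\<xi> \<alpha>" "\<eta> \<alpha>" using quasi_sasakian r(1) .
  interpret b: quasi_sasakian T A g "\<phi> \<beta>" "\<xi> \<beta>" "\<eta> \<beta>" using quasi_sasakian r(2) .
  interpret c: quasi_sasakian T A g "\<phi> \<gamma>" "\<xi> \<gamma>" "\<eta> \<gamma>" using quasi_sasakian r(3) .
  let ?F = "fundamental_form (\<phi> \<alpha>) g"
  let ?B = "lie_bracket (\<xi> \<beta>) (\<xi> \<gamma>)"
  have F_beta: "?F q v (\<xi> \<beta> q) = \<eta> \<gamma> q v" and F_gamma: "?F q v (\<xi> \<gamma> q) = - \<eta> \<beta> q v"
    and gamma_F: "?F q (\<xi> \<gamma> q) v = \<eta> \<beta> q v"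
    if q: "q \<in> carrier A" and v: "v \<in> tangent_space A q" for q v
  proof -
    note tb = b.reeb_tangent[OF q] and tc = c.reeb_tangent[OF q]
    show "?F q v (\<xi> \<beta> q) = \<eta> \<gamma> q v"
      using c.metric_reeb[OF q v] phi_reeb_next(1)[OF perm q] by (simp add: fundamental_form_def)
    show "?F q v (\<xi> \<gamma> q) = - \<eta> \<beta> q v"
      using b.metric_reeb[OF q v] phi_reeb_prev[OF perm q] metric_minus(2)[OF q tb v]
      by (simp add: fundamental_form_def)
    have "?F q (\<xi> \<gamma> q) v = - g q (\<phi> \<alpha> q (\<xi> \<gamma> q)) v"
      using a.metric_phi[OF q tc v] by (simp add: fundamental_form_def)
    then show "?F q (\<xi> \<gamma> q) v = \<eta> \<beta> q v"
      using b.metric_reeb'[OF q v] phi_reeb_prev[OF perm q] metric_minus(1)[OF q tb v] by simp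
  qed
  have B: "vector_field A ?B"
    by (rule lie_bracket_vector_field[OF b.reeb_field c.reeb_field])
  have F0: "?F p (?B p) (X p) = 0" if X: "vector_field A X" for X
  proof -
    note tX = vector_field_tangent[OF X]
    have "ext_deriv2 ?F (\<xi> \<beta>) (\<xi> \<gamma>) X p = 0"
      using a.closed b.reeb_field c.reeb_field X p by (simp add: closed_2_form_def)
    moreover have "\<xi> \<beta> p (\<lambda>q. ?F q (\<xi> \<gamma> q) (X q)) = \<xi> \<beta> p (\<lambda>q. \<eta> \<beta> q (X q))"
      by (rule sym, rule tangent_cong[OF b.reeb_tangent[OF p] b.eta_smooth[OF X]])
        (use gamma_F tX in simp)
    moreover have "\<xi> \<gamma> p (\<lambda>q. ?F q (X q) (\<xi> \<beta> q)) = \<xi> \<gamma> p (\<lambda>q. \<eta> \<gamma> q (X q))"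
      by (rule sym, rule tangent_cong[OF c.reeb_tangent[OF p] c.eta_smooth[OF X]])
        (use F_beta tX in simp)
    \<comment> \<open>\<Phi>(\<xi> \<beta>, \<xi> \<gamma>) = -\<eta> \<beta>(\<xi> \<beta>) = -1 is
      constant, so its derivative along X vanishes.\<close>
    moreover have "X p (\<lambda>q. ?F q (\<xi> \<beta> q) (\<xi> \<gamma> q)) = X p (\<lambda>q. -1)"
      by (rule sym, rule tangent_cong[OF tX[OF p] smooth_fun_const])
        (use F_gamma[OF _ b.reeb_tangent] b.eta_reeb in simp)
    moreover have "?F p (lie_bracket (\<xi> \<gamma>) X p) (\<xi> \<beta> p) = \<eta> \<gamma> p (lie_bracket (\<xi> \<gamma>) X p)"
      by (rule F_beta[OF p lie_bracket_tangent[OF c.reeb_field X p]])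
    moreover have "?F p (lie_bracket X (\<xi> \<beta>) p) (\<xi> \<gamma> p) = \<eta> \<beta> p (lie_bracket (\<xi> \<beta>) X p)"
      using F_gamma[OF p lie_bracket_tangent[OF X b.reeb_field p]] lie_bracket_swap[of X "\<xi> \<beta>" p]
        b.eta_minus[OF p lie_bracket_tangent[OF b.reeb_field X p]] by simp
    ultimately show ?thesis
      using tangent_const[OF tX[OF p]] b.reeb_eta[OF p X] c.reeb_eta[OF p X]
      by (simp add: ext_deriv2_def)
  qed
  have tB: "?B p \<in> tangent_space A p" using vector_field_tangent[OF B p] .
  \<comment> \<open>Choosing \<phi> \<alpha> of the bracket as the third field turns \<Phi>(B, X) =
    0 into the vanishing of the squared length of \<phi> \<alpha> B; the kernel of \<phi> \<alpha>
    is spanned by \<xi> \<alpha>.\<close>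
  have "g p (\<phi> \<alpha> p (?B p)) (\<phi> \<alpha> p (?B p)) = 0"
    using F0[OF a.phi_field[OF B]] a.metric_phi[OF p tB a.phi_tangent[OF p tB]]
    by (simp add: fundamental_form_def)
  then have "\<phi> \<alpha> p (?B p) = (\<lambda>f. 0)"
    using metric_eq_zero[OF p a.phi_tangent[OF p tB]] by simp
  then show ?thesis by (rule a.phi_eq_zero[OF p tB])
qed

abbreviation D where "D \<equiv> reeb_distribution \<xi>"

lemma reeb_distributionI: "v = (\<lambda>f. \<Sum>\<alpha>\<in>{1, 2, 3}. a \<alpha> * \<xi> \<alpha> p f) \<Longrightarrow> v \<in> D p"
  unfolding reeb_distribution_def by (intro CollectI exI[of _ a])

text \<open>\<eta> \<beta> is the metric dual of \<xi> \<beta> and the Reeb fields are orthonormal,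
  so the \<eta> read off the coefficients. This gives a vertical field coefficients that are smooth
  functions on M.\<close>

lemma reeb_distribution_iff:
  assumes p: "p \<in> carrier A" and v: "v \<in> tangent_space A p"
  shows "v \<in> D p \<longleftrightarrow> v = (\<lambda>f. \<Sum>\<alpha>\<in>{1, 2, 3}. \<eta> \<alpha> p v * \<xi> \<alpha> p f)"
proof
  assume "v \<in> D p"
  then obtain a where a: "v = (\<lambda>f. \<Sum>\<alpha>\<in>{1, 2, 3}. a \<alpha> * \<xi> \<alpha> p f)"
    by (auto simp: reeb_distribution_def)
  have "\<eta> \<beta> p v = a \<beta>" if b: "\<beta> \<in> {1, 2, 3}" for \<beta>
  proof -
    have "\<eta> \<beta> p v = g p (\<lambda>f. \<Sum>\<alpha>\<in>{1, 2, 3}. a \<alpha> * \<xi> \<alpha> p f) (\<xi> \<beta> p)"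
      using metric_reeb[OF b p v] a by simp
    also have "\<dots> = (\<Sum>\<alpha>\<in>{1, 2, 3}. a \<alpha> * g p (\<xi> \<alpha> p) (\<xi> \<beta> p))"
      by (rule metric_sum[OF p]) (use reeb_tangent p b in auto)
    also have "\<dots> = (\<Sum>\<alpha>\<in>{1, 2, 3}. a \<alpha> * (if \<beta> = \<alpha> then 1 else 0))"
      using metric_reeb[OF b p] reeb_tangent[OF _ p] eta_reeb[OF p b] by (intro sum.cong) auto
    also have "\<dots> = a \<beta>" using b by auto
    finally show ?thesis .
  qed
  then have "(\<lambda>f. \<Sum>\<alpha>\<in>{1, 2, 3}. \<eta> \<alpha> p v * \<xi> \<alpha> p f) = (\<lambda>f. \<Sum>\<alpha>\<in>{1, 2, 3}. a \<alpha> * \<xi> \<alpha> p f)"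
    by simp
  then show "v = (\<lambda>f. \<Sum>\<alpha>\<in>{1, 2, 3}. \<eta> \<alpha> p v * \<xi> \<alpha> p f)" using a by simp
next
  assume "v = (\<lambda>f. \<Sum>\<alpha>\<in>{1, 2, 3}. \<eta> \<alpha> p v * \<xi> \<alpha> p f)"
  then show "v \<in> D p" by (rule reeb_distributionI)
qed

lemma reeb_multiple_in_distribution:
  assumes "\<alpha> \<in> {1, 2, 3}"
  shows "(\<lambda>f. k * \<xi> \<alpha> p f) \<in> D p"
proof -
  have "(\<lambda>f. k * \<xi> \<alpha> p f) = (\<lambda>f. \<Sum>\<beta>\<in>{1, 2, 3}. (if \<beta> = \<alpha> then k else 0) * \<xi> \<beta> p f)"
    using assms by (auto simp: fun_eq_iff)
  then show ?thesis by (rule reeb_distributionI)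
qed

lemma reeb_distribution_scale:
  assumes "v \<in> D p"
  shows "(\<lambda>f. k * v f) \<in> D p"
proof -
  obtain a where a: "v = (\<lambda>f. \<Sum>\<alpha>\<in>{1, 2, 3}. a \<alpha> * \<xi> \<alpha> p f)"
    using assms by (auto simp: reeb_distribution_def)
  have "(\<lambda>f. k * v f) = (\<lambda>f. \<Sum>\<alpha>\<in>{1, 2, 3}. (k * a \<alpha>) * \<xi> \<alpha> p f)"
    unfolding a by (simp add: algebra_simps)
  then show ?thesis by (rule reeb_distributionI)
qed

lemma lie_bracket_reeb_in_distribution:
  assumes p: "p \<in> carrier A" and "\<alpha> \<in> {1, 2, 3}" "\<beta> \<in> {1, 2, 3}"
  shows "lie_bracket (\<xi> \<alpha>) (\<xi> \<beta>) p \<in> D p"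
proof -
  consider "\<alpha> = \<beta>" | \<gamma> where "(\<gamma>, \<alpha>, \<beta>) \<in> even_perms" | \<gamma> where "(\<gamma>, \<beta>, \<alpha>) \<in> even_perms"
    using assms(2,3) by (auto simp: even_perms_def)
  then show ?thesis
  proof cases
    case 1
    then have "lie_bracket (\<xi> \<alpha>) (\<xi> \<beta>) p = (\<lambda>f. 0 * \<xi> \<alpha> p f)" by (simp add: lie_bracket_def)
    then show ?thesis using reeb_multiple_in_distribution[OF assms(2)] by metis
  next
    case 2
    then show ?thesis
      using lie_bracket_reeb[OF 2 p] reeb_multiple_in_distribution perm_range(1)[OF 2] by metis
  next
    case 3
    then have "lie_bracket (\<xi> \<beta>) (\<xi> \<alpha>) p \<in> D p"
      using lie_bracket_reeb[OF 3 p] reeb_multiple_in_distribution perm_range(1)[OF 3] by metis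
    from reeb_distribution_scale[OF this, of "-1"] show ?thesis
      using lie_bracket_swap[of "\<xi> \<alpha>" "\<xi> \<beta>" p] by simp
  qed
qed

lemma integrable: "integrable_distribution TYPE(real ^ 3) A D"
proof -
  \<comment> \<open>Translates the index type \<open>3\<close> of the Frobenius theorem into the
    natural numbers that index the structures.\<close>
  define j :: "3 \<Rightarrow> nat" where "j i = (if i = 1 then 1 else if i = 2 then 2 else 3)" for i
  have j: "j i \<in> {1, 2, 3}" for i by (simp add: j_def)
  have j3: "j 1 = 1" "j 2 = 2" "j 3 = 3" by (simp_all add: j_def)
  have sum: "(\<Sum>i\<in>UNIV. a $ i * \<xi> (j i) p f) = a $ 1 * \<xi> 1 p f + a $ 2 * \<xi> 2 p f + a $ 3 * \<xi> 3 p f"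
    for a :: "real ^ 3" and p f
    by (simp add: sum_3 j3)
  have D: "D p = range (\<lambda>a::real ^ 3. \<lambda>f. \<Sum>i\<in>UNIV. a $ i * \<xi> (j i) p f)" for p
  proof (intro equalityI subsetI)
    fix v assume "v \<in> D p"
    then obtain a where a: "v = (\<lambda>f. \<Sum>\<alpha>\<in>{1, 2, 3}. a \<alpha> * \<xi> \<alpha> p f)"
      by (auto simp: reeb_distribution_def)
    have "v = (\<lambda>f. \<Sum>i\<in>UNIV. vector [a 1, a 2, a 3] $ i * \<xi> (j i) p f)"
      unfolding a sum by (simp add: fun_eq_iff)
    then show "v \<in> range (\<lambda>a::real ^ 3. \<lambda>f. \<Sum>i\<in>UNIV. a $ i * \<xi> (j i) p f)" by blast
  next
    fix v assume "v \<in> range (\<lambda>a::real ^ 3. \<lambda>f. \<Sum>i\<in>UNIV. a $ i * \<xi> (j i) p f)"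
    then obtain a :: "real ^ 3" where a: "v = (\<lambda>f. \<Sum>i\<in>UNIV. a $ i * \<xi> (j i) p f)" by blast
    have "v = (\<lambda>f. \<Sum>\<alpha>\<in>{1, 2, 3}. (if \<alpha> = 1 then a $ 1 else if \<alpha> = 2 then a $ 2 else a $ 3) * \<xi> \<alpha> p f)"
      unfolding a sum by (simp add: fun_eq_iff)
    then show "v \<in> D p" by (rule reeb_distributionI)
  qed
  have "integrable_distribution TYPE(real ^ 3) A (\<lambda>p. range (\<lambda>a::real ^ 3. \<lambda>f. \<Sum>i\<in>UNIV. a $ i * \<xi> (j i) p f))"
  proof (rule Frobenius_3)
    show "vector_field A (\<xi> (j i))" for i by (rule reeb_field[OF j])
    show "lie_bracket (\<xi> (j i)) (\<xi> (j k)) p \<in> range (\<lambda>a::real ^ 3. \<lambda>f. \<Sum>i\<in>UNIV. a $ i * \<xi> (j i) p f)"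
      if "p \<in> carrier A" for p i k
      unfolding D[symmetric] by (rule lie_bracket_reeb_in_distribution[OF that j j])
    fix p and a :: "real ^ 3"
    assume p: "p \<in> carrier A" and 0: "(\<lambda>f. \<Sum>i\<in>UNIV. a $ i * \<xi> (j i) p f) = (\<lambda>f. 0)"
    have "a $ k = 0" for k
    proof -
      have "0 = g p (\<lambda>f. \<Sum>i\<in>UNIV. a $ i * \<xi> (j i) p f) (\<xi> (j k) p)"
        unfolding 0 using metric_zero(1)[OF p reeb_tangent[OF j p]] by simp
      also have "\<dots> = (\<Sum>i\<in>UNIV. a $ i * g p (\<xi> (j i) p) (\<xi> (j k) p))"
        by (rule metric_sum[OF p reeb_tangent[OF j p] reeb_tangent[OF j p]])
      also have "\<dots> = (\<Sum>i\<in>UNIV. if k = i then a $ i else 0)"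
      proof (rule sum.cong[OF refl])
        fix i
        have "j k = j i \<longleftrightarrow> k = i" using exhaust_3[of k] exhaust_3[of i] by (auto simp: j3)
        then show "a $ i * g p (\<xi> (j i) p) (\<xi> (j k) p) = (if k = i then a $ i else 0)"
          using metric_reeb[OF j p reeb_tangent[OF j p], of i k] eta_reeb[OF p j j, of k i] by simp
      qed
      finally show ?thesis by simp
    qed
    then show "a = 0" by (simp add: vec_eq_iff)
  qed
  then show ?thesis unfolding D .
qed

lemma distribution_orthogonal:
  assumes p: "p \<in> carrier A" and v: "v \<in> D p" and w: "w \<in> tangent_space A p"
    and 0: "\<And>\<alpha>. \<alpha> \<in> {1, 2, 3} \<Longrightarrow> g p (\<xi> \<alpha> p) w = 0"
  shows "g p v w = 0"
proof -
  obtain a where a: "v = (\<lambda>f. \<Sum>\<alpha>\<in>{1, 2, 3}. a \<alpha> * \<xi> \<alpha> p f)"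
    using v by (auto simp: reeb_distribution_def)
  have "g p v w = (\<Sum>\<alpha>\<in>{1, 2, 3}. a \<alpha> * g p (\<xi> \<alpha> p) w)"
    unfolding a by (rule metric_sum[OF p]) (use reeb_tangent p w in auto)
  then show ?thesis using 0 by simp
qed

section \<open>Covariant derivatives of Reeb and vertical fields\<close>

context
  fixes nabla assumes lc: "levi_civita_connection A g nabla"
begin

lemma nabla_field: "vector_field A X \<Longrightarrow> vector_field A Y \<Longrightarrow> vector_field A (nabla X Y)"
  using lc by (auto simp: levi_civita_connection_def)

lemma nabla_torsion: "vector_field A X \<Longrightarrow> vector_field A Y \<Longrightarrow> p \<in> carrier A \<Longrightarrow>
    lie_bracket X Y p = (\<lambda>f. nabla X Y p f - nabla Y X p f)"
  using lc by (auto simp: levi_civita_connection_def fun_eq_iff)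

lemma nabla_metric: "vector_field A X \<Longrightarrow> vector_field A Y \<Longrightarrow> vector_field A Z \<Longrightarrow> p \<in> carrier A \<Longrightarrow>
    X p (\<lambda>q. g q (Y q) (Z q)) = g p (nabla X Y p) (Z p) + g p (Y p) (nabla X Z p)"
  using lc by (auto simp: levi_civita_connection_def)

text \<open>The Killing property expressed by the connection: absence of torsion rewrites the
  brackets, and the derivatives along \<xi> \<alpha> cancel by metric compatibility.\<close>

lemma nabla_killing:
  assumes a: "\<alpha> \<in> {1, 2, 3}" and p: "p \<in> carrier A" and Z: "vector_field A Z" and W: "vector_field A W"
  shows "g p (nabla Z (\<xi> \<alpha>) p) (W p) + g p (Z p) (nabla W (\<xi> \<alpha>) p) = 0"
proof -
  note x = reeb_field[OF a]
  note t = vector_field_tangent[OF Z p] vector_field_tangent[OF W p]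
    vector_field_tangent[OF nabla_field[OF x Z] p] vector_field_tangent[OF nabla_field[OF Z x] p]
    vector_field_tangent[OF nabla_field[OF x W] p] vector_field_tangent[OF nabla_field[OF W x] p]
  have "g p (lie_bracket (\<xi> \<alpha>) Z p) (W p) = g p (nabla (\<xi> \<alpha>) Z p) (W p) - g p (nabla Z (\<xi> \<alpha>) p) (W p)"
    unfolding nabla_torsion[OF x Z p] by (rule metric_diff[OF p t(3,4,2)])
  moreover have "g p (Z p) (lie_bracket (\<xi> \<alpha>) W p) = g p (Z p) (nabla (\<xi> \<alpha>) W p) - g p (Z p) (nabla W (\<xi> \<alpha>) p)"
    unfolding nabla_torsion[OF x W p] using metric_comb_right[OF p t(5,6,1), of 1 "-1"] by simp
  ultimately show ?thesis
    using reeb_killing[OF a p Z W] nabla_metric[OF x Z W p] by simp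
qed

text \<open>The Killing equations of \<open>\<xi> \<alpha>\<close> and \<open>\<xi> \<beta>\<close> and the constancy of \<open>g(\<xi> \<alpha>, \<xi> \<beta>)\<close> make the
  derivative of \<open>\<xi> \<beta>\<close> along \<open>\<xi> \<alpha>\<close> antisymmetric in \<open>\<alpha>\<close>, \<open>\<beta>\<close>, hence half the bracket.\<close>

lemma nabla_reeb:
  assumes a: "\<alpha> \<in> {1, 2, 3}" and b: "\<beta> \<in> {1, 2, 3}" and p: "p \<in> carrier A"
  shows "nabla (\<xi> \<alpha>) (\<xi> \<beta>) p \<in> D p"
proof -
  note x = reeb_field[OF a] and y = reeb_field[OF b]
  \<comment> \<open>The symmetric part serves as its own test field: by the two Killing equations
    g(Z, Z) = -Z(g(\<xi> \<alpha>, \<xi> \<beta>)), the derivative of a constant. The factors 1 fit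
    \<open>metric_comb_left\<close>.\<close>
  define Z where "Z q f = 1 * nabla (\<xi> \<alpha>) (\<xi> \<beta>) q f + 1 * nabla (\<xi> \<beta>) (\<xi> \<alpha>) q f" for q f
  have Z: "vector_field A Z"
    unfolding Z_def by (intro vector_field_comb nabla_field x y smooth_fun_const)
  note t = vector_field_tangent[OF nabla_field[OF x y] p] vector_field_tangent[OF nabla_field[OF y x] p]
    vector_field_tangent[OF Z p] vector_field_tangent[OF x p] vector_field_tangent[OF y p]
    vector_field_tangent[OF nabla_field[OF Z y] p] vector_field_tangent[OF nabla_field[OF Z x] p]
  have const: "Z p (\<lambda>q. g q (\<xi> \<alpha> q) (\<xi> \<beta> q)) = Z p (\<lambda>q. if \<beta> = \<alpha> then 1 else 0)"
    by (rule tangent_cong[OF t(3) metric_smooth[OF x y]])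
      (use metric_reeb[OF b] reeb_tangent[OF a] eta_reeb[OF _ b a] in simp)
  have "g p (nabla Z (\<xi> \<alpha>) p) (\<xi> \<beta> p) + g p (\<xi> \<alpha> p) (nabla Z (\<xi> \<beta>) p) = 0"
    using nabla_metric[OF Z x y p] const tangent_const[OF t(3)] by simp
  moreover have "g p (nabla (\<xi> \<alpha>) (\<xi> \<beta>) p) (Z p) + g p (\<xi> \<alpha> p) (nabla Z (\<xi> \<beta>) p) = 0"
    by (rule nabla_killing[OF b p x Z])
  moreover have "g p (nabla (\<xi> \<beta>) (\<xi> \<alpha>) p) (Z p) + g p (\<xi> \<beta> p) (nabla Z (\<xi> \<alpha>) p) = 0"
    by (rule nabla_killing[OF a p y Z])
  moreover have "g p (Z p) (Z p) = 1 * g p (nabla (\<xi> \<alpha>) (\<xi> \<beta>) p) (Z p) + 1 * g p (nabla (\<xi> \<beta>) (\<xi> \<alpha>) p) (Z p)"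
    unfolding Z_def[of p, abs_def] by (rule metric_comb_left[OF p t(1,2)]) (use t(3) in \<open>simp add: Z_def[abs_def]\<close>)
  ultimately have "g p (Z p) (Z p) = 0"
    using metric_sym[OF p t(5,7)] by simp
  then have "Z p = (\<lambda>f. 0)" using metric_eq_zero[OF p t(3)] by simp
  then have "nabla (\<xi> \<alpha>) (\<xi> \<beta>) p = (\<lambda>f. (1 / 2) * lie_bracket (\<xi> \<alpha>) (\<xi> \<beta>) p f)"
    unfolding nabla_torsion[OF x y p] by (auto simp: Z_def fun_eq_iff field_simps)
  then show ?thesis
    using reeb_distribution_scale[OF lie_bracket_reeb_in_distribution[OF p a b], of "1 / 2"] by simp
qed

text \<open>By metric compatibility and \<open>const\<close> it suffices that the derivative of Z
  along X is orthogonal to each \<xi> \<beta> at p. As g(\<xi> \<beta>, Z) = 0, this pairing is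
  minus that of the derivative of \<xi> \<beta> along X with Z, which the Killing equation turns
  into the pairing of X p with the derivative of \<xi> \<beta> along Z. The latter is linear in X p,
  so X may be replaced by the Reeb fields, for which \<open>nabla_reeb\<close> applies.\<close>

lemma nabla_horizontal:
  assumes X: "vector_field A X" and Y: "vector_field A Y" and Z: "vector_field A Z"
    and p: "p \<in> carrier A" and XD: "X p \<in> D p" and YD: "Y p \<in> D p"
    and ZD: "\<And>q \<alpha>. q \<in> carrier A \<Longrightarrow> \<alpha> \<in> {1, 2, 3} \<Longrightarrow> g q (\<xi> \<alpha> q) (Z q) = 0"
    and const: "X p (\<lambda>q. g q (Y q) (Z q)) = 0"
  shows "g p (nabla X Y p) (Z p) = 0"
proof -
  have tZ: "Z p \<in> tangent_space A p" using vector_field_tangent[OF Z p] .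
  have "g p (\<xi> \<beta> p) (nabla X Z p) = 0" if b: "\<beta> \<in> {1, 2, 3}" for \<beta>
  proof -
    note y = reeb_field[OF b]
    have tZy: "nabla Z (\<xi> \<beta>) p \<in> tangent_space A p"
      using vector_field_tangent[OF nabla_field[OF Z y] p] .
    have "g p (\<xi> \<alpha> p) (nabla Z (\<xi> \<beta>) p) = 0" if a: "\<alpha> \<in> {1, 2, 3}" for \<alpha>
      using nabla_killing[OF b p reeb_field[OF a] Z]
        distribution_orthogonal[OF p nabla_reeb[OF a b p] tZ ZD[OF p]] by simp
    then have "g p (X p) (nabla Z (\<xi> \<beta>) p) = 0"
      by (rule distribution_orthogonal[OF p XD tZy])
    then have "g p (nabla X (\<xi> \<beta>) p) (Z p) = 0"
      using nabla_killing[OF b p X Z] by simp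
    moreover have "X p (\<lambda>q. g q (\<xi> \<beta> q) (Z q)) = X p (\<lambda>q. 0)"
      by (rule tangent_cong[OF vector_field_tangent[OF X p] metric_smooth[OF y Z]]) (use ZD b in simp)
    ultimately show ?thesis
      using nabla_metric[OF X y Z p] tangent_const[OF vector_field_tangent[OF X p]] by simp
  qed
  then have "g p (Y p) (nabla X Z p) = 0"
    by (rule distribution_orthogonal[OF p YD vector_field_tangent[OF nabla_field[OF X Z] p]])
  then show ?thesis using nabla_metric[OF X Y Z p] const by simp
qed

end

section \<open>Leaves are totally geodesic\<close>

definition horizontal_part :: "'p vfield \<Rightarrow> 'p vfield" where
  "horizontal_part X = (\<lambda>p f. X p f - (\<Sum>\<alpha>\<in>{1, 2, 3}. \<eta> \<alpha> p (X p) * \<xi> \<alpha> p f))"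

context
  fixes X assumes X: "vector_field A X"
begin

lemma vertical_part_field: "vector_field A (\<lambda>p f. \<Sum>\<alpha>\<in>{1, 2, 3}. \<eta> \<alpha> p (X p) * \<xi> \<alpha> p f)"
  by (rule vector_field_weighted_sum) (use reeb_field eta_smooth X in auto)

lemma horizontal_part_field: "vector_field A (horizontal_part X)"
  using vector_field_comb[OF X vertical_part_field smooth_fun_const[of 1] smooth_fun_const[of "-1"]]
  by (simp only: horizontal_part_def mult_1_left mult_minus1 add_uminus_conv_diff)

lemma metric_horizontal_part:
  assumes p: "p \<in> carrier A" and w: "w \<in> tangent_space A p"
  shows "g p (horizontal_part X p) w = g p (X p) w - (\<Sum>\<alpha>\<in>{1, 2, 3}. \<eta> \<alpha> p (X p) * g p (\<xi> \<alpha> p) w)"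
proof -
  have "g p (\<lambda>f. \<Sum>\<alpha>\<in>{1, 2, 3}. \<eta> \<alpha> p (X p) * \<xi> \<alpha> p f) w = (\<Sum>\<alpha>\<in>{1, 2, 3}. \<eta> \<alpha> p (X p) * g p (\<xi> \<alpha> p) w)"
    by (rule metric_sum[OF p]) (use reeb_tangent p w in auto)
  then show ?thesis
    using metric_diff[OF p vector_field_tangent[OF X p] vector_field_tangent[OF vertical_part_field p] w]
    by (simp only: horizontal_part_def)
qed

lemma horizontal_part_orthogonal:
  assumes p: "p \<in> carrier A" and b: "\<beta> \<in> {1, 2, 3}"
  shows "g p (\<xi> \<beta> p) (horizontal_part X p) = 0"
proof -
  have "g p (horizontal_part X p) (\<xi> \<beta> p)
      = \<eta> \<beta> p (X p) - (\<Sum>\<alpha>\<in>{1, 2, 3}. \<eta> \<alpha> p (X p) * (if \<beta> = \<alpha> then 1 else 0))"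
    using metric_horizontal_part[OF p reeb_tangent[OF b p]] metric_reeb[OF b p]
      vector_field_tangent[OF X p] reeb_tangent[OF _ p] eta_reeb[OF p b] by simp
  also have "\<dots> = 0" using b by auto
  finally show ?thesis
    using metric_sym[OF p reeb_tangent[OF b p] vector_field_tangent[OF horizontal_part_field p]] by simp
qed

end

text \<open>The derivative N of Y along X is tested against its own horizontal part Z: g(N, Z) =
  g(Z, Z), so orthogonality to horizontal fields forces Z p = 0.\<close>

lemma totally_geodesic: "totally_geodesic_foliation TYPE(real ^ 3) A g D"
  unfolding totally_geodesic_foliation_def totally_geodesic_def
proof (rule allI, rule allI, rule impI, rule allI, rule impI)
  fix S and B :: "('p, real ^ 3) atlas" and nabla
  assume im: "integral_manifold A D S B" and lc: "levi_civita_connection A g nabla"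
  have mB: "smooth_manifold S B" and incl: "smooth_map B A id"
    and DB: "\<And>q. q \<in> carrier B \<Longrightarrow> submanifold_tangent_space A B q = D q"
    using im by (auto simp: integral_manifold_def immersed_submanifold_def)
  interpret B: smooth_mfd S B using mB by unfold_locales
  show "\<forall>W X Y. openin S W \<and> vector_field A X \<and> vector_field A Y \<and>
      (\<forall>q\<in>W. X q \<in> submanifold_tangent_space A B q \<and> Y q \<in> submanifold_tangent_space A B q) \<longrightarrow>
      (\<forall>p\<in>W. nabla X Y p \<in> submanifold_tangent_space A B p)"
  proof (intro allI impI ballI; elim conjE)
    fix W X Y p
    assume W: "openin S W" and X: "vector_field A X" and Y: "vector_field A Y"
      and XY: "\<forall>q\<in>W. X q \<in> submanifold_tangent_space A B q \<and> Y q \<in> submanifold_tangent_space A B q"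
      and pW: "p \<in> W"
    have WB: "W \<subseteq> carrier B" using openin_subset[OF W] B.topspace by simp
    have WA: "W \<subseteq> carrier A" using WB incl by (auto simp: smooth_map_def)
    have p: "p \<in> carrier A" using pW WA by blast
    have XD: "X q \<in> D q" and YD: "Y q \<in> D q" if "q \<in> W" for q
      using XY that DB WB by auto
    let ?N = "nabla X Y"
    have N: "vector_field A ?N" by (rule nabla_field[OF lc X Y])
    let ?Z = "horizontal_part ?N"
    have Z: "vector_field A ?Z" by (rule horizontal_part_field[OF N])
    note ZD = horizontal_part_orthogonal[OF N]
    have tZ: "?Z p \<in> tangent_space A p" by (rule vector_field_tangent[OF Z p])
    \<comment> \<open>g(Y, Z) vanishes on W, which is open in the leaf but in general not in M. The
      derivative is therefore computed inside the leaf: X p is the image of a leaf vector w, and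
      locality is applied to w and the pulled back function.\<close>
    have const: "X p (\<lambda>q. g q (Y q) (?Z q)) = 0"
    proof -
      let ?u = "\<lambda>q. g q (Y q) (?Z q)"
      have u: "smooth_fun A ?u" by (rule metric_smooth[OF Y Z])
      have u0: "?u q = 0" if "q \<in> W" for q
        using distribution_orthogonal[OF _ YD[OF that] vector_field_tangent[OF Z] ZD] WA that by blast
      obtain w where w: "w \<in> tangent_space B p" "X p = differential A id w"
        using XY pW by (auto simp: submanifold_tangent_space_def)
      have "w (?u \<circ> id) = 0"
        by (rule B.tangent_local_0[OF w(1) smooth_fun_pullback[OF smooth_manifold mB incl u] W pW])
          (use u0 in simp)
      then show ?thesis using w(2) u by (simp add: differential_def)
    qed
    have "g p (?N p) (?Z p) = 0"
      by (rule nabla_horizontal[OF lc X Y Z p XD[OF pW] YD[OF pW] ZD const])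
    then have "g p (?Z p) (?Z p) = 0"
      using metric_horizontal_part[OF N p tZ] ZD[OF p] by simp
    then have "?Z p = (\<lambda>f. 0)" by (rule metric_eq_zero[OF p tZ])
    then have "?N p f = (\<Sum>\<alpha>\<in>{1, 2, 3}. \<eta> \<alpha> p (?N p) * \<xi> \<alpha> p f)" for f
      unfolding horizontal_part_def by (simp only: fun_eq_iff right_minus_eq)
    then have "?N p = (\<lambda>f. \<Sum>\<alpha>\<in>{1, 2, 3}. \<eta> \<alpha> p (?N p) * \<xi> \<alpha> p f)" ..
    then have "?N p \<in> D p"
      using reeb_distribution_iff[OF p vector_field_tangent[OF N p]] by simp
    then show "?N p \<in> submanifold_tangent_space A B p"
      unfolding DB[OF subsetD[OF WB pW]] .
  qed
qed

text \<open>[h \<xi>, X] = h [\<xi>, X] - X(h) \<xi>: the derivatives of the coefficients of V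
  contribute a vertical vector only, which the horizontal w does not see.\<close>

lemma metric_bracket_vertical:
  assumes V: "vector_field A V" and VD: "\<And>q. q \<in> carrier A \<Longrightarrow> V q \<in> D q" and X: "vector_field A X"
    and p: "p \<in> carrier A" and w: "w \<in> tangent_space A p"
    and wD: "\<And>\<alpha>. \<alpha> \<in> {1, 2, 3} \<Longrightarrow> g p (\<xi> \<alpha> p) w = 0"
  shows "g p (lie_bracket V X p) w = (\<Sum>\<alpha>\<in>{1, 2, 3}. \<eta> \<alpha> p (V p) * g p (lie_bracket (\<xi> \<alpha>) X p) w)"
proof -
  let ?h = "\<lambda>\<alpha> q. \<eta> \<alpha> q (V q)"
  let ?I = "{1, 2, 3::nat}"
  have Veq: "V q = (\<lambda>f. \<Sum>\<alpha>\<in>?I. ?h \<alpha> q * \<xi> \<alpha> q f)" if "q \<in> carrier A" for q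
    by (rule reeb_distribution_iff[OF that vector_field_tangent[OF V that], THEN iffD1, OF VD[OF that]])
  have h: "smooth_fun A (?h \<alpha>)" if "\<alpha> \<in> ?I" for \<alpha> by (rule eta_smooth[OF that V])
  note tX = vector_field_tangent[OF X p]
  let ?a = "\<lambda>f. \<Sum>\<alpha>\<in>?I. ?h \<alpha> p * lie_bracket (\<xi> \<alpha>) X p f"
  let ?b = "\<lambda>f. \<Sum>\<alpha>\<in>?I. X p (?h \<alpha>) * \<xi> \<alpha> p f"
  have "lie_bracket V X p = (\<lambda>f. 1 * ?a f + (-1) * ?b f)"
  proof
    fix f
    have "X p (\<lambda>q. V q f) = X p (\<lambda>q. \<Sum>\<alpha>\<in>?I. ?h \<alpha> q * \<xi> \<alpha> q f)"
      by (rule tangent_cong[OF tX vector_field_smooth[OF V]]) (rule fun_cong[OF Veq])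
    also have "\<dots> = (\<Sum>\<alpha>\<in>?I. X p (\<lambda>q. ?h \<alpha> q * \<xi> \<alpha> q f))"
      by (rule tangent_sum[OF tX]) (intro smooth_fun_mult h vector_field_smooth reeb_field)
    also have "\<dots> = (\<Sum>\<alpha>\<in>?I. ?h \<alpha> p * X p (\<lambda>q. \<xi> \<alpha> q f) + \<xi> \<alpha> p f * X p (?h \<alpha>))"
      by (intro sum.cong refl tangent_mult[OF tX] h vector_field_smooth reeb_field)
    finally have "X p (\<lambda>q. V q f) = \<dots>" .
    moreover have "V p (\<lambda>q. X q f) = (\<Sum>\<alpha>\<in>?I. ?h \<alpha> p * \<xi> \<alpha> p (\<lambda>q. X q f))"
      using fun_cong[OF Veq[OF p]] .
    ultimately show "lie_bracket V X p f = 1 * ?a f + (-1) * ?b f"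
      by (simp add: lie_bracket_def algebra_simps)
  qed
  moreover have ta: "?a \<in> tangent_space A p"
    by (rule tangent_weighted_sum[OF p]) (use lie_bracket_tangent reeb_field X p in blast)
  moreover have tb: "?b \<in> tangent_space A p"
    by (rule tangent_weighted_sum[OF p]) (use reeb_tangent p in blast)
  ultimately have "g p (lie_bracket V X p) w = 1 * g p ?a w + (-1) * g p ?b w"
    using metric_comb_left[OF p ta tb w, of 1 "-1"] by simp
  moreover have "?b \<in> D p" by (rule reeb_distributionI[OF refl])
  then have "g p ?b w = 0" using distribution_orthogonal[OF p _ w wD] by blast
  moreover have "g p ?a w = (\<Sum>\<alpha>\<in>?I. ?h \<alpha> p * g p (lie_bracket (\<xi> \<alpha>) X p) w)"
    by (rule metric_sum[OF p _ w]) (use lie_bracket_tangent reeb_field X p in blast)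
  ultimately show ?thesis by simp
qed

text \<open>On horizontal fields the Lie derivative of g depends on V only pointwise, by
  \<open>metric_bracket_vertical\<close>, so it is the combination of the three Killing equations
  with coefficients \<eta> \<alpha>(V).\<close>

lemma riemannian: "riemannian_foliation A g D"
  unfolding riemannian_foliation_def
proof (intro allI impI ballI; elim conjE)
  fix V X Y p
  assume V: "vector_field A V" and X: "vector_field A X" and Y: "vector_field A Y" and p: "p \<in> carrier A"
    and D: "\<forall>p\<in>carrier A. V p \<in> D p \<and> (\<forall>u\<in>D p. g p (X p) u = 0 \<and> g p (Y p) u = 0)"
  let ?I = "{1, 2, 3::nat}"
  note t = vector_field_tangent[OF X p] vector_field_tangent[OF Y p]
  have VD: "V q \<in> D q" if "q \<in> carrier A" for q using D that by blast
  have XD: "g p (\<xi> \<alpha> p) (X p) = 0" and YD: "g p (\<xi> \<alpha> p) (Y p) = 0" if a: "\<alpha> \<in> ?I" for \<alpha>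
    using D p reeb_multiple_in_distribution[OF a, of 1 p] metric_sym[OF p reeb_tangent[OF a p]] t by auto
  have "V p (\<lambda>q. g q (X q) (Y q)) = (\<Sum>\<alpha>\<in>?I. \<eta> \<alpha> p (V p) * \<xi> \<alpha> p (\<lambda>q. g q (X q) (Y q)))"
    using fun_cong[OF reeb_distribution_iff[OF p vector_field_tangent[OF V p], THEN iffD1, OF VD[OF p]]] .
  also have "\<dots> = (\<Sum>\<alpha>\<in>?I. \<eta> \<alpha> p (V p) * g p (lie_bracket (\<xi> \<alpha>) X p) (Y p)
      + \<eta> \<alpha> p (V p) * g p (lie_bracket (\<xi> \<alpha>) Y p) (X p))"
    using reeb_killing[OF _ p X Y] metric_sym[OF p t(1) lie_bracket_tangent[OF reeb_field Y p]]
    by (intro sum.cong refl) (simp only: distrib_left)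
  also have "\<dots> = g p (lie_bracket V X p) (Y p) + g p (lie_bracket V Y p) (X p)"
    using metric_bracket_vertical[OF V VD X p t(2) YD] metric_bracket_vertical[OF V VD Y p t(1) XD]
    by (simp only: sum.distrib)
  finally show "lie_derivative_metric g V X Y p = 0"
    using metric_sym[OF p t(1) lie_bracket_tangent[OF V Y p]] by (simp add: lie_derivative_metric_def)
qed

end

theorem theorem3p4:
  fixes n :: nat
    and T :: "'p topology"
    and A :: "('p, 'e::euclidean_space) atlas"
    and \<phi> :: "nat \<Rightarrow> 'p \<Rightarrow> 'p tangent \<Rightarrow> 'p tangent"
    and \<xi> :: "nat \<Rightarrow> 'p vfield"
    and \<eta> :: "nat \<Rightarrow> 'p \<Rightarrow> 'p tangent \<Rightarrow> real"
    and g :: "'p \<Rightarrow> 'p tangent \<Rightarrow> 'p tangent \<Rightarrow> real"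
  assumes "three_quasi_sasakian_manifold n T A \<phi> \<xi> \<eta> g"
  shows "integrable_distribution TYPE(real ^ 3) A (reeb_distribution \<xi>) \<and>
    totally_geodesic_foliation TYPE(real ^ 3) A g (reeb_distribution \<xi>) \<and>
    riemannian_foliation A g (reeb_distribution \<xi>)"
proof -
  interpret three_quasi_sasakian n T A \<phi> \<xi> \<eta> g
    using assms by unfold_locales
  show ?thesis
    using integrable totally_geodesic riemannian by blast
qed

end
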